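(* Let $0<t<1$, let $a,b,z_0\in\mathbb C$, and let $K_n$ be the normalized reproducing kernel for the potential $V(z)=|z|^2-\mathrm{Re}(tz^2)$. Let $\psi\in(-\pi,\pi]$ be arbitrary if $z_0\notin\partial E_t$; if $z_0=a_t\cos\phi+i\,b_t\sin\phi\in\partial E_t$ with $\phi\in(-\pi,\pi]$, let $$\psi=\begin{cases}\arctan\left(\frac{1+t}{1-t}\tan\phi\right)&\text{if }\phi\in(-\frac\pi2,\frac\pi2),\\ \arctan\left(\frac{1+t}{1-t}\tan\phi\right)+\mathrm{sign}(\phi)\pi&\text{if }\phi\notin[-\frac\pi2,\frac\pi2],\\ \phi&\text{if }\phi=\pm\frac\pi2.\end{cases}$$ Put $$\theta_{n}=\sqrt n\,\mathrm{Im}\left(e^{-i\psi}(\overline a-\overline b)(z_0-t\,\overline{z_0})\right)+\mathrm{Im}\left(\overline ab+\tfrac t2e^{2i\psi}(a^2-b^2)\right).$$ Then, as $n\to\infty$, $$\frac1nK_n\left(z_0+\frac{ae^{i\psi}}{\sqrt n},z_0+\frac{be^{i\psi}}{\sqrt n}\right)-e^{i\theta_n}\,e^{-\frac{|a-b|^2}2}\,\kappa\ \longrightarrow\ 0,$$ where $$\kappa=\begin{cases}\frac1\pi&\text{if }z_0\text{ lies inside of }\partial E_t,\\ \frac1{2\pi}\,\mathrm{erfc}\left(\frac{\overline a+b}{\sqrt2}\right)&\text{if }z_0\in\partial E_t,\\0&\text{if }z_0\text{ lies outside of }\partial E_t.\end{cases}$$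
   Context: For $n\in\mathbb N$, let $(p_{k,n})_{k\ge0}$ be the polynomials with $\deg p_{k,n}=k$ and positive leading coefficient satisfying $\int_{\mathbb C}\overline{p_{k,n}(z)}p_{l,n}(z)e^{-nV(z)}\,d^2z=\delta_{kl}$ ($d^2z$ is Lebesgue measure). The normalized reproducing kernel is $K_n(w,z)=e^{-\frac n2(V(w)+V(z))}\sum_{k=0}^{n-1}\overline{p_{k,n}(w)}\,p_{k,n}(z)$. Let $a_t=\sqrt{\frac{1+t}{1-t}}$, $b_t=\sqrt{\frac{1-t}{1+t}}$ and $\partial E_t=\{z\in\mathbb C:\frac{(\mathrm{Re}\,z)^2}{a_t^2}+\frac{(\mathrm{Im}\,z)^2}{b_t^2}=1\}$; "inside" means the left-hand side is $<1$, "outside" means $>1$. $\mathrm{erfc}(z)=\frac{2}{\sqrt\pi}\int_z^\infty e^{-w^2}dw$ (entire function). *)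

theory Defs
  imports "HOL-Analysis.Analysis" "HOL-Computational_Algebra.Polynomial"
begin

definition orthonormal_polys :: "(complex \<Rightarrow> real) \<Rightarrow> nat \<Rightarrow> (nat \<Rightarrow> complex poly) \<Rightarrow> bool" where
  "orthonormal_polys V n p \<longleftrightarrow>
     (\<forall>k. degree (p k) = k \<and> lead_coeff (p k) \<in> \<real> \<and> Re (lead_coeff (p k)) > 0) \<and>
     (\<forall>k l. (LINT z|lborel. cnj (poly (p k) z) * poly (p l) z * of_real (exp (- real n * V z)))
            = (if k = l then 1 else 0))"

text \<open>
  No integrability condition is needed above: an integral equal to 1 is not the default
  value 0 of a non-integrable function, so the diagonal equations force every p k to be
  square integrable for the weight, and then all the products are integrable.

  The description below is well defined whenever all moments of the (finite) weight
  exp(-n V) exist. For the quadratic potential used later this holds for n > 0 but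
  not for n = 0, where the kernel is the empty sum in any case.
\<close>

definition orth_poly :: "(complex \<Rightarrow> real) \<Rightarrow> nat \<Rightarrow> nat \<Rightarrow> complex poly" where
  "orth_poly V n = (THE p. orthonormal_polys V n p)"

definition reproducing_kernel :: "(complex \<Rightarrow> real) \<Rightarrow> nat \<Rightarrow> complex \<Rightarrow> complex \<Rightarrow> complex" where
  "reproducing_kernel V n w z = of_real (exp (- (real n / 2) * (V w + V z))) *
     (\<Sum>k<n. cnj (poly (orth_poly V n k) w) * poly (orth_poly V n k) z)"

definition elliptic_potential :: "real \<Rightarrow> complex \<Rightarrow> real" where
  "elliptic_potential t z = (cmod z)\<^sup>2 - Re (of_real t * z\<^sup>2)"

definition semi_a :: "real \<Rightarrow> real" where
  "semi_a t = sqrt ((1 + t) / (1 - t))"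

definition semi_b :: "real \<Rightarrow> real" where
  "semi_b t = sqrt ((1 - t) / (1 + t))"

definition ellipse_form :: "real \<Rightarrow> complex \<Rightarrow> real" where
  "ellipse_form t z = (Re z)\<^sup>2 / (semi_a t)\<^sup>2 + (Im z)\<^sup>2 / (semi_b t)\<^sup>2"

definition ellipse :: "real \<Rightarrow> complex set" where
  "ellipse t = {z. ellipse_form t z = 1}"

definition ellipse_inside :: "real \<Rightarrow> complex set" where
  "ellipse_inside t = {z. ellipse_form t z < 1}"

text \<open>
  The integral from z to infinity is taken along the horizontal ray z + s with s \<ge> 0;
  the integrand is entire and decays like a Gaussian there, so the integral converges
  absolutely for every complex z.
\<close>

definition erfc :: "complex \<Rightarrow> complex" where
  "erfc z = of_real (2 / sqrt pi) * (LINT s:{0..}|lborel. exp (- (z + of_real s)\<^sup>2))"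

text \<open>The argument of the outward normal of the ellipse at \<open>semi_a t * cos \<phi> + \<i> * semi_b t * sin \<phi>\<close>.\<close>

definition normal_angle :: "real \<Rightarrow> real \<Rightarrow> real" where
  "normal_angle t \<phi> =
     (if \<phi> \<in> {- pi / 2 <..< pi / 2} then arctan ((1 + t) / (1 - t) * tan \<phi>)
      else if \<phi> \<notin> {- pi / 2 .. pi / 2} then arctan ((1 + t) / (1 - t) * tan \<phi>) + sgn \<phi> * pi
      else \<phi>)"

definition phase :: "real \<Rightarrow> complex \<Rightarrow> real \<Rightarrow> complex \<Rightarrow> complex \<Rightarrow> nat \<Rightarrow> real" where
  "phase t z0 \<psi> a b n =
     sqrt (real n) * Im (cis (- \<psi>) * (cnj a - cnj b) * (z0 - of_real t * cnj z0))
     + Im (cnj a * b + of_real (t / 2) * cis (2 * \<psi>) * (a\<^sup>2 - b\<^sup>2))"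

definition kappa :: "real \<Rightarrow> complex \<Rightarrow> complex \<Rightarrow> complex \<Rightarrow> complex" where
  "kappa t z0 a b =
     (if z0 \<in> ellipse_inside t then of_real (1 / pi)
      else if z0 \<in> ellipse t then of_real (1 / (2 * pi)) * erfc ((cnj a + b) / of_real (sqrt 2))
      else 0)"

end

theory Submission
  imports Defs "HOL-Probability.Probability" "HOL-Real_Asymp.Real_Asymp"
begin

text \<open>
  The orthonormal polynomials are rescaled Hermite polynomials, because multiplication by
  \<open>n (1 - t\<^sup>2) z\<close> minus \<open>t d/dz\<close> is adjoint to \<open>d/dz\<close> for the weight. Mehler's formula then
  gives a closed form for the generating function of the summands
  \<open>cnj (p\<^sub>k w) * p\<^sub>k z\<close> of the kernel, on and slightly beyond the unit circle.
  On the diagonal the suitably normalised summands form a probability distribution in \<open>k\<close>, and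
  the kernel is the probability of \<open>k < n\<close>. The mean of \<open>k / n\<close> tends to the value of the ellipse
  form at \<open>z0\<close>: off the ellipse a Chernoff bound shows that this probability tends to 1 or 0,
  and on the ellipse the central limit theorem, in the form of Levy's continuity theorem,
  gives the error function. For \<open>a \<noteq> b\<close> the complex weights are treated off the ellipse by
  Cauchy-Schwarz type bounds and on the ellipse by polarization, the limiting
  complex Gaussian density being itself a product \<open>cnj (f y) * g y\<close>.
\<close>

section \<open>Gaussian integrals over the complex plane\<close>

text \<open>The index \<open>k\<close> behaves like a random variable with mean about
  \<open>n\<close> times the ellipse form at \<open>z0\<close>. Displacing the point by order
  \<open>1 / sqrt n\<close> moves this mean by order \<open>sqrt n\<close>, which is also the order
  of the fluctuations; hence an error function on the ellipse instead of a step. To this order the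
  mean only sees the component of the displacement along the gradient of the form, which is how the
  angle \<psi> enters. The coincidence behind the universal limit is that on the ellipse the
  limiting variance of \<open>k / sqrt n\<close> is the squared length of half that gradient, so
  that rescaling removes both \<open>t\<close> and the position of \<open>z0\<close>.

  For \<open>a \<noteq> b\<close> the summands are complex and their phases oscillate with
  \<open>n\<close>. The oscillation splits into a function of \<open>a\<close> and one of
  \<open>b\<close>, which are absorbed into amplitudes; the amplitudes are then superposed to
  produce genuine nonnegative weights, whose characteristic functions are available because Mehler's
  formula allows independent arguments.

  The generating function converges for \<open>cmod r < 1 / t\<close>. This margin beyond the unit
  circle supplies the tilt \<open>r > 1\<close> for the tail estimate inside the ellipse.\<close>

lemma lborel_complex_distr:
  "(lborel :: complex measure) = distr (lborel \<Otimes>\<^sub>M lborel) borel (\<lambda>(x, y). Complex x y)"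
proof (rule lborel_eqI)
  have meas [measurable]: "(\<lambda>(x, y). Complex x y) \<in> borel_measurable (borel \<Otimes>\<^sub>M borel)"
    by (simp add: borel_prod split_beta')
       (intro borel_measurable_continuous_onI, simp add: Complex_eq continuous_intros)
  fix l u :: complex
  assume le: "\<And>b. b \<in> Basis \<Longrightarrow> l \<bullet> b \<le> u \<bullet> b"
  have "emeasure (distr (lborel \<Otimes>\<^sub>M lborel) borel (\<lambda>(x, y). Complex x y)) (box l u)
      = emeasure (lborel \<Otimes>\<^sub>M lborel) ({Re l<..<Re u} \<times> {Im l<..<Im u})"
    by (subst emeasure_distr)
       (auto intro!: arg_cong[where f = "emeasure (lborel \<Otimes>\<^sub>M lborel)"]
             simp: box_def Basis_complex_def space_pair_measure)
  then show "emeasure (distr (lborel \<Otimes>\<^sub>M lborel) borel (\<lambda>(x, y). Complex x y)) (box l u)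
      = ennreal (\<Prod>b\<in>Basis. (u - l) \<bullet> b)"
    using le[of 1] le[of \<i>]
    by (simp add: lborel.emeasure_pair_measure_Times Basis_complex_def ennreal_mult'')
qed simp

lemma
  fixes f :: "complex \<Rightarrow> 'a :: {banach, second_countable_topology}"
  assumes [measurable]: "f \<in> borel_measurable borel"
  shows integrable_complex_iff:
      "integrable lborel f \<longleftrightarrow> integrable (lborel \<Otimes>\<^sub>M lborel) (\<lambda>(x, y). f (Complex x y))"
    and integral_complex_pair:
      "integral\<^sup>L lborel f = integral\<^sup>L (lborel \<Otimes>\<^sub>M lborel) (\<lambda>(x, y). f (Complex x y))"
proof -
  have [measurable]: "(\<lambda>(x, y). Complex x y) \<in> borel_measurable (lborel \<Otimes>\<^sub>M lborel)"
    by (subst measurable_cong_sets[OF sets_pair_measure_cong[OF sets_lborel sets_lborel] refl])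
       (simp add: borel_prod split_beta',
        intro borel_measurable_continuous_onI, simp add: Complex_eq continuous_intros)
  show "integrable lborel f \<longleftrightarrow> integrable (lborel \<Otimes>\<^sub>M lborel) (\<lambda>(x, y). f (Complex x y))"
    by (subst lborel_complex_distr, subst integrable_distr_eq) (auto simp: split_beta')
  show "integral\<^sup>L lborel f = integral\<^sup>L (lborel \<Otimes>\<^sub>M lborel) (\<lambda>(x, y). f (Complex x y))"
    by (subst lborel_complex_distr, subst integral_distr) (auto simp: split_beta')
qed

lemma
  fixes p :: real
  assumes "p > 0"
  shows integrable_gaussian: "integrable lborel (\<lambda>x. exp (- (p * x\<^sup>2)))"
    and integral_gaussian: "(LINT x|lborel. exp (- (p * x\<^sup>2))) = sqrt (pi / p)"
proof -
  define \<sigma> where "\<sigma> = sqrt (1 / (2 * p))"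
  have s: "\<sigma>\<^sup>2 = 1 / (2 * p)" using assms by (simp add: \<sigma>_def)
  have eq: "exp (- (p * x\<^sup>2)) = sqrt (pi / p) * normal_density 0 \<sigma> x" for x
    using assms by (simp add: normal_density_def s field_simps real_sqrt_divide real_sqrt_mult)
  have "\<sigma> > 0" using assms by (simp add: \<sigma>_def)
  then show "integrable lborel (\<lambda>x. exp (- (p * x\<^sup>2)))"
    "(LINT x|lborel. exp (- (p * x\<^sup>2))) = sqrt (pi / p)"
    by (simp_all add: eq)
qed

lemma
  fixes p q :: real
  assumes "p > 0" "q > 0"
  shows integrable_gaussian_complex:
      "integrable lborel (\<lambda>z. exp (- (p * (Re z)\<^sup>2 + q * (Im z)\<^sup>2)))"
    and integral_gaussian_complex:
      "(LINT z|lborel. exp (- (p * (Re z)\<^sup>2 + q * (Im z)\<^sup>2))) = pi / sqrt (p * q)"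
proof -
  have [measurable]: "(\<lambda>z. exp (- (p * (Re z)\<^sup>2 + q * (Im z)\<^sup>2))) \<in> borel_measurable borel"
    by (intro borel_measurable_continuous_onI continuous_intros)
  have eq: "(\<lambda>(x, y). exp (- (p * (Re (Complex x y))\<^sup>2 + q * (Im (Complex x y))\<^sup>2)))
      = (\<lambda>(x, y). exp (- (p * x\<^sup>2)) * exp (- (q * y\<^sup>2)))"
    by (auto simp: exp_add exp_diff exp_minus field_simps)
  have int: "integrable (lborel \<Otimes>\<^sub>M lborel) (\<lambda>(x, y). exp (- (p * x\<^sup>2)) * exp (- (q * y\<^sup>2)))"
    using assms
    by (intro lborel_pair.Fubini_integrable)
       (auto simp: integral_gaussian integrable_gaussian abs_mult)
  then show "integrable lborel (\<lambda>z. exp (- (p * (Re z)\<^sup>2 + q * (Im z)\<^sup>2)))"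
    by (subst integrable_complex_iff) (simp_all only: eq, measurable)
  show "(LINT z|lborel. exp (- (p * (Re z)\<^sup>2 + q * (Im z)\<^sup>2))) = pi / sqrt (p * q)"
  proof -
    have "(LINT z|lborel. exp (- (p * (Re z)\<^sup>2 + q * (Im z)\<^sup>2)))
        = (LINT x|lborel. LINT y|lborel. exp (- (p * x\<^sup>2)) * exp (- (q * y\<^sup>2)))"
      unfolding lborel_pair.integral_fst[OF int] by (subst integral_complex_pair) (simp_all only: eq, measurable)
    also have "\<dots> = sqrt (pi / p) * sqrt (pi / q)"
      unfolding integral_mult_right_zero integral_mult_left_zero
      using assms by (simp only: integral_gaussian)
    finally show ?thesis
      using assms by (simp add: real_sqrt_divide real_sqrt_mult)
  qed
qed

text \<open>The fundamental theorem of calculus on the whole line: the bound on \<open>F\<close>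
  kills both boundary terms and the bound on \<open>f\<close> gives integrability. All integrations
  by parts below rest on this.\<close>

lemma integral_deriv_eq_0:
  fixes F f :: "real \<Rightarrow> complex"
  assumes F: "\<And>x. (F has_vector_derivative f x) (at x)"
    and f: "continuous_on UNIV f"
    and bF: "\<And>x. norm (F x) \<le> C * exp (- (p * x\<^sup>2))"
    and bf: "\<And>x. norm (f x) \<le> D * exp (- (p * x\<^sup>2))"
    and p: "p > 0"
  shows "(LINT x|lborel. f x) = 0"
proof -
  have int: "integrable lborel f"
    by (rule Bochner_Integration.integrable_bound[OF integrable_mult_right[OF integrable_gaussian[OF p], of D]])
       (auto intro!: always_eventually order.trans[OF bf] borel_measurable_continuous_onI f)
  have b0: "filterlim (\<lambda>x. C * exp (- (p * x\<^sup>2))) (nhds 0) at_top"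
           "filterlim (\<lambda>x. C * exp (- (p * x\<^sup>2))) (nhds 0) at_bot"
    using p by real_asymp+
  have top: "(F \<longlongrightarrow> 0) at_top" and bot: "(F \<longlongrightarrow> 0) at_bot"
    by (rule Lim_null_comparison[OF always_eventually b0(1)], simp add: bF)
       (rule Lim_null_comparison[OF always_eventually b0(2)], simp add: bF)
  have "(LBINT x=-\<infinity>..\<infinity>. f x) = 0 - 0"
  proof (rule interval_integral_FTC_integrable[where F = F])
    show "((F \<circ> real_of_ereal) \<longlongrightarrow> 0) (at_right (-\<infinity>))"
      using bot by (simp add: ereal_tendsto_simps)
    show "((F \<circ> real_of_ereal) \<longlongrightarrow> 0) (at_left \<infinity>)"
      using top by (simp add: ereal_tendsto_simps)
    show "set_integrable lborel (einterval (-\<infinity>) \<infinity>) f"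
      using int by (simp add: set_integrable_def einterval_eq_UNIV)
    show "isCont f x" for x
      using f by (simp add: continuous_on_eq_continuous_at)
  qed (simp_all add: F)
  then show ?thesis
    by (simp add: interval_lebesgue_integral_def set_lebesgue_integral_def einterval_eq_UNIV)
qed

section \<open>The weighted inner product and integration by parts\<close>

lemma elliptic_potential_eq:
  "elliptic_potential t z = (1 - t) * (Re z)\<^sup>2 + (1 + t) * (Im z)\<^sup>2"
  by (simp add: elliptic_potential_def cmod_power2, simp add: power2_eq_square algebra_simps)

text \<open>Half of \<epsilon> pays for the polynomial from the induction hypothesis and the other
  half absorbs the new factor \<open>z\<close>, which is why \<epsilon> is generalised in the
  induction.\<close>

lemma poly_gaussian_bound:
  fixes p :: "complex poly"
  assumes "\<epsilon> > 0"
  obtains C where "C \<ge> 0" "\<And>z. cmod (poly p z) \<le> C * exp (\<epsilon> * (cmod z)\<^sup>2)"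
  using assms
proof (induction p arbitrary: \<epsilon> thesis)
  case 0
  then show ?case by (metis mult_zero_left norm_zero order_refl poly_0)
next
  case (pCons a p)
  obtain C where C: "C \<ge> 0" "\<And>z. cmod (poly p z) \<le> C * exp (\<epsilon> / 2 * (cmod z)\<^sup>2)"
    using pCons(2)[of "\<epsilon> / 2"] pCons.prems by auto
  have "cmod (poly (pCons a p) z) \<le> (cmod a + (1 + 2 / \<epsilon>) * C) * exp (\<epsilon> * (cmod z)\<^sup>2)" for z
  proof -
    define u where "u = \<epsilon> / 2 * (cmod z)\<^sup>2"
    have u: "u \<ge> 0" "exp (\<epsilon> * (cmod z)\<^sup>2) = exp u * exp u"
      using pCons.prems by (auto simp: u_def mult_exp_exp)
    have "cmod z \<le> 1 + (cmod z)\<^sup>2"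
      using sum_power2_ge_zero[of "cmod z - 1" 0] by (simp add: power2_eq_square algebra_simps)
        (smt (verit) mult_nonneg_nonneg norm_ge_zero)
    also have "\<dots> = 1 + 2 / \<epsilon> * u" using pCons.prems by (simp add: u_def)
    also have "\<dots> \<le> exp u + 2 / \<epsilon> * exp u"
      using u pCons.prems exp_ge_add_one_self[of u] by (intro add_mono mult_left_mono) (auto simp del: exp_ge_add_one_self)
    finally have "cmod z \<le> (1 + 2 / \<epsilon>) * exp u" by (simp add: algebra_simps)
    then have "cmod z * cmod (poly p z) \<le> ((1 + 2 / \<epsilon>) * exp u) * (C * exp u)"
      using C(2)[of z] C(1) pCons.prems by (intro mult_mono) (auto simp: u_def)
    moreover have "cmod a \<le> cmod a * (exp u * exp u)"
      using u by (simp add: mult_le_cancel_left1 mult_exp_exp)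
    moreover have "cmod (poly (pCons a p) z) \<le> cmod a + cmod z * cmod (poly p z)"
      by (simp add: norm_triangle_le norm_mult)
    ultimately show ?thesis unfolding u(2) by (simp add: algebra_simps)
  qed
  then show ?case
    using pCons.prems C(1) by (intro pCons.prems(1)[of "cmod a + (1 + 2 / \<epsilon>) * C"]) auto
qed

lemma poly_Complex_vector_derivative:
  fixes f :: "complex poly"
  shows "((\<lambda>x. poly f (Complex x y)) has_vector_derivative poly (pderiv f) (Complex x y)) (at x)"
    and "((\<lambda>y. poly f (Complex x y)) has_vector_derivative \<i> * poly (pderiv f) (Complex x y)) (at y)"
proof -
  have "((\<lambda>x. Complex x y) has_vector_derivative 1) (at x)" 
       "((\<lambda>y. Complex x y) has_vector_derivative \<i>) (at y)"
    unfolding Complex_eq by (auto intro!: derivative_eq_intros)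
  from this[THEN field_vector_diff_chain_at, OF poly_DERIV, of f]
  show "((\<lambda>x. poly f (Complex x y)) has_vector_derivative poly (pderiv f) (Complex x y)) (at x)"
    and "((\<lambda>y. poly f (Complex x y)) has_vector_derivative \<i> * poly (pderiv f) (Complex x y)) (at y)"
    by (simp_all add: o_def)
qed

definition weighted :: "real \<Rightarrow> real \<Rightarrow> complex poly \<Rightarrow> complex poly \<Rightarrow> complex \<Rightarrow> complex" where
  "weighted t m f g z = cnj (poly f z) * poly g z * of_real (exp (- m * elliptic_potential t z))"

definition ip :: "real \<Rightarrow> real \<Rightarrow> complex poly \<Rightarrow> complex poly \<Rightarrow> complex" where
  "ip t m f g = (LINT z|lborel. weighted t m f g z)"

context
  fixes t m :: real
  assumes t: "0 < t" "t < 1" and m: "m > 0"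
begin

lemma weighted_bound:
  obtains C where "\<And>z. cmod (weighted t m f g z) \<le> C * exp (- (m * (1 - t) / 2 * (cmod z)\<^sup>2))"
proof -
  \<comment> \<open>Each polynomial may use up a quarter of the decay rate
    \<open>m * (1 - t)\<close> of the weight, so half of that rate survives.\<close>
  define \<epsilon> where "\<epsilon> = m * (1 - t) / 4"
  have e: "\<epsilon> > 0" using t m by (simp add: \<epsilon>_def)
  obtain A where A: "A \<ge> 0" "\<And>z. cmod (poly f z) \<le> A * exp (\<epsilon> * (cmod z)\<^sup>2)"
    using poly_gaussian_bound[OF e, of f] by blast
  obtain B where B: "B \<ge> 0" "\<And>z. cmod (poly g z) \<le> B * exp (\<epsilon> * (cmod z)\<^sup>2)"
    using poly_gaussian_bound[OF e, of g] by blast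
  have "cmod (weighted t m f g z) \<le> A * B * exp (- (m * (1 - t) / 2 * (cmod z)\<^sup>2))" for z
  proof -
    have "(1 - t) * (cmod z)\<^sup>2 \<le> elliptic_potential t z"
      using t by (simp add: elliptic_potential_eq cmod_power2 algebra_simps mult_mono)
    then have "- m * elliptic_potential t z \<le> - (4 * \<epsilon>) * (cmod z)\<^sup>2"
      using m by (simp add: \<epsilon>_def mult.assoc)
    then have "cmod (weighted t m f g z)
        \<le> (A * exp (\<epsilon> * (cmod z)\<^sup>2)) * (B * exp (\<epsilon> * (cmod z)\<^sup>2)) * exp (- (4 * \<epsilon>) * (cmod z)\<^sup>2)"
      unfolding weighted_def norm_mult complex_mod_cnj
      by (intro mult_mono A(2) B(2)) (auto intro!: mult_nonneg_nonneg A(1) B(1))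
    also have "\<dots> = A * B * (exp (\<epsilon> * (cmod z)\<^sup>2) * exp (\<epsilon> * (cmod z)\<^sup>2) * exp (- (4 * \<epsilon>) * (cmod z)\<^sup>2))"
      by (simp add: mult_ac)
    also have "\<dots> = A * B * exp (- (m * (1 - t) / 2 * (cmod z)\<^sup>2))"
      unfolding mult_exp_exp by (simp add: \<epsilon>_def field_simps)
    finally show ?thesis .
  qed
  then show thesis by (rule that)
qed

lemma continuous_weighted: "continuous_on UNIV (weighted t m f g)"
  unfolding weighted_def elliptic_potential_eq by (intro continuous_intros)

lemma measurable_weighted [measurable]: "weighted t m f g \<in> borel_measurable borel"
  by (rule borel_measurable_continuous_onI[OF continuous_weighted])

lemma integrable_weighted: "integrable lborel (weighted t m f g)"
proof -
  obtain C where C: "\<And>z. cmod (weighted t m f g z) \<le> C * exp (- (m * (1 - t) / 2 * (cmod z)\<^sup>2))"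
    using weighted_bound by blast
  have "integrable lborel (\<lambda>z. exp (- (m * (1 - t) / 2 * (cmod z)\<^sup>2)))"
    using integrable_gaussian_complex[of "m * (1 - t) / 2" "m * (1 - t) / 2"] t m
    by (simp add: cmod_power2 distrib_left)
  then have int: "integrable lborel (\<lambda>z. C * exp (- (m * (1 - t) / 2 * (cmod z)\<^sup>2)))"
    by simp
  have "norm (weighted t m f g z) \<le> norm (C * exp (- (m * (1 - t) / 2 * (cmod z)\<^sup>2)))" for z
    using C[of z] by simp
  then show ?thesis
    by (intro Bochner_Integration.integrable_bound[OF int _ always_eventually] allI) measurable
qed

lemma ip_linear:
  "ip t m f (g + h) = ip t m f g + ip t m f h"
  "ip t m f (smult c g) = c * ip t m f g"
  "ip t m (f + h) g = ip t m f g + ip t m h g"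
  "ip t m (smult c f) g = cnj c * ip t m f g"
proof -
  have "weighted t m f (g + h) = (\<lambda>z. weighted t m f g z + weighted t m f h z)"
    "weighted t m f (smult c g) = (\<lambda>z. c * weighted t m f g z)"
    "weighted t m (f + h) g = (\<lambda>z. weighted t m f g z + weighted t m h g z)"
    "weighted t m (smult c f) g = (\<lambda>z. cnj c * weighted t m f g z)"
    by (auto simp: weighted_def algebra_simps)
  then show "ip t m f (g + h) = ip t m f g + ip t m f h"
    "ip t m f (smult c g) = c * ip t m f g"
    "ip t m (f + h) g = ip t m f g + ip t m h g"
    "ip t m (smult c f) g = cnj c * ip t m f g"
    unfolding ip_def by (simp_all add: integrable_weighted)
qed

lemma ip_cnj: "ip t m g f = cnj (ip t m f g)"
  
proof -
  have "weighted t m g f = (\<lambda>z. cnj (weighted t m f g z))" by (auto simp: weighted_def)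
  then show ?thesis by (simp add: ip_def)
qed

lemma ip_1_1: "ip t m 1 1 = of_real (pi / (m * sqrt (1 - t\<^sup>2)))"
proof -
  have "ip t m 1 1 = of_real (LINT z|lborel. exp (- (m * (1 - t) * (Re z)\<^sup>2 + m * (1 + t) * (Im z)\<^sup>2)))"
    unfolding ip_def integral_complex_of_real[symmetric]
    by (intro Bochner_Integration.integral_cong) (simp_all add: weighted_def elliptic_potential_eq algebra_simps del: of_real_exp)
  also have "\<dots> = of_real (pi / sqrt ((m * (1 - t)) * (m * (1 + t))))"
    using t m by (subst integral_gaussian_complex) auto
  also have "(m * (1 - t)) * (m * (1 + t)) = m\<^sup>2 * (1 - t\<^sup>2)"
    by (simp add: power2_eq_square algebra_simps)
  finally show ?thesis using m by (simp add: real_sqrt_mult)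
qed

end

text \<open>Fubini with the inner integral taken in the direction of the derivative, where it
  vanishes by \<open>integral_deriv_eq_0\<close>. In polar terms the Gaussian bound depends on the
  modulus only, so it factorises over the two coordinates.\<close>

lemma
  fixes F h :: "complex \<Rightarrow> complex"
  assumes h: "continuous_on UNIV h"
    and bF: "\<And>z. norm (F z) \<le> C * exp (- (p * (cmod z)\<^sup>2))"
    and bh: "\<And>z. norm (h z) \<le> D * exp (- (p * (cmod z)\<^sup>2))"
    and p: "p > 0"
  shows integral_partial_x_eq_0:
      "(\<And>x y. ((\<lambda>x. F (Complex x y)) has_vector_derivative h (Complex x y)) (at x)) \<Longrightarrow>
       (LINT z|lborel. h z) = 0"
    and integral_partial_y_eq_0:
      "(\<And>x y. ((\<lambda>y. F (Complex x y)) has_vector_derivative h (Complex x y)) (at y)) \<Longrightarrow>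
       (LINT z|lborel. h z) = 0"
proof -
  have [measurable]: "h \<in> borel_measurable borel"
    by (rule borel_measurable_continuous_onI[OF h])
  have "integrable lborel (\<lambda>z. exp (- (p * (cmod z)\<^sup>2)))"
    using integrable_gaussian_complex[OF p p] by (simp add: cmod_power2 distrib_left)
  then have int_D: "integrable lborel (\<lambda>z. D * exp (- (p * (cmod z)\<^sup>2)))"
    by simp
  have "integrable lborel h"
  proof (rule Bochner_Integration.integrable_bound[OF int_D _ always_eventually], measurable, rule allI)
    show "norm (h z) \<le> norm (D * exp (- (p * (cmod z)\<^sup>2)))" for z
      using bh[of z] by simp
  qed
  then have int: "integrable (lborel \<Otimes>\<^sub>M lborel) (\<lambda>(x, y). h (Complex x y))"
    by (simp add: integrable_complex_iff)
  have e: "exp (- (p * (cmod (Complex x y))\<^sup>2)) = exp (- (p * x\<^sup>2)) * exp (- (p * y\<^sup>2))" for x y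
    by (simp add: cmod_power2 mult_exp_exp distrib_left)
  have Cx: "continuous_on UNIV (\<lambda>x. h (Complex x y))" for y
    by (rule continuous_on_compose2[OF h _ subset_UNIV]) (unfold Complex_eq, intro continuous_intros)
  have Cy: "continuous_on UNIV (\<lambda>y. h (Complex x y))" for x
    by (rule continuous_on_compose2[OF h _ subset_UNIV]) (unfold Complex_eq, intro continuous_intros)
  {
    assume F: "\<And>x y. ((\<lambda>x. F (Complex x y)) has_vector_derivative h (Complex x y)) (at x)"
    have "(LINT x|lborel. h (Complex x y)) = 0" for y
    proof (rule integral_deriv_eq_0[OF F Cx _ _ p])
      show "norm (F (Complex x y)) \<le> C * exp (- (p * y\<^sup>2)) * exp (- (p * x\<^sup>2))" for x
        using bF[of "Complex x y"] unfolding e by (simp only: mult_ac)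
      show "norm (h (Complex x y)) \<le> D * exp (- (p * y\<^sup>2)) * exp (- (p * x\<^sup>2))" for x
        using bh[of "Complex x y"] unfolding e by (simp only: mult_ac)
    qed
    then show "(LINT z|lborel. h z) = 0"
      unfolding integral_complex_pair[OF \<open>h \<in> borel_measurable borel\<close>]
        lborel_pair.integral_snd[OF int, symmetric] by simp
  }
  {
    assume F: "\<And>x y. ((\<lambda>y. F (Complex x y)) has_vector_derivative h (Complex x y)) (at y)"
    have "(LINT y|lborel. h (Complex x y)) = 0" for x
    proof (rule integral_deriv_eq_0[OF F Cy _ _ p])
      show "norm (F (Complex x y)) \<le> C * exp (- (p * x\<^sup>2)) * exp (- (p * y\<^sup>2))" for y
        using bF[of "Complex x y"] unfolding e by (simp only: mult_ac)
      show "norm (h (Complex x y)) \<le> D * exp (- (p * x\<^sup>2)) * exp (- (p * y\<^sup>2))" for y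
        using bh[of "Complex x y"] unfolding e by (simp only: mult_ac)
    qed
    then show "(LINT z|lborel. h z) = 0"
      unfolding integral_complex_pair[OF \<open>h \<in> borel_measurable borel\<close>]
        lborel_pair.integral_fst[OF int, symmetric] by simp
  }
qed

context
  fixes t m :: real
  assumes t: "0 < t" "t < 1" and m: "m > 0"
begin

text \<open>The combination has the shape of both partial derivatives of \<open>weighted\<close>:
  two terms from differentiating the polynomials and a third from the weight, in which a real
  coordinate is expressed through \<open>z\<close> and its conjugate.\<close>

lemma combination_bound:
  "\<exists>D. \<forall>z. cmod (c1 * weighted t m f1 g1 z + c2 * weighted t m f2 g2 z
          + c3 * (weighted t m f3 g3 z + c4 * weighted t m f4 g4 z))
       \<le> D * exp (- (m * (1 - t) / 2 * (cmod z)\<^sup>2))"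
proof -
  have "\<exists>C. \<forall>z. cmod (weighted t m f g z) \<le> C * exp (- (m * (1 - t) / 2 * (cmod z)\<^sup>2))" for f g
    using weighted_bound[OF t m, of f g] by metis
  then obtain C where C: "\<And>f g z. cmod (weighted t m f g z) \<le> C f g * exp (- (m * (1 - t) / 2 * (cmod z)\<^sup>2))"
    by metis
  have "cmod (c1 * weighted t m f1 g1 z + c2 * weighted t m f2 g2 z
          + c3 * (weighted t m f3 g3 z + c4 * weighted t m f4 g4 z))
     \<le> (cmod c1 * C f1 g1 + cmod c2 * C f2 g2 + cmod c3 * (C f3 g3 + cmod c4 * C f4 g4))
        * exp (- (m * (1 - t) / 2 * (cmod z)\<^sup>2))" (is "cmod (?a + ?b + c3 * (?c + c4 * ?d)) \<le> ?R") for z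
  proof -
    let ?E = "exp (- (m * (1 - t) / 2 * (cmod z)\<^sup>2))"
    have "cmod (?a + ?b + c3 * (?c + c4 * ?d))
        \<le> cmod ?a + cmod ?b + cmod (c3 * (?c + c4 * ?d))"
      by (intro norm_triangle_le add_mono norm_triangle_ineq order_refl)
    also have "\<dots> \<le> cmod c1 * (C f1 g1 * ?E) + cmod c2 * (C f2 g2 * ?E)
        + cmod c3 * (C f3 g3 * ?E + cmod c4 * (C f4 g4 * ?E))"
      unfolding norm_mult
      by (intro add_mono mult_left_mono C order.trans[OF norm_triangle_ineq] norm_ge_zero order_refl)
         (simp only: norm_mult, intro mult_left_mono C norm_ge_zero)
    also have "\<dots> = ?R" by (simp add: algebra_simps)
    finally show ?thesis .
  qed
  then show ?thesis by blast
qed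

abbreviation X_poly :: "complex poly \<Rightarrow> complex poly" where "X_poly \<equiv> pCons 0"

lemma ip_partial_x:
  "ip t m (pderiv f) g + ip t m f (pderiv g)
   = of_real (m * (1 - t)) * (ip t m f (X_poly g) + ip t m (X_poly f) g)"
proof -
  \<comment> \<open>The x-derivative of \<open>weighted t m f g\<close>. The weight contributes the
    factor \<open>2 * x = z + cnj z\<close>, and \<open>z\<close> is absorbed into \<open>g\<close>,
    \<open>cnj z\<close> into \<open>f\<close>.\<close>
  define h where "h = (\<lambda>z. 1 * weighted t m (pderiv f) g z + 1 * weighted t m f (pderiv g) z
     + of_real (- (m * (1 - t))) * (weighted t m f (X_poly g) z + 1 * weighted t m (X_poly f) g z))"
  obtain C where C: "\<And>z. cmod (weighted t m f g z) \<le> C * exp (- (m * (1 - t) / 2 * (cmod z)\<^sup>2))"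
    using weighted_bound[OF t m] by blast
  obtain D where D: "\<And>z. cmod (h z) \<le> D * exp (- (m * (1 - t) / 2 * (cmod z)\<^sup>2))"
    using combination_bound unfolding h_def by metis
  have "(LINT z|lborel. h z) = 0"
  proof (rule integral_partial_x_eq_0[OF _ C D])
    fix x y
    have w: "((\<lambda>x. complex_of_real (exp (- m * elliptic_potential t (Complex x y)))) has_vector_derivative
        of_real (- (m * (1 - t) * (2 * x)) * exp (- m * elliptic_potential t (Complex x y)))) (at x)"
      unfolding elliptic_potential_eq
      by (auto intro!: derivative_eq_intros has_vector_derivative_of_real simp: algebra_simps
          simp del: of_real_exp simp flip: has_real_derivative_iff_has_vector_derivative)
    have x: "complex_of_real x = (Complex x y + cnj (Complex x y)) / 2"
      by (simp add: complex_eq_iff)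
    show "((\<lambda>x. weighted t m f g (Complex x y)) has_vector_derivative h (Complex x y)) (at x)"
      unfolding weighted_def h_def
      by (rule has_vector_derivative_eq_rhs[OF has_vector_derivative_mult[OF has_vector_derivative_mult[OF
            has_vector_derivative_cnj[OF poly_Complex_vector_derivative(1)]
            poly_Complex_vector_derivative(1)] w]])
         (simp only: of_real_mult of_real_minus of_real_numeral x poly_pCons complex_cnj_mult complex_cnj_add complex_cnj_zero, simp add: field_simps)
    show "continuous_on UNIV h"
      unfolding h_def by (intro continuous_intros continuous_weighted t m)
    show "m * (1 - t) / 2 > 0" using t m by simp
  qed
  moreover have "(LINT z|lborel. h z) = ip t m (pderiv f) g + ip t m f (pderiv g)
      - of_real (m * (1 - t)) * (ip t m f (X_poly g) + ip t m (X_poly f) g)"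
    unfolding h_def ip_def using integrable_weighted[OF t m] by simp
  ultimately show ?thesis by (simp only: right_minus_eq)
qed

lemma ip_partial_y:
  "ip t m f (pderiv g) - ip t m (pderiv f) g
   = - of_real (m * (1 + t)) * (ip t m f (X_poly g) - ip t m (X_poly f) g)"
proof -
  \<comment> \<open>The y-derivative. Differentiation in y multiplies by \<i> on the holomorphic
    factor and by \<open>- \<i>\<close> on the conjugated one, and
    \<open>2 * y = - \<i> * (z - cnj z)\<close>.\<close>
  define h where "h = (\<lambda>z. (-\<i>) * weighted t m (pderiv f) g z + \<i> * weighted t m f (pderiv g) z
     + (\<i> * of_real (m * (1 + t))) * (weighted t m f (X_poly g) z + (-1) * weighted t m (X_poly f) g z))"
  obtain C where C: "\<And>z. cmod (weighted t m f g z) \<le> C * exp (- (m * (1 - t) / 2 * (cmod z)\<^sup>2))"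
    using weighted_bound[OF t m] by blast
  obtain D where D: "\<And>z. cmod (h z) \<le> D * exp (- (m * (1 - t) / 2 * (cmod z)\<^sup>2))"
    using combination_bound unfolding h_def by metis
  have "(LINT z|lborel. h z) = 0"
  proof (rule integral_partial_y_eq_0[OF _ C D])
    fix x y
    have w: "((\<lambda>y. complex_of_real (exp (- m * elliptic_potential t (Complex x y)))) has_vector_derivative
        of_real (- (m * (1 + t) * (2 * y)) * exp (- m * elliptic_potential t (Complex x y)))) (at y)"
      unfolding elliptic_potential_eq
      by (auto intro!: derivative_eq_intros has_vector_derivative_of_real simp: algebra_simps
          simp del: of_real_exp simp flip: has_real_derivative_iff_has_vector_derivative)
    have y: "complex_of_real y = -\<i> * (Complex x y - cnj (Complex x y)) / 2"
      by (simp add: complex_eq_iff)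
    show "((\<lambda>y. weighted t m f g (Complex x y)) has_vector_derivative h (Complex x y)) (at y)"
      unfolding weighted_def h_def
      by (rule has_vector_derivative_eq_rhs[OF has_vector_derivative_mult[OF has_vector_derivative_mult[OF
            has_vector_derivative_cnj[OF poly_Complex_vector_derivative(2)]
            poly_Complex_vector_derivative(2)] w]])
         (simp only: of_real_mult of_real_minus of_real_numeral y poly_pCons complex_cnj_mult complex_cnj_add complex_cnj_zero, simp add: field_simps)
    show "continuous_on UNIV h"
      unfolding h_def by (intro continuous_intros continuous_weighted t m)
    show "m * (1 - t) / 2 > 0" using t m by simp
  qed
  moreover have "(LINT z|lborel. h z) = - \<i> * ip t m (pderiv f) g + \<i> * ip t m f (pderiv g)
      + \<i> * of_real (m * (1 + t)) * (ip t m f (X_poly g) - ip t m (X_poly f) g)"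
    unfolding h_def ip_def using integrable_weighted[OF t m] by simp
  ultimately have "\<i> * (ip t m f (pderiv g) - ip t m (pderiv f) g
      + of_real (m * (1 + t)) * (ip t m f (X_poly g) - ip t m (X_poly f) g)) = 0"
    by (simp only: distrib_left right_diff_distrib mult.assoc) simp
  then show ?thesis
    by (simp only: mult_eq_0_iff complex_i_not_zero simp_thms add_eq_0_iff2 mult_minus_left)
qed

text \<open>Adding the two identities with weights \<open>1 + t\<close> and \<open>1 - t\<close>
  eliminates \<open>ip t m f (X_poly g)\<close>, so that multiplication by the variable is left on
  the first argument only.\<close>

lemma ip_pderiv_adjoint:
  "ip t m f (pderiv g) =
   ip t m (smult (of_real (m * (1 - t\<^sup>2))) (X_poly f) - smult (of_real t) (pderiv f)) g"
proof -
  have "ip t m f (pderiv g) = of_real (m * (1 - t\<^sup>2)) * ip t m (X_poly f) g - of_real t * ip t m (pderiv f) g"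
  proof -
    let ?a = "ip t m f (pderiv g)" and ?b = "ip t m (pderiv f) g"
      and ?c = "ip t m f (X_poly g)" and ?d = "ip t m (X_poly f) g"
      and ?m = "complex_of_real m" and ?t = "complex_of_real t"
    have "(1 + ?t) * (?b + ?a) + (1 - ?t) * (?a - ?b)
        = (1 + ?t) * (?m * (1 - ?t) * (?c + ?d)) + (1 - ?t) * (- (?m * (1 + ?t)) * (?c - ?d))"
      using ip_partial_x[of f g] ip_partial_y[of f g] by simp
    then have "2 * ?a = 2 * (?m * (1 - ?t\<^sup>2) * ?d - ?t * ?b)"
      by (simp add: algebra_simps power2_eq_square)
    then have "?a = ?m * (1 - ?t\<^sup>2) * ?d - ?t * ?b"
      by (rule mult_left_cancel[THEN iffD1, rotated]) simp
    then show ?thesis by simp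
  qed
  also have "\<dots> = ip t m (smult (of_real (m * (1 - t\<^sup>2))) (X_poly f) + smult (of_real (- t)) (pderiv f)) g"
    unfolding ip_linear[OF t m] complex_cnj_complex_of_real by simp
  finally show ?thesis by simp
qed

end

section \<open>Hermite polynomials as orthonormal polynomials\<close>

text \<open>The adjoint of differentiation iterated on the constant 1. For positive \<open>c\<close>
  and \<open>t\<close> these are the probabilists' Hermite polynomials \<open>He_k\<close> in the
  form \<open>sqrt (c * t) ^ k * He_k (sqrt (c / t) * x)\<close>; the recursion keeps square roots
  out.\<close>

fun herm :: "complex \<Rightarrow> complex \<Rightarrow> nat \<Rightarrow> complex poly" where
  "herm c t 0 = 1"
| "herm c t (Suc k) = smult c (pCons 0 (herm c t k)) - smult t (pderiv (herm c t k))"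

text \<open>The commutator of differentiation with the operator \<open>c * x - t * d/dx\<close> is
  the constant \<open>c\<close>, so differentiation lowers the index.\<close>

lemma pderiv_herm: "pderiv (herm c t (Suc k)) = smult (c * of_nat (Suc k)) (herm c t k)"
proof (induction k)
  case 0
  then show ?case by (simp add: pderiv_pCons)
next
  case (Suc k)
  let ?h = "herm c t (Suc k)"
  have "pderiv (herm c t (Suc (Suc k)))
      = smult c ?h + (smult c (pCons 0 (pderiv ?h)) - smult t (pderiv (pderiv ?h)))"
    unfolding herm.simps(2)[of c t "Suc k"]
    by (simp only: pderiv_diff pderiv_smult pderiv_pCons smult_add_right add_diff_eq)
  also have "\<dots> = smult c ?h + smult (c * of_nat (Suc k)) ?h"
    by (simp add: Suc pderiv_smult smult_diff_right mult_ac del: of_nat_Suc herm.simps(2))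
       (simp add: smult_diff_right mult_ac)
  also have "\<dots> = smult (c * of_nat (Suc (Suc k))) ?h"
    by (simp only: smult_add_left[symmetric] of_nat_Suc distrib_left) (simp add: algebra_simps)
  finally show ?case .
qed

lemma poly_herm_Suc:
  "poly (herm c t (Suc k)) x = c * x * poly (herm c t k) x - t * poly (pderiv (herm c t k)) x"
  by simp

lemma poly_herm_Suc_Suc:
  "poly (herm c t (Suc (Suc k))) x
   = c * x * poly (herm c t (Suc k)) x - t * c * of_nat (Suc k) * poly (herm c t k) x"
  unfolding poly_herm_Suc[of c t "Suc k"] pderiv_herm by (simp del: herm.simps)

text \<open>The coefficients are real. Moving the conjugation to the argument makes the kernel
  analytic in \<open>cnj w\<close> and \<open>z\<close>, so that Mehler's formula can be used with
  these two as independent variables.\<close>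

lemma cnj_poly_herm:
  "cnj (poly (herm (of_real c) (of_real t) k) x) = poly (herm (of_real c) (of_real t) k) (cnj x)"
proof (induction k rule: induct_nat_012)
  case (ge2 k)
  then show ?case by (simp only: poly_herm_Suc_Suc) simp
qed (simp_all add: pderiv_pCons)

lemma
  assumes "c \<noteq> 0"
  shows degree_herm: "degree (herm c t k) = k"
    and lead_coeff_herm: "lead_coeff (herm c t k) = c ^ k"
proof -
  have "coeff (herm c t k) k = c ^ k \<and> (\<forall>i>k. coeff (herm c t k) i = 0)"
    by (induction k) (auto simp: coeff_pderiv coeff_pCons split: nat.split)
  then have *: "coeff (herm c t k) k = c ^ k" "\<forall>i>k. coeff (herm c t k) i = 0" by blast+
  then show "degree (herm c t k) = k"
    using assms by (intro antisym degree_le le_degree) auto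
  with * show "lead_coeff (herm c t k) = c ^ k" by simp
qed

context
  fixes t m :: real
  assumes t: "0 < t" "t < 1" and m: "m > 0"
begin

lemma ip_zero [simp]: "ip t m f 0 = 0" "ip t m 0 f = 0"
  using ip_linear(2)[OF t m, of f 0 0] ip_linear(4)[OF t m, of 0 0 f] by simp_all

lemma ip_diff: "ip t m f (g - h) = ip t m f g - ip t m f h" "ip t m (f - h) g = ip t m f g - ip t m h g"
  using ip_linear(1)[OF t m, of f g "- h"] ip_linear(2)[OF t m, of f "-1" h]
    ip_linear(3)[OF t m, of f "- h" g] ip_linear(4)[OF t m, of "-1" h g]
  by simp_all

lemma ip_herm_Suc:
  "ip t m (herm (of_real (m * (1 - t\<^sup>2))) (of_real t) (Suc k)) g
   = ip t m (herm (of_real (m * (1 - t\<^sup>2))) (of_real t) k) (pderiv g)"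
  unfolding ip_pderiv_adjoint[OF t m] herm.simps ..

text \<open>A raising step on the left becomes a derivative on the right and lowers the index there.
  Equal indices descend to the Gaussian integral \<open>ip_1_1\<close>, different ones to a
  derivative of the constant 1.\<close>

lemma ip_herm:
  fixes k l :: nat
  defines "h \<equiv> herm (of_real (m * (1 - t\<^sup>2))) (of_real t)"
  shows "ip t m (h k) (h l) = 
    (if k = l then of_real (fact k * (m * (1 - t\<^sup>2)) ^ k * (pi / (m * sqrt (1 - t\<^sup>2)))) else 0)"
proof (induction k arbitrary: l)
  case 0
  show ?case
  proof (cases l)
    case 0
    then show ?thesis by (simp add: h_def ip_1_1[OF t m])
  next
    case (Suc l')
    have "ip t m (h 0) (h l) = cnj (ip t m (h (Suc l')) 1)"
      unfolding Suc by (subst ip_cnj[OF t m]) (simp only: h_def herm.simps(1))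
    also have "\<dots> = 0"
      unfolding h_def ip_herm_Suc by simp
    finally show ?thesis using Suc by simp
  qed
next
  case (Suc k)
  show ?case
  proof (cases l)
    case 0
    then show ?thesis unfolding h_def ip_herm_Suc by simp
  next
    case (Suc l')
    have "ip t m (h (Suc k)) (h l) = of_real (m * (1 - t\<^sup>2)) * of_nat (Suc l') * ip t m (h k) (h l')"
      unfolding h_def ip_herm_Suc Suc pderiv_herm ip_linear(2)[OF t m] by simp
    then show ?thesis
      unfolding Suc.IH using Suc by simp
  qed
qed

section \<open>Uniqueness of the orthonormal family\<close>

lemma ip_span_eq_0:
  assumes "\<And>j. degree (p j) = j" "\<And>j. p j \<noteq> 0"
    and "\<And>j. j < N \<Longrightarrow> ip t m (p j) g = 0"
    and "\<And>i. i \<ge> N \<Longrightarrow> coeff f i = 0"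
  shows "ip t m f g = 0"
  using assms(3,4)
proof (induction N arbitrary: f)
  case 0
  then have "f = 0" by (simp add: poly_eq_iff)
  then show ?case by simp
next
  case (Suc N)
  define a where "a = coeff f N / lead_coeff (p N)"
  have "ip t m (f - smult a (p N)) g = 0"
  proof (rule Suc.IH)
    fix i assume "i \<ge> N"
    then consider "i = N" | "i > N" by linarith
    then show "coeff (f - smult a (p N)) i = 0"
    proof cases
      case 1
      then show ?thesis using assms(1)[of N] assms(2)[of N] leading_coeff_0_iff[of "p N"] by (simp add: a_def)
    next
      case 2
      then show ?thesis using Suc.prems(2)[of i] assms(1)[of N] by (simp add: coeff_eq_0)
    qed
  qed (use Suc.prems in auto)
  then show ?case using Suc.prems(1)[of N] by (simp add: ip_diff ip_linear[OF t m])
qed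

text \<open>Vanishing coefficients from \<open>N\<close> on, instead of a bound on the degree, also
  cover \<open>N = 0\<close>, where \<open>f\<close> is the zero polynomial; this gives the
  induction its base.\<close>

lemma orthogonal_to_span_imp_0:
  assumes "\<And>j. degree (p j) = j" and p: "\<And>j k. ip t m (p j) (p k) = (if j = k then 1 else 0)"
    and "\<And>j. j < N \<Longrightarrow> ip t m (p j) f = 0"
    and "\<And>i. i \<ge> N \<Longrightarrow> coeff f i = 0"
  shows "f = 0"
  using assms(3,4)
proof (induction N)
  case 0
  then show ?case by (simp add: poly_eq_iff)
next
  case (Suc N)
  have ne: "p j \<noteq> 0" for j using p[of j j] by auto
  define a where "a = coeff f N / lead_coeff (p N)"
  have coeff: "coeff (f - smult a (p N)) i = 0" if "i \<ge> N" for i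
  proof (cases "i = N")
    case True
    then show ?thesis using assms(1)[of N] ne[of N] leading_coeff_0_iff[of "p N"] by (simp add: a_def)
  next
    case False
    then show ?thesis using that Suc.prems(2)[of i] assms(1)[of N] by (simp add: coeff_eq_0)
  qed
  have "ip t m (f - smult a (p N)) (p N) = 0"
    by (rule ip_span_eq_0[OF assms(1) ne _ coeff, of N]) (auto simp: p)
  then have "ip t m f (p N) = cnj a"
    by (simp add: ip_diff ip_linear[OF t m] p)
  moreover have "ip t m f (p N) = 0"
    using Suc.prems(1)[of N] ip_cnj[OF t m, of f "p N"] by simp
  ultimately have "a = 0" by simp
  then show ?case using coeff Suc.prems(1) by (intro Suc.IH) auto
qed

text \<open>Required since \<open>orth_poly\<close> is a definite description. With the positive
  factor \<open>c\<close> chosen to cancel the leading terms, \<open>d\<close> has lower degree and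
  is orthogonal to \<open>p k\<close> and \<open>q k\<close>; comparing norms gives
  \<open>c = 1\<close>, and orthogonality of \<open>d\<close> to every lower \<open>p j\<close>
  makes it zero.\<close>

lemma orthonormal_family_unique:
  assumes p: "\<And>k. degree (p k) = k" "\<And>k. lead_coeff (p k) \<in> \<real>" "\<And>k. Re (lead_coeff (p k)) > 0"
      "\<And>j k. ip t m (p j) (p k) = (if j = k then 1 else 0)"
    and q: "\<And>k. degree (q k) = k" "\<And>k. lead_coeff (q k) \<in> \<real>" "\<And>k. Re (lead_coeff (q k)) > 0"
      "\<And>j k. ip t m (q j) (q k) = (if j = k then 1 else 0)"
  shows "p = q"
proof
  fix k
  have ne: "p j \<noteq> 0" "q j \<noteq> 0" for j using p(4)[of j j] q(4)[of j j] by auto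
  define c where "c = Re (lead_coeff (q k)) / Re (lead_coeff (p k))"
  have c: "c > 0" using p(3)[of k] q(3)[of k] by (simp add: c_def)
  have lead: "lead_coeff (q k) = of_real c * lead_coeff (p k)"
    using p(2,3)[of k] q(2)[of k]
    by (auto simp: c_def complex_is_Real_iff complex_eq_iff)
  define d where "d = q k - smult (of_real c) (p k)"
  have coeff: "coeff d i = 0" if "i \<ge> k" for i
  proof (cases "i = k")
    case True
    then show ?thesis using lead p(1)[of k] q(1)[of k] by (simp add: d_def)
  next
    case False
    then show ?thesis using that p(1)[of k] q(1)[of k] by (simp add: d_def coeff_eq_0)
  qed
  have dq: "ip t m d (q k) = 0"
    by (rule ip_span_eq_0[OF q(1) ne(2) _ coeff]) (auto simp: q)
  have dp: "ip t m d (p k) = 0"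
    by (rule ip_span_eq_0[OF p(1) ne(1) _ coeff]) (auto simp: p)
  have qk: "q k = d + smult (of_real c) (p k)" by (simp add: d_def)
  have pd: "ip t m (p k) d = 0"
    using dp ip_cnj[OF t m, of "p k" d] by simp
  have "1 = ip t m (q k) (q k)" by (simp add: q)
  also have "\<dots> = ip t m (d + smult (of_real c) (p k)) (q k)" by (simp only: qk[symmetric])
  also have "\<dots> = of_real c * ip t m (p k) (q k)" by (simp add: ip_linear[OF t m] dq)
  also have "ip t m (p k) (q k) = ip t m (p k) (d + smult (of_real c) (p k))"
    by (simp only: qk[symmetric])
  also have "of_real c * \<dots> = of_real (c\<^sup>2)"
    by (simp add: ip_linear[OF t m] pd p power2_eq_square)
  finally have "c\<^sup>2 = 1" using of_real_eq_iff by (metis of_real_1)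
  then have c1: "c = 1" using c by (auto simp: power2_eq_1_iff)
  have "d = 0"
  proof (rule orthogonal_to_span_imp_0[OF p(1,4) _ coeff])
    fix j assume "j < k"
    have "ip t m (p j) (q k) = 0"
      by (rule ip_span_eq_0[OF q(1) ne(2), of k]) (use \<open>j < k\<close> p(1)[of j] in \<open>auto simp: q coeff_eq_0\<close>)
    then show "ip t m (p j) d = 0"
      using \<open>j < k\<close> by (simp add: d_def ip_diff ip_linear[OF t m] p)
  qed
  then show "p k = q k" by (simp add: qk c1)
qed

end

section \<open>The orthonormal polynomials and the kernel in terms of Hermite polynomials\<close>

lemma orth_poly_elliptic:
  fixes t :: real and n :: nat
  assumes t: "0 < t" "t < 1" and n: "n > 0"
  defines "c \<equiv> real n * (1 - t\<^sup>2)"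
  shows "orth_poly (elliptic_potential t) n k =
    smult (of_real (1 / sqrt (fact k * c ^ k * (pi / (real n * sqrt (1 - t\<^sup>2))))))
      (herm (of_real c) (of_real t) k)"
proof -
  define \<nu> where "\<nu> k = fact k * c ^ k * (pi / (real n * sqrt (1 - t\<^sup>2)))" for k
  define q where "q k = smult (of_real (1 / sqrt (\<nu> k))) (herm (of_real c) (of_real t) k)" for k
  have "t\<^sup>2 < 1" using t by (simp add: abs_square_less_1)
  then have c: "c > 0" and n': "real n > 0" using n by (auto simp: c_def)
  have nu: "\<nu> k > 0" for k using c n' \<open>t\<^sup>2 < 1\<close> by (simp add: \<nu>_def)
  have ipq: "ip t n (q j) (q k) = (if j = k then 1 else 0)" for j k
  proof -
    have "sqrt (\<nu> k) * sqrt (\<nu> k) = \<nu> k" using nu[of k] by simp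
    then have *: "of_real (1 / sqrt (\<nu> k)) * (of_real (1 / sqrt (\<nu> k)) * complex_of_real (\<nu> k)) = 1"
      using nu[of k] unfolding of_real_mult[symmetric] by (simp add: field_simps del: of_real_mult real_sqrt_mult_self)
    have "ip t n (q j) (q k) = of_real (1 / sqrt (\<nu> j)) * (of_real (1 / sqrt (\<nu> k)) *
        ip t n (herm (of_real c) (of_real t) j) (herm (of_real c) (of_real t) k))"
      unfolding q_def ip_linear[OF t n'] complex_cnj_complex_of_real by (simp add: mult_ac)
    then show ?thesis
      unfolding c_def ip_herm[OF t n'] using * unfolding \<nu>_def c_def by simp
  qed
  have q1: "degree (q k) = k" "lead_coeff (q k) = of_real (c ^ k / sqrt (\<nu> k))" for k
    
  proof -
    have "coeff (herm (of_real c) (of_real t) k) k = of_real c ^ k"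
      using c lead_coeff_herm[of "of_real c" "of_real t" k] by (simp add: degree_herm)
    with c nu[of k] show "degree (q k) = k" "lead_coeff (q k) = of_real (c ^ k / sqrt (\<nu> k))"
      by (simp_all add: q_def degree_herm)
  qed
  have q2: "lead_coeff (q k) \<in> \<real>" "Re (lead_coeff (q k)) > 0" for k
    unfolding q1(2) using c nu[of k] by (auto simp del: of_real_divide)
  have ip_eq: "(LINT z|lborel. cnj (poly (p k) z) * poly (p l) z
      * of_real (exp (- real n * elliptic_potential t z))) = ip t n (p k) (p l)" for p :: "nat \<Rightarrow> complex poly" and k l
    by (simp add: ip_def weighted_def)
  have "orth_poly (elliptic_potential t) n = q"
    unfolding orth_poly_def
  proof (rule the_equality)
    show "orthonormal_polys (elliptic_potential t) n q"
      unfolding orthonormal_polys_def ip_eq using q1(1) q2 ipq by blast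
  next
    fix p assume "orthonormal_polys (elliptic_potential t) n p"
    then have "\<And>k. degree (p k) = k" "\<And>k. lead_coeff (p k) \<in> \<real>" "\<And>k. Re (lead_coeff (p k)) > 0"
      "\<And>j k. ip t n (p j) (p k) = (if j = k then 1 else 0)"
      unfolding orthonormal_polys_def ip_eq by blast+
    then show "p = q"
      by (rule orthonormal_family_unique[OF t n' _ _ _ _ q1(1) q2 ipq])
  qed
  then show ?thesis by (simp add: q_def \<nu>_def)
qed

lemma reproducing_kernel_elliptic:
  fixes t :: real and n :: nat
  assumes t: "0 < t" "t < 1" and n: "n > 0"
  defines "c \<equiv> real n * (1 - t\<^sup>2)"
  shows "reproducing_kernel (elliptic_potential t) n w z / of_nat n =
    of_real (sqrt (1 - t\<^sup>2) / pi * exp (- (real n / 2) * (elliptic_potential t w + elliptic_potential t z))) *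
    (\<Sum>k<n. poly (herm (of_real c) (of_real t) k) (cnj w) * poly (herm (of_real c) (of_real t) k) z
        / of_real (fact k * c ^ k))"
proof -
  have "t\<^sup>2 < 1" using t by (simp add: abs_square_less_1)
  then have c: "c > 0" and n': "real n > 0" using n by (auto simp: c_def)
  have "cnj (poly (orth_poly (elliptic_potential t) n k) w) * poly (orth_poly (elliptic_potential t) n k) z
    = of_real (real n * sqrt (1 - t\<^sup>2) / pi) *
      (poly (herm (of_real c) (of_real t) k) (cnj w) * poly (herm (of_real c) (of_real t) k) z
        / of_real (fact k * c ^ k))" for k
  proof -
    define \<nu> where "\<nu> = fact k * c ^ k * (pi / (real n * sqrt (1 - t\<^sup>2)))"
    have nu: "\<nu> > 0" using c n' \<open>t\<^sup>2 < 1\<close> by (simp add: \<nu>_def)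
    have "1 / sqrt \<nu> * (1 / sqrt \<nu>) = 1 / \<nu>" using nu by simp
    then have e: "of_real (1 / sqrt \<nu>) * (of_real (1 / sqrt \<nu>) * X) = of_real (1 / \<nu>) * X" for X :: complex
      by (metis mult.assoc of_real_mult)
    have e2: "1 / \<nu> = real n * sqrt (1 - t\<^sup>2) / pi * (1 / (fact k * c ^ k))"
      using c n' \<open>t\<^sup>2 < 1\<close> by (simp add: \<nu>_def)
    have "cnj (poly (orth_poly (elliptic_potential t) n k) w) * poly (orth_poly (elliptic_potential t) n k) z
      = of_real (1 / sqrt \<nu>) * (of_real (1 / sqrt \<nu>) * (poly (herm (of_real c) (of_real t) k) (cnj w) * poly (herm (of_real c) (of_real t) k) z))"
      unfolding orth_poly_elliptic[OF t n] c_def[symmetric] \<nu>_def[symmetric] poly_smult complex_cnj_mult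
        cnj_poly_herm complex_cnj_complex_of_real by (simp only: mult_ac)
    then show ?thesis unfolding e e2 by simp
  qed
  note * = this
  show ?thesis
    unfolding reproducing_kernel_def * sum_distrib_left[symmetric] using n' by simp
qed

section \<open>Mehler's formula\<close>

text \<open>Relative to \<open>sqrt (fact k * c ^ k)\<close>, the second term of the three-term
  recurrence costs a factor at most \<open>t\<close> over two steps, while the first is smaller by
  order \<open>1 / sqrt k\<close>. Any rate \<open>Q > t\<close> per two steps therefore dominates
  both for large \<open>k\<close>. Uniformity in \<open>x\<close> is what termwise differentiation
  requires.\<close>

lemma herm_bound:
  fixes c t Q R :: real
  assumes c: "c > 0" and t: "t > 0" and Q: "t < Q"
  obtains C where "C \<ge> 0" "\<And>k x. cmod x \<le> R \<Longrightarrow>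
     cmod (poly (herm (of_real c) (of_real t) k) x) \<le> C * sqrt Q ^ k * sqrt (fact k * c ^ k)"
proof -
  let ?h = "herm (of_real c) (of_real t)"
  define q where "q = sqrt Q"
  define s where "s k = sqrt (fact k * c ^ k)" for k
  have q: "q > 0" "q * q = Q" using Q t by (auto simp: q_def)
  have s_pos: "s k > 0" for k using c by (simp add: s_def)
  have s_Suc: "s (Suc k) = sqrt c * sqrt (Suc k) * s k" for k
    by (simp add: s_def real_sqrt_mult[symmetric] mult_ac)
  have "\<exists>M\<ge>0. \<forall>x. cmod x \<le> R \<longrightarrow> cmod (poly (?h k) x) \<le> M" for k
  proof -
    have "bounded (poly (?h k) ` cball 0 R)"
      by (intro compact_imp_bounded compact_continuous_image continuous_intros compact_cball)
    then obtain M where "\<forall>x\<in>cball 0 R. cmod (poly (?h k) x) \<le> M"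
      by (auto simp: bounded_iff)
    then show ?thesis by (intro exI[of _ "max M 0"]) (auto simp: le_max_iff_disj)
  qed
  then obtain M where M: "\<And>k. M k \<ge> 0" "\<And>k x. cmod x \<le> R \<Longrightarrow> cmod (poly (?h k) x) \<le> M k"
    by metis
  \<comment> \<open>From index \<open>K\<close> on, the term of the recurrence that contains
    \<open>x\<close> fits into the gap \<open>Q - t\<close>.\<close>
  obtain K :: nat where K: "K \<ge> (sqrt c * \<bar>R\<bar> * q / (Q - t))\<^sup>2"
    using real_arch_simple by blast
  have large: "sqrt c * \<bar>R\<bar> * q \<le> (Q - t) * sqrt (Suc (Suc k))" if "k \<ge> K" for k
  proof -
    have "(sqrt c * \<bar>R\<bar> * q / (Q - t))\<^sup>2 \<le> real (Suc (Suc k))" using K that by linarith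
    then have "sqrt c * \<bar>R\<bar> * q / (Q - t) \<le> sqrt (Suc (Suc k))"
      by (rule real_le_rsqrt)
    then show ?thesis using Q by (simp add: divide_le_eq mult.commute)
  qed
  \<comment> \<open>A sum in place of a maximum over the finitely many indices that precede the
    regime controlled by \<open>K\<close>.\<close>
  define C where "C = (\<Sum>k\<le>Suc K. M k / (q ^ k * s k))"
  have C0: "C \<ge> 0" unfolding C_def using M(1) q s_pos by (intro sum_nonneg) (simp add: less_imp_le)
  have "cmod (poly (?h k) x) \<le> C * q ^ k * s k" if x: "cmod x \<le> R" for k x
  proof (induction k rule: less_induct)
    case (less k)
    show ?case
    proof (cases "k \<le> Suc K")
      case True
      have "M k / (q ^ k * s k) \<le> C"
        unfolding C_def using True M(1) q s_pos
        by (intro member_le_sum[of k "{..Suc K}" "\<lambda>k. M k / (q ^ k * s k)"]) (auto simp: less_imp_le)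
      then have "M k \<le> C * (q ^ k * s k)"
        using q(1) s_pos[of k] by (simp add: divide_le_eq)
      then show ?thesis using M(2)[OF x, of k] by (simp add: mult.assoc)
    next
      case False
      then obtain j where k: "k = Suc (Suc j)" and j: "j \<ge> K"
        by (metis not_less_eq_eq Suc_le_D Suc_le_mono nle_le)
      have R: "R \<ge> 0" using x norm_ge_zero order.trans by blast
      have 1: "cmod (poly (?h (Suc j)) x) \<le> C * q ^ Suc j * s (Suc j)"
        and 0: "cmod (poly (?h j) x) \<le> C * q ^ j * s j"
        by (rule less.IH, simp add: k)+
      have "cmod (poly (?h k) x) \<le> c * R * cmod (poly (?h (Suc j)) x) + t * c * Suc j * cmod (poly (?h j) x)"
        unfolding k poly_herm_Suc_Suc using c t x
        by (intro order.trans[OF norm_triangle_ineq4] add_mono)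
           (simp_all add: norm_mult mult_right_mono del: of_nat_Suc)
      also have "\<dots> \<le> c * R * (C * q ^ Suc j * s (Suc j)) + t * c * Suc j * (C * q ^ j * s j)"
        using c t R by (intro add_mono mult_left_mono 0 1) auto
      also have "\<dots> = C * q ^ j * (sqrt c * s (Suc j)) * (sqrt c * R * q)
          + C * q ^ j * t * (sqrt c * s (Suc j)) * sqrt (Suc j)"
      proof -
        have "c * R * (C * q ^ Suc j * s (Suc j)) = (sqrt c * sqrt c) * R * (C * q ^ Suc j * s (Suc j))"
          using c by simp
        moreover have "t * c * Suc j * (C * q ^ j * s j)
            = t * (sqrt c * sqrt c) * (sqrt (Suc j) * sqrt (Suc j)) * (C * q ^ j * s j)"
          using c by simp
        ultimately show ?thesis unfolding s_Suc by (simp only: power_Suc mult_ac)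
      qed
      also have "\<dots> \<le> C * q ^ j * (sqrt c * s (Suc j)) * ((Q - t) * sqrt (Suc (Suc j)))
          + C * q ^ j * t * (sqrt c * s (Suc j)) * sqrt (Suc (Suc j))"
        using large[OF j] R C0 q s_pos[of "Suc j"] c t
        by (intro add_mono mult_left_mono mult_nonneg_nonneg) (auto simp: less_imp_le)
      also have "\<dots> = C * q ^ j * Q * (sqrt c * sqrt (Suc (Suc j)) * s (Suc j))"
        by (simp only: algebra_simps)
      also have "\<dots> = C * q ^ k * s k"
        unfolding k s_Suc[of "Suc j"] using q(2) by (simp add: mult_ac)
      finally show ?thesis .
    qed
  qed
  then show thesis using that C0 unfolding q_def s_def by blast
qed

definition mehler_term :: "real \<Rightarrow> real \<Rightarrow> complex \<Rightarrow> complex \<Rightarrow> complex \<Rightarrow> nat \<Rightarrow> complex" where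
  "mehler_term c t r x y k = r ^ k * poly (herm (of_real c) (of_real t) k) x
     * poly (herm (of_real c) (of_real t) k) y / of_real (fact k * c ^ k)"

text \<open>The derivative in \<open>x\<close> of the \<open>mehler_term\<close> with index
  \<open>Suc k\<close>: lowering the index cancels one factor \<open>Suc k * c\<close> of the
  normalisation. The term with index 0 is constant.\<close>

definition mehler_dterm :: "real \<Rightarrow> real \<Rightarrow> complex \<Rightarrow> complex \<Rightarrow> complex \<Rightarrow> nat \<Rightarrow> complex" where
  "mehler_dterm c t r x y k = r ^ Suc k * poly (herm (of_real c) (of_real t) k) x
     * poly (herm (of_real c) (of_real t) (Suc k)) y / of_real (fact k * c ^ k)"

context
  fixes c t :: real and r :: complex
  assumes c: "c > 0" and t: "t > 0" and r: "cmod r * t < 1"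
begin

lemma mehler_term_bounds:
  obtains A \<rho> where "0 \<le> \<rho>" "\<rho> < 1"
    "\<And>k x y. cmod x \<le> R \<Longrightarrow> cmod y \<le> R \<Longrightarrow> cmod (mehler_term c t r x y k) \<le> A * \<rho> ^ k"
    "\<And>k x y. cmod x \<le> R \<Longrightarrow> cmod y \<le> R \<Longrightarrow>
       cmod (mehler_dterm c t r x y k) \<le> A * (real (Suc k) * \<rho> ^ k)"
proof -
  let ?h = "herm (of_real c) (of_real t)"
  \<comment> \<open>Since \<open>herm_bound\<close> holds for every rate above \<open>t\<close>, a
    \<open>Q\<close> strictly between \<open>t\<close> and \<open>1 / cmod r\<close> leaves a
    geometric series of ratio \<open>cmod r * Q < 1\<close>.\<close>
  obtain Q where Q: "t < Q" "cmod r * Q < 1"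
  proof (cases "r = 0")
    case True
    then show ?thesis using that[of "t + 1"] by simp
  next
    case False
    then have "t < 1 / cmod r" using r by (simp add: less_divide_eq mult.commute)
    then obtain Q where "t < Q" "Q < 1 / cmod r" using dense by blast
    then show ?thesis using False that[of Q] by (simp add: less_divide_eq mult.commute)
  qed
  define \<rho> where "\<rho> = cmod r * Q"
  define q where "q = sqrt Q"
  define s where "s k = sqrt (fact k * c ^ k)" for k
  have q: "q > 0" "q * q = Q" using Q t by (auto simp: q_def)
  have s_pos: "s k > 0" for k using c by (simp add: s_def)
  have s2: "fact k * c ^ k = s k * s k" for k using c by (simp add: s_def)
  have s_Suc: "s (Suc k) = sqrt c * sqrt (Suc k) * s k" for k
    by (simp add: s_def real_sqrt_mult[symmetric] mult_ac)
  obtain C where C: "C \<ge> 0" "\<And>k x. cmod x \<le> R \<Longrightarrow> cmod (poly (?h k) x) \<le> C * q ^ k * s k"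
    using herm_bound[OF c t Q(1), of R] unfolding q_def s_def by blast
  define A where "A = C\<^sup>2 + C\<^sup>2 * cmod r * q * sqrt c"
  have \<rho>: "0 \<le> \<rho>" "\<rho> < 1" using Q t by (auto simp: \<rho>_def)
  have A: "C\<^sup>2 \<le> A" "C\<^sup>2 * cmod r * q * sqrt c \<le> A" using q c by (auto simp: A_def)
  have "cmod (mehler_term c t r x y k) \<le> A * \<rho> ^ k" if xy: "cmod x \<le> R" "cmod y \<le> R" for x y k
  proof -
    have "cmod (mehler_term c t r x y k) = cmod r ^ k * (cmod (poly (?h k) x) * cmod (poly (?h k) y)) / (s k * s k)"
      unfolding mehler_term_def s2 using s_pos[of k] by (simp add: norm_mult norm_divide norm_power mult_ac)
    also have "\<dots> \<le> cmod r ^ k * ((C * q ^ k * s k) * (C * q ^ k * s k)) / (s k * s k)"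
      using s_pos[of k] C q xy by (intro divide_right_mono mult_left_mono mult_mono) (auto simp: less_imp_le)
    also have "\<dots> = C\<^sup>2 * \<rho> ^ k"
      using s_pos[of k] by (simp add: \<rho>_def q(2)[symmetric] power_mult_distrib power2_eq_square)
    also have "\<dots> \<le> A * \<rho> ^ k" using A \<rho> by (intro mult_right_mono) auto
    finally show ?thesis .
  qed
  moreover have "cmod (mehler_dterm c t r x y k) \<le> A * (real (Suc k) * \<rho> ^ k)"
    if xy: "cmod x \<le> R" "cmod y \<le> R" for x y k
  proof -
    have "cmod (mehler_dterm c t r x y k)
        = cmod r ^ Suc k * (cmod (poly (?h k) x) * cmod (poly (?h (Suc k)) y)) / (s k * s k)"
      unfolding mehler_dterm_def s2 using s_pos[of k]
      by (simp add: norm_mult norm_divide norm_power mult_ac del: herm.simps)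
    also have "\<dots> \<le> cmod r ^ Suc k * ((C * q ^ k * s k) * (C * q ^ Suc k * s (Suc k))) / (s k * s k)"
      using s_pos[of k] s_pos[of "Suc k"] C(1) q xy
      by (intro divide_right_mono mult_left_mono mult_mono C(2)) (auto simp: less_imp_le simp del: herm.simps)
    also have "\<dots> = C\<^sup>2 * cmod r * q * sqrt c * (sqrt (Suc k) * \<rho> ^ k)"
      using s_pos[of k] unfolding s_Suc
      by (simp add: \<rho>_def q(2)[symmetric] power_mult_distrib power2_eq_square)
    also have "\<dots> \<le> A * (real (Suc k) * \<rho> ^ k)"
    proof (intro mult_mono A)
      show "sqrt (real (Suc k)) \<le> real (Suc k)" by (rule real_le_lsqrt) (simp_all add: power2_eq_square)
    qed (use \<rho> q c A C in \<open>auto intro: order.trans[OF zero_le_power2]\<close>)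
    finally show ?thesis .
  qed
  ultimately show thesis using that \<rho> by blast
qed

lemma summable_mehler:
  "summable (mehler_term c t r x y)" "summable (mehler_dterm c t r x y)"
proof -
  define R where "R = max (cmod x) (cmod y)"
  obtain A \<rho> where *: "0 \<le> \<rho>" "\<rho> < 1"
    "\<And>k x y. cmod x \<le> R \<Longrightarrow> cmod y \<le> R \<Longrightarrow> cmod (mehler_term c t r x y k) \<le> A * \<rho> ^ k"
    "\<And>k x y. cmod x \<le> R \<Longrightarrow> cmod y \<le> R \<Longrightarrow>
       cmod (mehler_dterm c t r x y k) \<le> A * (real (Suc k) * \<rho> ^ k)"
    by (rule mehler_term_bounds[of R]) (rule that)
  have xy: "cmod x \<le> R" "cmod y \<le> R" by (simp_all add: R_def)
  have "summable (\<lambda>k. A * \<rho> ^ k)"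
    using *(1,2) by (intro summable_mult summable_geometric) simp
  then show "summable (mehler_term c t r x y)"
    by (rule summable_comparison_test') (rule *(3)[OF xy])
  have "summable (\<lambda>k. A * (real (Suc k) * \<rho> ^ k))"
    using *(1,2) by (intro summable_mult sums_summable[OF geometric_deriv_sums]) simp
  then show "summable (mehler_dterm c t r x y)"
    by (rule summable_comparison_test') (rule *(4)[OF xy])
qed

definition "mehler x y = (\<Sum>k. mehler_term c t r x y k)"
definition "dmehler x y = (\<Sum>k. mehler_dterm c t r x y k)"

lemma mehler_commute: "mehler x y = mehler y x"
  unfolding mehler_def mehler_term_def by (simp add: mult_ac)

lemma mehler_derivative: "((\<lambda>x. mehler x y) has_field_derivative dmehler x y) (at x)"
proof -
  define R where "R = max (cmod x) (cmod y) + 1"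
  obtain A \<rho> where *: "0 \<le> \<rho>" "\<rho> < 1"
    "\<And>k x y. cmod x \<le> R \<Longrightarrow> cmod y \<le> R \<Longrightarrow> cmod (mehler_term c t r x y k) \<le> A * \<rho> ^ k"
    "\<And>k x y. cmod x \<le> R \<Longrightarrow> cmod y \<le> R \<Longrightarrow>
       cmod (mehler_dterm c t r x y k) \<le> A * (real (Suc k) * \<rho> ^ k)"
    by (rule mehler_term_bounds[of R]) (rule that)
  have x: "x \<in> interior (ball 0 R)" and y: "cmod y \<le> R" by (auto simp: R_def)
  have "((\<lambda>x. \<Sum>k. mehler_term c t r x y (Suc k)) has_field_derivative (\<Sum>k. mehler_dterm c t r x y k)) (at x)"
  proof (rule has_field_derivative_series'[of "ball 0 R"])
    fix k x
    have "((\<lambda>x. mehler_term c t r x y (Suc k)) has_field_derivative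
        r ^ Suc k * (of_real c * of_nat (Suc k) * poly (herm (of_real c) (of_real t) k) x)
          * poly (herm (of_real c) (of_real t) (Suc k)) y / of_real (fact (Suc k) * c ^ Suc k)) (at x)"
      unfolding mehler_term_def using pderiv_herm[of "of_real c" "of_real t" k] c
      by (auto intro!: derivative_eq_intros simp del: herm.simps of_real_mult)
    also have "r ^ Suc k * (of_real c * of_nat (Suc k) * poly (herm (of_real c) (of_real t) k) x)
          * poly (herm (of_real c) (of_real t) (Suc k)) y / of_real (fact (Suc k) * c ^ Suc k)
        = mehler_dterm c t r x y k"
      using c by (simp add: mehler_dterm_def field_simps del: herm.simps of_nat_Suc)
    finally show "((\<lambda>x. mehler_term c t r x y (Suc k)) has_field_derivative mehler_dterm c t r x y k)
        (at x within ball 0 R)"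
      by (rule has_field_derivative_at_within)
  next
    show "uniformly_convergent_on (ball 0 R) (\<lambda>n x. \<Sum>k<n. mehler_dterm c t r x y k)"
    proof (rule Weierstrass_m_test')
      show "cmod (mehler_dterm c t r x y k) \<le> A * (real (Suc k) * \<rho> ^ k)" if "x \<in> ball 0 R" for k x
        using that y by (intro *(4)) simp_all
      show "summable (\<lambda>k. A * (real (Suc k) * \<rho> ^ k))"
        using *(1,2) by (intro summable_mult sums_summable[OF geometric_deriv_sums]) simp
    qed
    show "summable (\<lambda>k. mehler_term c t r x y (Suc k))"
      using summable_mehler by (subst summable_Suc_iff)
  qed (use x in auto)
  then have "((\<lambda>x. 1 + (\<Sum>k. mehler_term c t r x y (Suc k))) has_field_derivative dmehler x y) (at x)"
    unfolding dmehler_def by (auto intro!: derivative_eq_intros)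
  moreover have "mehler x y = 1 + (\<Sum>k. mehler_term c t r x y (Suc k))" for x
  proof -
    have "mehler_term c t r x y 0 = 1" by (simp add: mehler_term_def)
    then show ?thesis
      using suminf_split_head[OF summable_mehler(1)[of x y]] by (simp add: mehler_def)
  qed
  ultimately show ?thesis by simp
qed

text \<open>The recursion applied to the raised factor in \<open>y\<close> ties the two partial
  derivatives of the generating function together. With the same identity for exchanged variables
  this is a linear system, of determinant \<open>1 - r^2 * t^2\<close>, for the two
  derivatives.\<close>

lemma dmehler_eq: "dmehler x y = r * of_real c * y * mehler x y - r * of_real t * dmehler y x"
proof -
  let ?h = "herm (of_real c) (of_real t)"
  define G where "G k = r ^ k * poly (?h k) x * poly (pderiv (?h k)) y / of_real (fact k * c ^ k)" for k
  have "G (Suc k) = mehler_dterm c t r y x k" for k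
    using c unfolding G_def pderiv_herm mehler_dterm_def by (simp add: field_simps del: herm.simps of_nat_Suc)
  then have "(\<lambda>k. G (Suc k)) sums dmehler y x"
    unfolding dmehler_def by (simp add: summable_sums summable_mehler)
  then have "G sums dmehler y x"
    by (rule sums_Suc_imp[rotated]) (simp add: G_def pderiv_1)
  then have "(\<lambda>k. r * of_real c * y * mehler_term c t r x y k - r * of_real t * G k) sums
      (r * of_real c * y * mehler x y - r * of_real t * dmehler y x)"
    unfolding mehler_def by (intro sums_diff sums_mult summable_sums summable_mehler)
  moreover have "mehler_dterm c t r x y = (\<lambda>k. r * of_real c * y * mehler_term c t r x y k - r * of_real t * G k)"
    unfolding mehler_dterm_def mehler_term_def G_def poly_herm_Suc
    by (simp add: fun_eq_iff diff_divide_distrib algebra_simps)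
  ultimately have "mehler_dterm c t r x y sums (r * of_real c * y * mehler x y - r * of_real t * dmehler y x)"
    by (simp only:)
  then show ?thesis unfolding dmehler_def[of x y] by (rule sums_unique[symmetric])
qed

section \<open>Solving the differential equation of the generating function\<close>

lemma one_minus_r2t2_nonzero: "1 - r\<^sup>2 * of_real (t\<^sup>2) \<noteq> 0"
proof
  assume "1 - r\<^sup>2 * of_real (t\<^sup>2) = 0"
  then have "(r * of_real t)\<^sup>2 = 1" by (simp add: power_mult_distrib)
  then have "cmod (r * of_real t) = 1" by (metis norm_one norm_power power2_eq_1_iff norm_minus_cancel)
  then show False using r t by (simp add: norm_mult)
qed

lemma dmehler_ode:
  "dmehler x y = of_real c * (r * y - r\<^sup>2 * of_real t * x) / (1 - r\<^sup>2 * of_real (t\<^sup>2)) * mehler x y"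
proof -
  have "dmehler x y = r * of_real c * y * mehler x y
      - r * of_real t * (r * of_real c * x * mehler x y - r * of_real t * dmehler x y)"
    using dmehler_eq[of x y] dmehler_eq[of y x] by (simp add: mehler_commute[of y x])
  then have "(1 - r\<^sup>2 * of_real (t\<^sup>2)) * dmehler x y = of_real c * (r * y - r\<^sup>2 * of_real t * x) * mehler x y"
    by (simp add: algebra_simps power2_eq_square)
  then show ?thesis using one_minus_r2t2_nonzero by (simp add: field_simps)
qed

lemma mehler_first_variable:
  "mehler x y = mehler 0 y * exp (of_real c * (r * x * y - r\<^sup>2 * of_real t * x\<^sup>2 / 2) / (1 - r\<^sup>2 * of_real (t\<^sup>2)))"
proof -
  define d where "d = 1 - r\<^sup>2 * of_real (t\<^sup>2)"
  \<comment> \<open>The antiderivative, vanishing at 0, of the coefficient in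
    \<open>dmehler_ode\<close>, so that \<open>exp (- E x)\<close> is an integrating factor.\<close>
  define E where "E x = of_real c * (r * x * y - r\<^sup>2 * of_real t * x\<^sup>2 / 2) / d" for x
  have d: "d \<noteq> 0" unfolding d_def by (rule one_minus_r2t2_nonzero)
  have E': "(E has_field_derivative of_real c * (r * y - r\<^sup>2 * of_real t * x) / d) (at x)" for x
    unfolding E_def using d by (auto intro!: derivative_eq_intros)
  have "((\<lambda>x. mehler x y * exp (- E x)) has_field_derivative 0) (at x within UNIV)" for x
  proof -
    have "((\<lambda>x. mehler x y * exp (- E x)) has_field_derivative
       dmehler x y * exp (- E x) + exp (- E x) * (- (of_real c * (r * y - r\<^sup>2 * of_real t * x) / d)) * mehler x y) (at x)"
      by (intro derivative_intros mehler_derivative E')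
    also have "dmehler x y * exp (- E x) + exp (- E x) * (- (of_real c * (r * y - r\<^sup>2 * of_real t * x) / d)) * mehler x y = 0"
      unfolding dmehler_ode d_def by simp
    finally show ?thesis .
  qed
  from has_field_derivative_zero_constant[OF convex_UNIV this]
  have "mehler x y * exp (- E x) = mehler 0 y * exp (- E 0)" by (metis UNIV_I)
  then show ?thesis
    by (simp add: E_def d_def exp_minus field_simps)
qed

text \<open>Odd Hermite polynomials vanish at 0, and consecutive even terms have the ratio of the
  binomial series with exponent \<open>- 1 / 2\<close>.\<close>

lemma mehler_0_0: "mehler 0 0 = (1 - r\<^sup>2 * of_real (t\<^sup>2)) powr (- 1 / 2)"
proof -
  let ?h = "herm (of_real c) (of_real t)"
  have odd: "poly (?h (Suc (2 * m))) 0 = 0" for m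
    by (induction m) (simp_all add: poly_herm_Suc_Suc pderiv_pCons del: herm.simps(2), simp)
  have even: "mehler_term c t r 0 0 (2 * m) = ((- 1 / 2) gchoose m) * (- (r\<^sup>2 * of_real (t\<^sup>2))) ^ m" for m
  proof (induction m)
    case 0
    then show ?case by (simp add: mehler_term_def)
  next
    case (Suc m)
    have "poly (?h (2 * Suc m)) 0 = - of_real t * of_real c * of_nat (Suc (2 * m)) * poly (?h (2 * m)) 0"
      using poly_herm_Suc_Suc[of "of_real c" "of_real t" "2 * m" 0] by (simp del: herm.simps)
    then have "mehler_term c t r 0 0 (2 * Suc m)
        = r\<^sup>2 * of_real (t\<^sup>2) * (of_nat (Suc (2 * m)) / of_nat (2 * Suc m)) * mehler_term c t r 0 0 (2 * m)"
      using c by (simp add: mehler_term_def field_simps power2_eq_square del: herm.simps of_nat_Suc)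
    also have "\<dots> = ((- 1 / 2) gchoose Suc m) * (- (r\<^sup>2 * of_real (t\<^sup>2))) ^ Suc m"
    proof -
      have "((- 1 / 2 :: complex) gchoose Suc m) = ((- 1 / 2) gchoose m) * ((- 1 / 2 - of_nat m) / of_nat (Suc m))"
      proof -
        have "(- 1 / 2 gchoose Suc m) * of_nat (Suc m) = ((- 1 / 2 :: complex) gchoose m) * (- 1 / 2 - of_nat m)"
          using gbinomial_mult_1[of "- 1 / 2 :: complex" m] by (simp add: algebra_simps)
        then show ?thesis by (metis nonzero_eq_divide_eq of_nat_neq_0 times_divide_eq_right)
      qed
      also have "(- 1 / 2 - of_nat m :: complex) / of_nat (Suc m) = - (of_nat (Suc (2 * m)) / of_nat (2 * Suc m))"
      proof -
        have "- 1 / 2 - of_nat m = - (of_nat (Suc (2 * m)) / 2 :: complex)"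
          by (simp add: add_divide_distrib)
        then show ?thesis by (simp only: of_nat_mult of_nat_numeral minus_divide_left divide_divide_eq_left)
      qed
      finally show ?thesis unfolding Suc.IH by simp
    qed
    finally show ?case .
  qed
  have "cmod (- (r\<^sup>2 * of_real (t\<^sup>2))) = (cmod r * t)\<^sup>2"
    using t by (simp add: norm_mult norm_power power_mult_distrib)
  also have "\<dots> < 1" using r t by (simp add: abs_square_less_1)
  finally have "(\<lambda>m. ((- 1 / 2) gchoose m) * (- (r\<^sup>2 * of_real (t\<^sup>2))) ^ m) sums
      (1 + - (r\<^sup>2 * of_real (t\<^sup>2))) powr (- 1 / 2)"
    by (rule gen_binomial_complex)
  then have "(\<lambda>m. mehler_term c t r 0 0 (2 * m)) sums (1 - r\<^sup>2 * of_real (t\<^sup>2)) powr (- 1 / 2)"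
    by (simp add: even)
  then have "mehler_term c t r 0 0 sums (1 - r\<^sup>2 * of_real (t\<^sup>2)) powr (- 1 / 2)"
  proof (subst (asm) sums_mono_reindex)
    show "mehler_term c t r 0 0 k = 0" if "k \<notin> range ((*) 2)" for k
    proof -
      from that have "odd k" by (auto elim!: evenE)
      then obtain m where "k = Suc (2 * m)" by (auto elim!: oddE)
      then show ?thesis by (simp add: mehler_term_def odd del: herm.simps)
    qed
  qed (simp_all add: strict_mono_def)
  then show ?thesis unfolding mehler_def by (simp add: sums_iff)
qed

theorem mehler_formula:
  "mehler_term c t r x y sums
     ((1 - r\<^sup>2 * of_real (t\<^sup>2)) powr (- 1 / 2) *
      exp (of_real c * (r * x * y - r\<^sup>2 * of_real t * (x\<^sup>2 + y\<^sup>2) / 2) / (1 - r\<^sup>2 * of_real (t\<^sup>2))))"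
proof -
  have "mehler x y = mehler 0 0 * exp (of_real c * (- (r\<^sup>2 * of_real t * y\<^sup>2 / 2)) / (1 - r\<^sup>2 * of_real (t\<^sup>2)))
      * exp (of_real c * (r * x * y - r\<^sup>2 * of_real t * x\<^sup>2 / 2) / (1 - r\<^sup>2 * of_real (t\<^sup>2)))"
    using mehler_first_variable[of x y] mehler_first_variable[of y 0] mehler_commute[of 0 y] by simp
  also have "\<dots> = (1 - r\<^sup>2 * of_real (t\<^sup>2)) powr (- 1 / 2) *
      exp (of_real c * (r * x * y - r\<^sup>2 * of_real t * (x\<^sup>2 + y\<^sup>2) / 2) / (1 - r\<^sup>2 * of_real (t\<^sup>2)))"
    unfolding mehler_0_0 mult.assoc mult_exp_exp add_divide_distrib[symmetric]
    by (simp add: algebra_simps add_divide_distrib)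
  finally show ?thesis
    using summable_sums[OF summable_mehler(1)[of x y]] unfolding mehler_def by simp
qed

end

section \<open>Levy continuity for sesquilinear weights\<close>

lemma
  fixes W Y :: "nat \<Rightarrow> real"
  assumes W: "\<And>k. W k \<ge> 0" "summable W" and w: "(\<Sum>k. W k) > 0"
  defines "M \<equiv> distr (density (count_space UNIV) (\<lambda>k. W k / (\<Sum>k. W k))) borel Y"
  shows real_distribution_weights: "real_distribution M"
    and char_weights: "char M s = (\<Sum>k. of_real (W k) * cis (s * Y k)) / of_real (\<Sum>k. W k)"
    and cdf_weights: "cdf M x = (\<Sum>k. if Y k \<le> x then W k else 0) / (\<Sum>k. W k)"
proof -
  define w where "w = (\<Sum>k. W k)"
  define N where "N = density (count_space UNIV) (\<lambda>k. ennreal (W k / w))"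
  have w0: "w > 0" using w by (simp add: w_def)
  have nonneg: "W k / w \<ge> 0" for k using W(1)[of k] w0 by simp
  have sm: "(\<lambda>k. W k / w) sums 1"
    using sums_divide[OF summable_sums[OF W(2)], of w] w0 by (simp add: w_def)
  have "emeasure N (space N) = (\<integral>\<^sup>+k. ennreal (W k / w) \<partial>count_space UNIV)"
    by (simp add: N_def emeasure_density)
  also have "\<dots> = (\<Sum>k. ennreal (W k / w))" by (rule nn_integral_count_space_nat)
  also have "\<dots> = 1"
    using suminf_ennreal_eq[OF nonneg sm] by simp
  finally interpret N: prob_space N by (rule prob_spaceI)
  have M: "M = distr N borel Y" by (simp add: M_def N_def w_def)
  show R: "real_distribution M"
    unfolding M by (rule N.real_distribution_distr) (simp add: N_def)
  have int: "(LINT x|M. f x) = (\<Sum>k. (W k / w) *\<^sub>R f (Y k))"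
    if f: "f \<in> borel_measurable borel" "\<And>x. norm (f x) \<le> 1" for f :: "real \<Rightarrow> 'b :: {banach, second_countable_topology}"
  proof -
    have "(LINT x|M. f x) = (LINT k|N. f (Y k))"
      unfolding M by (rule integral_distr) (use f in \<open>auto simp: N_def\<close>)
    also have "\<dots> = (LINT k|count_space UNIV. (W k / w) *\<^sub>R f (Y k))"
      unfolding N_def by (rule integral_density) (auto simp: nonneg)
    also have "\<dots> = (\<Sum>k. (W k / w) *\<^sub>R f (Y k))"
    proof (rule integral_count_space_nat)
      have "summable (\<lambda>k. norm ((W k / w) *\<^sub>R f (Y k)))"
      proof (rule summable_comparison_test')
        show "summable (\<lambda>k. W k / w)" using sm by (rule sums_summable)
        show "norm (norm ((W k / w) *\<^sub>R f (Y k))) \<le> W k / w" for k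
          using mult_left_mono[OF f(2)[of "Y k"] nonneg[of k]] W(1)[of k] w0 by simp
      qed
      then show "integrable (count_space UNIV) (\<lambda>k. (W k / w) *\<^sub>R f (Y k))"
        by (simp add: integrable_count_space_nat_iff)
    qed
    finally show ?thesis .
  qed
  have "char M s = (\<Sum>k. (W k / w) *\<^sub>R iexp (s * Y k))"
    unfolding char_def by (rule int) auto
  also have "\<dots> = (\<Sum>k. of_real (W k) * cis (s * Y k) / of_real w)"
    by (simp add: scaleR_conv_of_real cis_conv_exp)
  also have "\<dots> = (\<Sum>k. of_real (W k) * cis (s * Y k)) / of_real w"
  proof (rule suminf_divide)
    show "summable (\<lambda>k. of_real (W k) * cis (s * Y k))"
      by (rule summable_comparison_test'[OF W(2)]) (simp add: norm_mult W(1))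
  qed
  finally show "char M s = (\<Sum>k. of_real (W k) * cis (s * Y k)) / of_real (\<Sum>k. W k)"
    by (simp add: w_def)
  interpret R: real_distribution M by (rule R)
  have "cdf M x = (LINT y|M. indicator {..x} y)"
    by (simp add: cdf_def)
  also have "\<dots> = (\<Sum>k. (W k / w) *\<^sub>R indicator {..x} (Y k))"
    by (rule int) (auto simp: indicator_def)
  also have "\<dots> = (\<Sum>k. (if Y k \<le> x then W k else 0) / w)"
    by (intro suminf_cong) (simp add: indicator_def)
  also have "\<dots> = (\<Sum>k. if Y k \<le> x then W k else 0) / w"
  proof (rule suminf_divide)
    show "summable (\<lambda>k. if Y k \<le> x then W k else 0)"
      by (rule summable_comparison_test'[OF W(2)]) (simp add: W(1))
  qed
  finally show "cdf M x = (\<Sum>k. if Y k \<le> x then W k else 0) / (\<Sum>k. W k)"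
    by (simp add: w_def)
qed

text \<open>Continuity of the distribution function is included because weak convergence gives
  convergence of distribution functions at continuity points only, and the cutoff has to be
  evaluated at 0.\<close>

lemma
  fixes d :: "real \<Rightarrow> real"
  assumes d: "\<And>y. d y \<ge> 0" "integrable lborel d" and w: "(LINT y|lborel. d y) > 0"
  defines "M \<equiv> density lborel (\<lambda>y. d y / (LINT y|lborel. d y))"
  shows real_distribution_density: "real_distribution M"
    and char_density: "char M s = (LINT y|lborel. of_real (d y) * cis (s * y)) / of_real (LINT y|lborel. d y)"
    and cdf_density: "cdf M x = (LINT y|lborel. indicator {..x} y * d y) / (LINT y|lborel. d y)"
    and isCont_cdf_density: "isCont (cdf M) x"
proof -
  define w where "w = (LINT y|lborel. d y)"
  have w0: "w > 0" using w by (simp add: w_def)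
  have [measurable]: "d \<in> borel_measurable borel" using d(2) by auto
  have nonneg: "d y / w \<ge> 0" for y using d(1)[of y] w0 by simp
  have M: "M = density lborel (\<lambda>y. ennreal (d y / w))" by (simp add: M_def w_def)
  have "emeasure M (space M) = (\<integral>\<^sup>+y. ennreal (d y / w) \<partial>lborel)"
    by (simp add: M emeasure_density)
  also have "\<dots> = ennreal (LINT y|lborel. d y / w)"
    by (rule nn_integral_eq_integral) (use d nonneg in auto)
  also have "\<dots> = 1" using w0 by (simp add: w_def)
  finally have "prob_space M" by (rule prob_spaceI)
  then show R: "real_distribution M"
    by (intro real_distribution.intro real_distribution_axioms.intro) (simp_all add: M)
  interpret R: real_distribution M by (rule R)
  have int: "(LINT x|M. f x) = (LINT y|lborel. (d y / w) *\<^sub>R f y)"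
    if "f \<in> borel_measurable borel" for f :: "real \<Rightarrow> 'b :: {banach, second_countable_topology}"
    unfolding M by (rule integral_density) (use that nonneg in auto)
  have "char M s = (LINT y|lborel. (d y / w) *\<^sub>R iexp (s * y))"
    unfolding char_def by (rule int) auto
  then show "char M s = (LINT y|lborel. of_real (d y) * cis (s * y)) / of_real (LINT y|lborel. d y)"
    by (simp add: scaleR_conv_of_real cis_conv_exp w_def)
  have "cdf M x = (LINT y|M. indicator {..x} y)"
    by (simp add: cdf_def)
  also have "\<dots> = (LINT y|lborel. (d y / w) *\<^sub>R indicator {..x} y)"
    by (rule int) auto
  finally show "cdf M x = (LINT y|lborel. indicator {..x} y * d y) / (LINT y|lborel. d y)"
    by (simp add: w_def mult.commute)
  have "emeasure M {x} = 0"
    unfolding M by (subst emeasure_density) (auto intro!: nn_integral_null_set simp: null_sets_def)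
  then show "isCont (cdf M) x"
    by (simp add: R.isCont_cdf measure_def)
qed

text \<open>Total masses need not be 1, but they converge by the hypothesis at \<open>s = 0\<close>.
  Dividing by them leads to Levy's theorem, and multiplying back gives the claim.\<close>

lemma levy_continuity_weights:
  fixes W Y :: "nat \<Rightarrow> nat \<Rightarrow> real" and d :: "real \<Rightarrow> real"
  assumes W: "\<And>n k. W n k \<ge> 0" "\<And>n. summable (W n)"
    and d: "\<And>y. d y \<ge> 0" "integrable lborel d"
    and lim: "\<And>s. (\<lambda>n. \<Sum>k. of_real (W n k) * cis (s * Y n k)) \<longlonglongrightarrow> (LINT y|lborel. of_real (d y) * cis (s * y))"
  shows "(\<lambda>n. \<Sum>k. if Y n k \<le> 0 then W n k else 0) \<longlonglongrightarrow> (LINT y|lborel. indicator {..0} y * d y)"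
proof -
  define w where "w = (LINT y|lborel. d y)"
  define wn where "wn n = (\<Sum>k. W n k)" for n
  have "(\<lambda>n. of_real (wn n)) \<longlonglongrightarrow> complex_of_real w"
    using lim[of 0] W(2) d(2) by (simp add: w_def wn_def suminf_of_real)
  then have wn: "wn \<longlonglongrightarrow> w"
    by (simp only: tendsto_of_real_iff)
  have S: "summable (\<lambda>k. if Y n k \<le> 0 then W n k else 0)" for n
    by (rule summable_comparison_test'[OF W(2)[of n]]) (simp add: W(1))
  show ?thesis
  proof (cases "w = 0")
    \<comment> \<open>A limit of mass zero cannot be normalised. It does occur: in the polarization
      below the density for \<omega> equal to -1 vanishes when the two functions coincide.\<close>
    case True
    have "AE y in lborel. d y = 0"
      using True integral_nonneg_eq_0_iff_AE[OF d(2)] d(1) by (simp add: w_def)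
    then have "AE y in lborel. indicator {..0::real} y * d y = 0" by auto
    then have "(LINT y|lborel. indicator {..0} y * d y) = 0"
      by (rule integral_eq_zero_AE)
    moreover have "(\<lambda>n. \<Sum>k. if Y n k \<le> 0 then W n k else 0) \<longlonglongrightarrow> 0"
    proof (rule tendsto_sandwich[OF _ _ tendsto_const])
      show "wn \<longlonglongrightarrow> 0" using wn True by simp
      show "\<forall>\<^sub>F n in sequentially. 0 \<le> (\<Sum>k. if Y n k \<le> 0 then W n k else 0)"
        using S W(1) by (intro always_eventually allI suminf_nonneg) auto
      show "\<forall>\<^sub>F n in sequentially. (\<Sum>k. if Y n k \<le> 0 then W n k else 0) \<le> wn n"
        unfolding wn_def using S W by (intro always_eventually allI suminf_le) auto
    qed
    ultimately show ?thesis by simp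
  next
    case False
    have "w \<ge> 0" unfolding w_def by (rule Bochner_Integration.integral_nonneg) (rule d(1))
    with False have w: "w > 0" by simp
    define M' where "M' = density lborel (\<lambda>y. ennreal (d y / w))"
    \<comment> \<open>While the mass of \<open>W n\<close> may still be zero, the limit itself
      serves as a placeholder, so that every member of the sequence is a probability distribution.
      Only finitely many \<open>n\<close> are affected.\<close>
    define M where "M n = (if wn n > 0 then distr (density (count_space UNIV) (\<lambda>k. ennreal (W n k / wn n))) borel (Y n) else M')" for n
    have M: "M n = distr (density (count_space UNIV) (\<lambda>k. W n k / (\<Sum>k. W n k))) borel (Y n)"
      if "(\<Sum>k. W n k) > 0" for n
      using that by (simp add: M_def wn_def)
    have M': "M' = density lborel (\<lambda>y. d y / (LINT y|lborel. d y))"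
      by (simp add: M'_def w_def)
    note w' = w[unfolded w_def]
    have pos: "\<forall>\<^sub>F n in sequentially. (\<Sum>k. W n k) > 0"
      using order_tendstoD(1)[OF wn w] by (simp add: wn_def)
    have "weak_conv_m M M'"
    proof (rule levy_continuity)
      show rd': "real_distribution M'"
        unfolding M' by (rule real_distribution_density[OF d w'])
      show "real_distribution (M n)" for n
      proof (cases "wn n > 0")
        case True
        then show ?thesis using M[of n] real_distribution_weights[OF W(1,2), of n "Y n"] by (simp add: wn_def)
      next
        case False
        then show ?thesis using rd' by (simp add: M_def)
      qed
      show "(\<lambda>n. char (M n) s) \<longlonglongrightarrow> char M' s" for s
      proof -
        have "(\<lambda>n. (\<Sum>k. of_real (W n k) * cis (s * Y n k)) / of_real (wn n)) \<longlonglongrightarrow>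
            (LINT y|lborel. of_real (d y) * cis (s * y)) / of_real w"
          using w by (intro tendsto_divide lim tendsto_of_real wn) auto
        moreover have "\<forall>\<^sub>F n in sequentially. (\<Sum>k. of_real (W n k) * cis (s * Y n k)) / of_real (wn n) = char (M n) s"
          using pos by eventually_elim (simp add: M char_weights[OF W(1,2)] wn_def)
        ultimately have "(\<lambda>n. char (M n) s) \<longlonglongrightarrow> (LINT y|lborel. of_real (d y) * cis (s * y)) / of_real w"
          by (rule Lim_transform_eventually)
        then show ?thesis unfolding M' char_density[OF d w'] by (simp add: w_def)
      qed
    qed
    then have "(\<lambda>n. cdf (M n) 0) \<longlonglongrightarrow> cdf M' 0"
      using isCont_cdf_density[OF d w', of 0] unfolding weak_conv_m_def weak_conv_def M' by blast
    then have *: "(\<lambda>n. cdf (M n) 0 * wn n) \<longlonglongrightarrow> cdf M' 0 * w"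
      by (intro tendsto_mult wn)
    have eq: "cdf M' 0 * w = (LINT y|lborel. indicator {..0} y * d y)"
      unfolding M' cdf_density[OF d w'] w_def using w' by simp
    have "\<forall>\<^sub>F n in sequentially. cdf (M n) 0 * wn n = (\<Sum>k. if Y n k \<le> 0 then W n k else 0)"
      using pos by eventually_elim (simp add: M cdf_weights[OF W(1,2)] wn_def)
    from Lim_transform_eventually[OF * this] show ?thesis unfolding eq .
  qed
qed

section \<open>Complex weights by polarization\<close>

lemma cnj_mult_norm_le: "cmod (cnj a * b) \<le> (cmod a)\<^sup>2 + (cmod b)\<^sup>2"
proof -
  have "2 * (cmod a * cmod b) \<le> (cmod a)\<^sup>2 + (cmod b)\<^sup>2"
    using sum_squares_bound[of "cmod a" "cmod b"] by simp
  moreover have "0 \<le> cmod a * cmod b" by simp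
  ultimately show ?thesis unfolding norm_mult complex_mod_cnj by linarith
qed

lemma cnj_polarization:
  "cnj a * b = (of_real ((cmod (a + b))\<^sup>2) - of_real ((cmod (a - b))\<^sup>2)
     - \<i> * of_real ((cmod (a + \<i> * b))\<^sup>2) + \<i> * of_real ((cmod (a - \<i> * b))\<^sup>2)) / 4"
  unfolding complex_norm_square by (simp add: algebra_simps)

text \<open>Complex products are not measures to which Levy's theorem applies, but they are
  combinations of the weights \<open>(cmod (\<phi> False n k + \<omega> * \<phi> True n
  k))\<^sup>2\<close> with \<omega> a fourth root of unity. Expanding such a square uses the limits
  for all four index pairs, hence the hypothesis over all \<open>i\<close> and \<open>j\<close>;
  \<open>bool\<close> just labels the two families.\<close>

lemma levy_continuity_sesquilinear:
  fixes \<phi> :: "bool \<Rightarrow> nat \<Rightarrow> nat \<Rightarrow> complex" and f :: "bool \<Rightarrow> real \<Rightarrow> complex" and Y :: "nat \<Rightarrow> nat \<Rightarrow> real"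
  assumes \<phi>: "\<And>i n. summable (\<lambda>k. (cmod (\<phi> i n k))\<^sup>2)"
    and f: "\<And>i. f i \<in> borel_measurable borel" "\<And>i. integrable lborel (\<lambda>y. (cmod (f i y))\<^sup>2)"
    and lim: "\<And>i j s. (\<lambda>n. \<Sum>k. cnj (\<phi> i n k) * \<phi> j n k * cis (s * Y n k))
        \<longlonglongrightarrow> (LINT y|lborel. cnj (f i y) * f j y * cis (s * y))"
  shows "(\<lambda>n. \<Sum>k. if Y n k \<le> 0 then cnj (\<phi> False n k) * \<phi> True n k else 0)
        \<longlonglongrightarrow> (LINT y|lborel. indicator {..0} y * (cnj (f False y) * f True y))"
proof -
  have sumb: "summable (\<lambda>k. cnj (\<phi> i n k) * \<phi> j n k * g k)" if "\<And>k. cmod (g k) \<le> 1" for i j n g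
  proof (rule summable_comparison_test'[OF summable_add[OF \<phi>[of i n] \<phi>[of j n]]])
    show "cmod (cnj (\<phi> i n k) * \<phi> j n k * g k) \<le> (cmod (\<phi> i n k))\<^sup>2 + (cmod (\<phi> j n k))\<^sup>2" for k
      using order.trans[OF mult_left_le[OF that[of k]] cnj_mult_norm_le[of "\<phi> i n k" "\<phi> j n k"]]
      by (simp add: norm_mult mult_ac)
  qed
  have intb: "integrable lborel (\<lambda>y. cnj (f i y) * f j y * g y)"
    if g: "g \<in> borel_measurable borel" "\<And>y. cmod (g y) \<le> 1" for i j and g :: "real \<Rightarrow> complex"
  proof (rule Bochner_Integration.integrable_bound[OF Bochner_Integration.integrable_add[OF f(2)[of i] f(2)[of j]] _ always_eventually], safe)
    show "(\<lambda>y. cnj (f i y) * f j y * g y) \<in> borel_measurable lborel"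
    proof -
      have [measurable]: "cnj \<in> borel_measurable borel"
        by (intro borel_measurable_continuous_onI continuous_intros)
      have [measurable]: "f i \<in> borel_measurable borel" for i by (rule f(1))
      note g(1)[measurable]
      show ?thesis by measurable
    qed
    show "cmod (cnj (f i y) * f j y * g y) \<le> norm ((cmod (f i y))\<^sup>2 + (cmod (f j y))\<^sup>2)" for y
      using order.trans[OF mult_left_le[OF g(2)[of y]] cnj_mult_norm_le[of "f i y" "f j y"]]
      by (simp add: norm_mult mult_ac)
  qed
  define P where "P \<omega> n k = (cmod (\<phi> False n k + \<omega> * \<phi> True n k))\<^sup>2" for \<omega> n k
  define d where "d \<omega> y = (cmod (f False y + \<omega> * f True y))\<^sup>2" for \<omega> y
  have expand: "of_real ((cmod (a + \<omega> * b))\<^sup>2) = cnj a * a + cnj b * b + \<omega> * (cnj a * b) + cnj \<omega> * (cnj b * a)"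
    if "cmod \<omega> = 1" for \<omega> a b :: complex
  proof -
    have "\<omega> * cnj \<omega> = 1" using that by (simp add: complex_norm_square[symmetric])
    then have "(\<omega> * cnj \<omega>) * (cnj b * b) = cnj b * b" by simp
    then show ?thesis unfolding complex_norm_square by (simp add: algebra_simps)
  qed
  have bound: "(cmod (a + \<omega> * b))\<^sup>2 \<le> 2 * (cmod a)\<^sup>2 + 2 * (cmod b)\<^sup>2" if "cmod \<omega> = 1" for \<omega> a b :: complex
  proof -
    have "(cmod (a + \<omega> * b))\<^sup>2 \<le> (cmod a + cmod b)\<^sup>2"
      using norm_triangle_ineq[of a "\<omega> * b"] that by (intro power_mono) (auto simp: norm_mult)
    also have "\<dots> \<le> 2 * (cmod a)\<^sup>2 + 2 * (cmod b)\<^sup>2"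
      using sum_squares_bound[of "cmod a" "cmod b"] by (simp add: power2_sum)
    finally show ?thesis .
  qed
  have P_summable: "summable (P \<omega> n)" if "cmod \<omega> = 1" for \<omega> n
    by (rule summable_comparison_test'[OF summable_add[OF summable_mult[OF \<phi>[of False n], of 2] summable_mult[OF \<phi>[of True n], of 2]]])
       (use bound[OF that] in \<open>simp add: P_def\<close>)
  have P_summable': "summable (\<lambda>k. if Y n k \<le> 0 then P \<omega> n k else 0)" if "cmod \<omega> = 1" for \<omega> n
    by (rule summable_comparison_test'[OF P_summable[OF that, of n]]) (simp add: P_def)
  have [measurable]: "f i \<in> borel_measurable borel" "d \<omega> \<in> borel_measurable borel" for i \<omega>
    using f(1) unfolding d_def by auto
  have d_int: "integrable lborel (d \<omega>)" if "cmod \<omega> = 1" for \<omega>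
  proof (rule Bochner_Integration.integrable_bound[OF Bochner_Integration.integrable_add[OF
        integrable_mult_right[OF f(2)[of False], of 2] integrable_mult_right[OF f(2)[of True], of 2]] _ always_eventually])
    show "\<forall>y. norm (d \<omega> y) \<le> norm (2 * (cmod (f False y))\<^sup>2 + 2 * (cmod (f True y))\<^sup>2)"
      using bound[OF that] by (simp add: d_def)
  qed simp
  have main: "(\<lambda>n. \<Sum>k. if Y n k \<le> 0 then P \<omega> n k else 0) \<longlonglongrightarrow> (LINT y|lborel. indicator {..0} y * d \<omega> y)"
    if \<omega>: "cmod \<omega> = 1" for \<omega>
  proof (rule levy_continuity_weights[OF _ P_summable[OF \<omega>] _ d_int[OF \<omega>]])
    fix s
    let ?S = "\<lambda>i j n. \<Sum>k. cnj (\<phi> i n k) * \<phi> j n k * cis (s * Y n k)"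
    let ?I = "\<lambda>i j. LINT y|lborel. cnj (f i y) * f j y * cis (s * y)"
    have "(\<lambda>n. ?S False False n + ?S True True n + \<omega> * ?S False True n + cnj \<omega> * ?S True False n)
        \<longlonglongrightarrow> ?I False False + ?I True True + \<omega> * ?I False True + cnj \<omega> * ?I True False"
      by (intro tendsto_intros lim)
    also have "(\<lambda>n. ?S False False n + ?S True True n + \<omega> * ?S False True n + cnj \<omega> * ?S True False n)
        = (\<lambda>n. \<Sum>k. of_real (P \<omega> n k) * cis (s * Y n k))"
    proof
      fix n
      have *: "(\<lambda>k. cnj (\<phi> i n k) * \<phi> j n k * cis (s * Y n k)) sums ?S i j n" for i j
        by (intro summable_sums sumb) simp
      have "(\<lambda>k. of_real (P \<omega> n k) * cis (s * Y n k)) sums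
         (?S False False n + ?S True True n + \<omega> * ?S False True n + cnj \<omega> * ?S True False n)"
        using sums_add[OF sums_add[OF sums_add[OF *[of False False] *[of True True]] sums_mult[OF *[of False True], of \<omega>]]
            sums_mult[OF *[of True False], of "cnj \<omega>"]]
        unfolding P_def expand[OF \<omega>] by (simp only: distrib_right mult.assoc)
      then show "?S False False n + ?S True True n + \<omega> * ?S False True n + cnj \<omega> * ?S True False n
        = (\<Sum>k. of_real (P \<omega> n k) * cis (s * Y n k))" by (simp add: sums_iff)
    qed
    also have "?I False False + ?I True True + \<omega> * ?I False True + cnj \<omega> * ?I True False
        = (LINT y|lborel. of_real (d \<omega> y) * cis (s * y))"
    proof -
      have *: "integrable lborel (\<lambda>y. cnj (f i y) * f j y * cis (s * y))" for i j
        by (rule intb) (auto intro!: borel_measurable_continuous_onI continuous_intros)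
      show ?thesis
        unfolding d_def expand[OF \<omega>] distrib_right mult.assoc using * by (simp add: mult.assoc)
    qed
    finally show "(\<lambda>n. \<Sum>k. of_real (P \<omega> n k) * cis (s * Y n k)) \<longlonglongrightarrow> (LINT y|lborel. of_real (d \<omega> y) * cis (s * y))" .
  qed (simp_all add: P_def d_def)
  define L where "L \<omega> = (LINT y|lborel. indicator {..0} y * d \<omega> y)" for \<omega>
  define Q where "Q \<omega> n = (\<Sum>k. if Y n k \<le> 0 then P \<omega> n k else 0)" for \<omega> n
  have "(\<lambda>n. (of_real (Q 1 n) - of_real (Q (-1) n) - \<i> * of_real (Q \<i> n) + \<i> * of_real (Q (-\<i>) n)) / 4)
      \<longlonglongrightarrow> (of_real (L 1) - of_real (L (-1)) - \<i> * of_real (L \<i>) + \<i> * of_real (L (-\<i>))) / 4"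
    unfolding Q_def L_def by (intro tendsto_intros main) simp_all
  also have "(\<lambda>n. (of_real (Q 1 n) - of_real (Q (-1) n) - \<i> * of_real (Q \<i> n) + \<i> * of_real (Q (-\<i>) n)) / 4)
     = (\<lambda>n. \<Sum>k. if Y n k \<le> 0 then cnj (\<phi> False n k) * \<phi> True n k else 0)"
  proof
    fix n
    have *: "(\<lambda>k. of_real (if Y n k \<le> 0 then P \<omega> n k else 0)) sums complex_of_real (Q \<omega> n)" if "cmod \<omega> = 1" for \<omega>
      unfolding Q_def by (intro sums_of_real summable_sums P_summable' that)
    have "(\<lambda>k. (of_real (if Y n k \<le> 0 then P 1 n k else 0) - of_real (if Y n k \<le> 0 then P (-1) n k else 0)
        - \<i> * of_real (if Y n k \<le> 0 then P \<i> n k else 0) + \<i> * of_real (if Y n k \<le> 0 then P (-\<i>) n k else 0)) / 4)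
      sums ((of_real (Q 1 n) - of_real (Q (-1) n) - \<i> * of_real (Q \<i> n) + \<i> * of_real (Q (-\<i>) n)) / 4)"
      by (intro sums_divide sums_add sums_diff sums_mult *) simp_all
    also have "(\<lambda>k. (of_real (if Y n k \<le> 0 then P 1 n k else 0) - of_real (if Y n k \<le> 0 then P (-1) n k else 0)
        - \<i> * of_real (if Y n k \<le> 0 then P \<i> n k else 0) + \<i> * of_real (if Y n k \<le> 0 then P (-\<i>) n k else 0)) / 4)
      = (\<lambda>k. if Y n k \<le> 0 then cnj (\<phi> False n k) * \<phi> True n k else 0)"
    proof
      fix k
      show "(of_real (if Y n k \<le> 0 then P 1 n k else 0) - of_real (if Y n k \<le> 0 then P (-1) n k else 0)
        - \<i> * of_real (if Y n k \<le> 0 then P \<i> n k else 0) + \<i> * of_real (if Y n k \<le> 0 then P (-\<i>) n k else 0)) / 4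
        = (if Y n k \<le> 0 then cnj (\<phi> False n k) * \<phi> True n k else 0)"
        unfolding cnj_polarization P_def by simp
    qed
    finally show "(of_real (Q 1 n) - of_real (Q (-1) n) - \<i> * of_real (Q \<i> n) + \<i> * of_real (Q (-\<i>) n)) / 4
      = (\<Sum>k. if Y n k \<le> 0 then cnj (\<phi> False n k) * \<phi> True n k else 0)" by (simp add: sums_iff)
  qed
  also have "(of_real (L 1) - of_real (L (-1)) - \<i> * of_real (L \<i>) + \<i> * of_real (L (-\<i>))) / 4
     = (LINT y|lborel. indicator {..0} y * (cnj (f False y) * f True y))"
  proof -
    have int: "integrable lborel (\<lambda>y. complex_of_real (indicator {..0} y * d \<omega> y))" if "cmod \<omega> = 1" for \<omega>
      using integrable_mult_indicator[OF _ d_int[OF that], of "{..0}"] by (intro integrable_of_real) simp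
    have "(of_real (L 1) - of_real (L (-1)) - \<i> * of_real (L \<i>) + \<i> * of_real (L (-\<i>))) / 4
     = (LINT y|lborel. (of_real (indicator {..0} y * d 1 y) - of_real (indicator {..0} y * d (-1) y)
       - \<i> * of_real (indicator {..0} y * d \<i> y) + \<i> * of_real (indicator {..0} y * d (-\<i>) y)) / 4)"
      unfolding L_def integral_complex_of_real[symmetric] using int by (simp del: of_real_mult)
    also have "\<dots> = (LINT y|lborel. indicator {..0} y * (cnj (f False y) * f True y))"
    proof (rule Bochner_Integration.integral_cong[OF refl])
      fix y :: real
      show "(of_real (indicator {..0} y * d 1 y) - of_real (indicator {..0} y * d (-1) y)
         - \<i> * of_real (indicator {..0} y * d \<i> y) + \<i> * of_real (indicator {..0} y * d (-\<i>) y)) / 4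
         = indicator {..0} y * (cnj (f False y) * f True y)"
        unfolding cnj_polarization d_def by (cases "y \<le> 0") simp_all
    qed
    finally show ?thesis .
  qed
  finally show ?thesis .
qed

section \<open>Gaussian wave functions of coherent states\<close>

definition gauss_wave :: "complex \<Rightarrow> real \<Rightarrow> complex" where
  "gauss_wave a y = of_real (sqrt (1 / sqrt (2 * pi))) *
     exp (- (of_real y)\<^sup>2 / 4 + a * of_real y - a\<^sup>2 / 2 - of_real ((cmod a)\<^sup>2) / 2)"

text \<open>The inner product of \<open>gauss_wave a\<close> and \<open>gauss_wave b\<close>, that
  is, the overlap of two normalised coherent states; its modulus is
  \<open>exp (- (cmod (a - b))\<^sup>2 / 2)\<close>.\<close>

definition coherent :: "complex \<Rightarrow> complex \<Rightarrow> complex" where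
  "coherent a b = exp (cnj a * b - of_real ((cmod a)\<^sup>2 + (cmod b)\<^sup>2) / 2)"

lemma continuous_gauss_wave: "continuous_on UNIV (gauss_wave a)"
  unfolding gauss_wave_def by (intro continuous_intros) simp_all

text \<open>For \<open>a = b\<close> this is the normal density of variance 1 and mean
  \<open>2 * Re a\<close>; in general the mean becomes the complex number \<open>cnj a + b\<close>.
  That such a complex Gaussian factorises is what permits polarization on the side of the
  limit.\<close>

lemma cnj_gauss_wave_mult:
  "cnj (gauss_wave a y) * gauss_wave b y
   = coherent a b * (of_real (1 / sqrt (2 * pi)) * exp (- (of_real y - (cnj a + b))\<^sup>2 / 2))"
proof -
  have "cnj (gauss_wave a y) * gauss_wave b y = of_real (sqrt (1 / sqrt (2 * pi)) * sqrt (1 / sqrt (2 * pi))) *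
     exp ((- (of_real y)\<^sup>2 / 4 + cnj a * of_real y - (cnj a)\<^sup>2 / 2 - of_real ((cmod a)\<^sup>2) / 2)
       + (- (of_real y)\<^sup>2 / 4 + b * of_real y - b\<^sup>2 / 2 - of_real ((cmod b)\<^sup>2) / 2))"
    unfolding exp_add of_real_mult by (simp add: gauss_wave_def exp_cnj mult_ac del: real_sqrt_divide real_sqrt_one)
  also have "sqrt (1 / sqrt (2 * pi)) * sqrt (1 / sqrt (2 * pi)) = 1 / sqrt (2 * pi)"
    by (simp only: real_sqrt_mult_self) simp
  also have "(- (of_real y)\<^sup>2 / 4 + cnj a * of_real y - (cnj a)\<^sup>2 / 2 - of_real ((cmod a)\<^sup>2) / 2)
       + (- (of_real y)\<^sup>2 / 4 + b * of_real y - b\<^sup>2 / 2 - of_real ((cmod b)\<^sup>2) / 2)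
     = (cnj a * b - of_real ((cmod a)\<^sup>2 + (cmod b)\<^sup>2) / 2) + (- (of_real y - (cnj a + b))\<^sup>2 / 2)"
    by (simp add: field_simps power2_eq_square)
  finally show ?thesis
    unfolding exp_add coherent_def by (simp only: mult_ac)
qed

lemma integrable_complex_gaussian:
  fixes c z :: complex
  shows "integrable lborel (\<lambda>y. exp (- (of_real y - c)\<^sup>2 / 2 + of_real y * z))"
proof -
  define u where "u = Re c + Re z"
  have n: "cmod (exp (- (of_real y - c)\<^sup>2 / 2 + of_real y * z))
     = exp (u\<^sup>2 / 2 - Re (c\<^sup>2) / 2) * exp (- (1 / 2 * (y - u)\<^sup>2))" for y
    unfolding norm_exp_eq_Re mult_exp_exp u_def by (simp add: power2_eq_square field_simps)
  have "integrable lborel (\<lambda>y. exp (- (1 / 2 * (- u + 1 * y)\<^sup>2)))"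
    by (rule lborel_integrable_real_affine[OF integrable_gaussian]) simp_all
  then have "integrable lborel (\<lambda>y. exp (u\<^sup>2 / 2 - Re (c\<^sup>2) / 2) * exp (- (1 / 2 * (y - u)\<^sup>2)))"
    by simp
  then show ?thesis
    unfolding n[symmetric]
    by (rule integrable_norm_cancel)
       measurable
qed

text \<open>Translating the variable by the real part of \<open>z\<close> leaves the characteristic
  function of the standard normal distribution at the imaginary part, so no contour has to be
  moved.\<close>

lemma integral_complex_gaussian_real:
  fixes z :: complex
  shows "(LINT y|lborel. of_real (1 / sqrt (2 * pi)) * exp (- (of_real y)\<^sup>2 / 2 + of_real y * z)) = exp (z\<^sup>2 / 2)"
proof -
  define u v where "u = Re z" and "v = Im z"
  have z: "z = of_real u + \<i> * of_real v" by (simp add: u_def v_def complex_eq_iff)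
  let ?f = "\<lambda>y. of_real (1 / sqrt (2 * pi)) * exp (- (of_real y)\<^sup>2 / 2 + of_real y * z)"
  have "(LINT y|lborel. ?f y) = (LINT y|lborel. ?f (u + 1 * y))"
    using lborel_integral_real_affine[of 1 ?f u] by simp
  also have "\<dots> = (LINT y|lborel. exp (of_real (u\<^sup>2 / 2) + \<i> * of_real (u * v)) * (std_normal_density y *\<^sub>R iexp (v * y)))"
  proof (rule Bochner_Integration.integral_cong[OF refl])
    fix y :: real
    have "?f (u + 1 * y) = of_real (1 / sqrt (2 * pi)) *
        exp (of_real (u\<^sup>2 / 2) + \<i> * of_real (u * v) + (of_real (- y\<^sup>2 / 2) + \<i> * of_real (v * y)))"
    proof -
      have "- (of_real (u + 1 * y))\<^sup>2 / 2 + of_real (u + 1 * y) * z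
        = of_real (u\<^sup>2 / 2) + \<i> * of_real (u * v) + (of_real (- y\<^sup>2 / 2) + \<i> * of_real (v * y))"
        unfolding z by (simp add: power2_eq_square field_simps)
      then show ?thesis by (simp only:)
    qed
    also have "\<dots> = exp (of_real (u\<^sup>2 / 2) + \<i> * of_real (u * v)) *
        (of_real (1 / sqrt (2 * pi) * exp (- y\<^sup>2 / 2)) * iexp (v * y))"
      unfolding exp_add of_real_mult exp_of_real by (simp only: mult_ac)
    finally show "?f (u + 1 * y) = exp (of_real (u\<^sup>2 / 2) + \<i> * of_real (u * v)) * (std_normal_density y *\<^sub>R iexp (v * y))"
      unfolding std_normal_density_def scaleR_conv_of_real .
  qed
  also have "\<dots> = exp (of_real (u\<^sup>2 / 2) + \<i> * of_real (u * v)) * (LINT y|lborel. std_normal_density y *\<^sub>R iexp (v * y))"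
    by (rule integral_mult_right_zero)
  also have "(LINT y|lborel. std_normal_density y *\<^sub>R iexp (v * y)) = char std_normal_distribution v"
    unfolding char_def by (rule integral_density[symmetric]) auto
  also have "\<dots> = exp (of_real (- v\<^sup>2 / 2))"
    by (simp add: char_std_normal_distribution exp_of_real[symmetric])
  also have "exp (of_real (u\<^sup>2 / 2) + \<i> * of_real (u * v)) * exp (of_real (- v\<^sup>2 / 2)) = exp (z\<^sup>2 / 2)"
    unfolding mult_exp_exp z by (rule arg_cong[of _ _ exp]) (simp add: power2_eq_square field_simps)
  finally show ?thesis .
qed

lemma integral_gauss_wave:
  "(LINT y|lborel. cnj (gauss_wave a y) * gauss_wave b y * cis (s * y))
   = coherent a b * exp (\<i> * of_real s * (cnj a + b) - of_real (s\<^sup>2) / 2)"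
proof -
  define c where "c = cnj a + b"
  have "(LINT y|lborel. cnj (gauss_wave a y) * gauss_wave b y * cis (s * y))
     = (LINT y|lborel. coherent a b * exp (- c\<^sup>2 / 2) *
        (of_real (1 / sqrt (2 * pi)) * exp (- (of_real y)\<^sup>2 / 2 + of_real y * (c + \<i> * of_real s))))"
  proof (rule Bochner_Integration.integral_cong[OF refl])
    fix y :: real
    have "exp (- (of_real y - c)\<^sup>2 / 2) * cis (s * y)
      = exp (- c\<^sup>2 / 2) * exp (- (of_real y)\<^sup>2 / 2 + of_real y * (c + \<i> * of_real s))"
      unfolding cis_conv_exp mult_exp_exp
      by (rule arg_cong[of _ _ exp]) (simp add: power2_eq_square field_simps)
    note e = this
    have "cnj (gauss_wave a y) * gauss_wave b y * cis (s * y)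
      = coherent a b * (of_real (1 / sqrt (2 * pi)) * (exp (- (of_real y - c)\<^sup>2 / 2) * cis (s * y)))"
      unfolding cnj_gauss_wave_mult c_def[symmetric] by (simp only: mult.assoc)
    then show "cnj (gauss_wave a y) * gauss_wave b y * cis (s * y) = coherent a b * exp (- c\<^sup>2 / 2) *
        (of_real (1 / sqrt (2 * pi)) * exp (- (of_real y)\<^sup>2 / 2 + of_real y * (c + \<i> * of_real s)))"
      unfolding e by (simp only: mult_ac)
  qed
  also have "\<dots> = coherent a b * exp (- c\<^sup>2 / 2) * exp ((c + \<i> * of_real s)\<^sup>2 / 2)"
    by (subst integral_mult_right_zero) (simp only: integral_complex_gaussian_real)
  also have "\<dots> = coherent a b * exp (\<i> * of_real s * c - of_real (s\<^sup>2) / 2)"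
    unfolding mult.assoc mult_exp_exp
    by (rule arg_cong[of _ _ "\<lambda>x. coherent a b * exp x"]) (simp add: power2_eq_square field_simps)
  finally show ?thesis by (simp add: c_def)
qed

lemma integrable_gauss_wave: "integrable lborel (\<lambda>y. (cmod (gauss_wave a y))\<^sup>2)"
proof -
  have "integrable lborel (\<lambda>y. coherent a a * (of_real (1 / sqrt (2 * pi)) * exp (- (of_real y - (cnj a + a))\<^sup>2 / 2)))"
    using integrable_complex_gaussian[of "cnj a + a" 0] by simp
  then have "integrable lborel (\<lambda>y. cnj (gauss_wave a y) * gauss_wave a y)"
    unfolding cnj_gauss_wave_mult .
  then have "integrable lborel (\<lambda>y. complex_of_real ((cmod (gauss_wave a y))\<^sup>2))"
    by (simp only: complex_norm_square mult.commute)
  then show ?thesis by (simp only: complex_of_real_integrable_eq)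
qed

lemma integral_gauss_wave_half:
  "(LINT y|lborel. indicator {..0} y * (cnj (gauss_wave a y) * gauss_wave b y))
   = coherent a b * (erfc ((cnj a + b) / of_real (sqrt 2)) / 2)"
proof -
  define c where "c = cnj a + b"
  let ?f = "\<lambda>y. indicator {..0} y * (of_real (1 / sqrt (2 * pi)) * exp (- (of_real y - c)\<^sup>2 / 2)) :: complex"
  have "(LINT y|lborel. indicator {..0} y * (cnj (gauss_wave a y) * gauss_wave b y))
      = (LINT y|lborel. coherent a b * ?f y)"
    unfolding cnj_gauss_wave_mult c_def by (rule Bochner_Integration.integral_cong) (auto simp: mult_ac)
  also have "\<dots> = coherent a b * (LINT y|lborel. ?f y)" by (rule integral_mult_right_zero)
  \<comment> \<open>The substitution \<open>y = - sqrt 2 * s\<close> turns the half-line below 0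
    into the ray that defines \<open>erfc\<close> at \<open>c / sqrt 2\<close>.\<close>
  also have "(LINT y|lborel. ?f y) = sqrt 2 *\<^sub>R (LINT s|lborel. ?f (0 + (- sqrt 2) * s))"
    by (subst lborel_integral_real_affine[of "- sqrt 2" _ 0]) simp_all
  also have "(\<lambda>s. ?f (0 + (- sqrt 2) * s))
      = (\<lambda>s. of_real (1 / sqrt (2 * pi)) * (indicator {0..} s *\<^sub>R exp (- (c / of_real (sqrt 2) + of_real s)\<^sup>2)))"
  proof
    fix s :: real
    have r: "complex_of_real (sqrt 2) * of_real (sqrt 2) = 2"
      by (simp flip: of_real_mult)
    then have r2: "(complex_of_real (sqrt 2))\<^sup>2 = 2" by (simp add: power2_eq_square)
    have n: "complex_of_real (sqrt 2) \<noteq> 0" by simp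
    have "- (of_real (0 + - sqrt 2 * s) - c)\<^sup>2 / 2 = - (of_real (sqrt 2) * (c / of_real (sqrt 2) + of_real s))\<^sup>2 / 2"
    proof -
      have "of_real (sqrt 2) * (c / of_real (sqrt 2) + of_real s) = - (of_real (0 + - sqrt 2 * s) - c)"
        using n by (simp add: distrib_left)
      then show ?thesis by (simp only: power2_minus)
    qed
    also have "\<dots> = - (c / of_real (sqrt 2) + of_real s)\<^sup>2"
      unfolding power_mult_distrib r2 by simp
    finally show "?f (0 + (- sqrt 2) * s) = of_real (1 / sqrt (2 * pi)) *
        (indicator {0..} s *\<^sub>R exp (- (c / of_real (sqrt 2) + of_real s)\<^sup>2))"
      by (simp add: indicator_def zero_le_mult_iff)
  qed
  also have "sqrt 2 *\<^sub>R (LINT s|lborel. of_real (1 / sqrt (2 * pi)) *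
      (indicator {0..} s *\<^sub>R exp (- (c / of_real (sqrt 2) + of_real s)\<^sup>2)))
      = erfc (c / of_real (sqrt 2)) / 2"
    unfolding erfc_def set_lebesgue_integral_def integral_mult_right_zero
    by (simp add: scaleR_conv_of_real real_sqrt_mult)
  finally show ?thesis by (simp add: c_def)
qed

section \<open>The saddle point on the ellipse\<close>

lemma
  fixes u :: real
  shows cis_expansion_1: "(\<lambda>n. of_real (sqrt (real n)) * (cis (u / sqrt (real n)) - 1)) \<longlonglongrightarrow> \<i> * of_real u"
    and cis_expansion_2: "(\<lambda>n. of_nat n * (cis (u / sqrt (real n)) - 1 - \<i> * of_real (u / sqrt (real n)))) \<longlonglongrightarrow> - of_real (u\<^sup>2) / 2"
proof -
  have 1: "(\<lambda>n. sqrt (real n) * (cos (u / sqrt (real n)) - 1)) \<longlonglongrightarrow> 0"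
    by real_asymp
  have 2: "(\<lambda>n. sqrt (real n) * sin (u / sqrt (real n))) \<longlonglongrightarrow> u"
    by real_asymp
  have 3: "(\<lambda>n. real n * (cos (u / sqrt (real n)) - 1)) \<longlonglongrightarrow> - (u * u / 2)"
    by real_asymp
  have 4: "(\<lambda>n. real n * (sin (u / sqrt (real n)) - u / sqrt (real n))) \<longlonglongrightarrow> 0"
    by real_asymp
  show "(\<lambda>n. of_real (sqrt (real n)) * (cis (u / sqrt (real n)) - 1)) \<longlonglongrightarrow> \<i> * of_real u"
    using 1 2 by (simp add: tendsto_complex_iff)
  show "(\<lambda>n. of_nat n * (cis (u / sqrt (real n)) - 1 - \<i> * of_real (u / sqrt (real n)))) \<longlonglongrightarrow> - of_real (u\<^sup>2) / 2"
    using 3 4 by (simp add: tendsto_complex_iff power2_eq_square)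
qed

definition mehler_exponent :: "real \<Rightarrow> complex \<Rightarrow> complex \<Rightarrow> complex \<Rightarrow> complex" where
  "mehler_exponent t r x y = (r * x * y - r\<^sup>2 * of_real t * (x\<^sup>2 + y\<^sup>2) / 2) / (1 - r\<^sup>2 * of_real (t\<^sup>2))"

text \<open>In the variables \<open>x + y\<close> and \<open>x - y\<close> the exponent is diagonal,
  with coefficients that are Moebius functions of \<open>r\<close>, so subtracting the value at 1
  splits off \<open>r - 1\<close>. For conjugate arguments the two variables are
  \<open>2 * Re w\<close> and \<open>- 2 * \<i> * Im w\<close>, and the remaining factor at
  \<open>r = 1\<close> is a multiple of the ellipse form.\<close>

lemma mehler_exponent_diff:
  assumes t: "0 < t" "t < 1" and r: "cmod r * t < 1"
  shows "mehler_exponent t r x y - mehler_exponent t 1 x y =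
    (r - 1) / 4 * ((x + y)\<^sup>2 / ((1 + r * of_real t) * (1 + of_real t))
      - (x - y)\<^sup>2 / ((1 - r * of_real t) * (1 - of_real t)))"
proof -
  have rt: "cmod (r * of_real t) < 1" using t r by (simp add: norm_mult)
  have nz: "1 + r * of_real t \<noteq> 0" "1 - r * of_real t \<noteq> 0"
    using rt by (metis add_eq_0_iff norm_minus_cancel norm_one less_irrefl, force)
  have nz1: "1 + complex_of_real t \<noteq> 0" "1 - complex_of_real t \<noteq> 0"
    using t by (simp_all add: complex_eq_iff)
  have exp: "mehler_exponent t q x y = q / 4 * ((x + y)\<^sup>2 / (1 + q * of_real t) - (x - y)\<^sup>2 / (1 - q * of_real t))"
    if "1 + q * of_real t \<noteq> 0" "1 - q * of_real t \<noteq> 0" for q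
  proof -
    have "1 - q\<^sup>2 * of_real (t\<^sup>2) = (1 + q * of_real t) * (1 - q * of_real t)"
      by (simp add: algebra_simps power2_eq_square)
    moreover have "q / 4 * ((x + y)\<^sup>2 / (1 + q * of_real t) - (x - y)\<^sup>2 / (1 - q * of_real t))
      = q / 4 * ((x + y)\<^sup>2 * (1 - q * of_real t) - (x - y)\<^sup>2 * (1 + q * of_real t)) / ((1 + q * of_real t) * (1 - q * of_real t))"
      using that by (simp add: diff_frac_eq)
    moreover have "q / 4 * ((x + y)\<^sup>2 * (1 - q * of_real t) - (x - y)\<^sup>2 * (1 + q * of_real t))
      = q * x * y - q\<^sup>2 * of_real t * (x\<^sup>2 + y\<^sup>2) / 2"
      by (simp add: field_simps power2_eq_square)
    ultimately show ?thesis unfolding mehler_exponent_def by (simp only:)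
  qed
  have plus: "r / (1 + r * of_real t) - 1 / (1 + of_real t) = (r - 1) / ((1 + r * of_real t) * (1 + of_real t))"
    using nz nz1 by (simp add: divide_simps) (simp add: algebra_simps)
  have minus: "r / (1 - r * of_real t) - 1 / (1 - of_real t) = (r - 1) / ((1 - r * of_real t) * (1 - of_real t))"
    using nz nz1 by (simp add: divide_simps) (simp add: algebra_simps)
  have "mehler_exponent t r x y - mehler_exponent t 1 x y
     = (x + y)\<^sup>2 / 4 * (r / (1 + r * of_real t) - 1 / (1 + of_real t))
       - (x - y)\<^sup>2 / 4 * (r / (1 - r * of_real t) - 1 / (1 - of_real t))"
  proof -
    have *: "q / 4 * (S / a - D / b) - 1 / 4 * (S / a' - D / b')
        = S / 4 * (q / a - 1 / a') - D / 4 * (q / b - 1 / b')" for q S D a b a' b' :: complex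
      by (simp add: algebra_simps)
    show ?thesis
      unfolding exp[OF nz] using exp[of 1] nz1 *[of r "(x + y)\<^sup>2" "1 + r * of_real t" "(x - y)\<^sup>2"]
      by (simp only: mult_1 simp_thms)
  qed
  moreover have "S / 4 * (q / a) - D / 4 * (q / b) = q / 4 * (S / a - D / b)" for q S D a b :: complex
    by (simp add: algebra_simps)
  ultimately show ?thesis unfolding plus minus by (simp only:)
qed

text \<open>A second order expansion at \<open>r = 1\<close> with \<open>r - 1\<close> of order
  \<open>1 / sqrt n\<close>. Condition \<open>E\<close> lets the centring cancel the divergent
  linear term, \<open>S\<close> says that the quadratic coefficient is the variance, and the
  displacements \<open>A\<close>, \<open>B\<close> survive only through their cross terms with the
  base point.\<close>

lemma boundary_exponent_limit:
  fixes t x y s \<sigma> :: real and A B :: complex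
  assumes t: "0 < t" "t < 1" and \<sigma>: "\<sigma> > 0"
    and E: "(1 - t\<^sup>2) * (x\<^sup>2 / (1 + t)\<^sup>2 + y\<^sup>2 / (1 - t)\<^sup>2) = 1"
    and S: "\<sigma>\<^sup>2 = 1 + 2 * (1 - t\<^sup>2) * (- t * x\<^sup>2 / (1 + t) ^ 3 + t * y\<^sup>2 / (1 - t) ^ 3)"
  defines "\<tau> \<equiv> \<lambda>n. s / (\<sigma> * sqrt (real n))"
  defines "W \<equiv> \<lambda>n. of_real x - \<i> * of_real y + A / of_real (sqrt (real n))"
  defines "Z \<equiv> \<lambda>n. of_real x + \<i> * of_real y + B / of_real (sqrt (real n))"
  shows "(\<lambda>n. of_real (real n * (1 - t\<^sup>2)) * (mehler_exponent t (cis (\<tau> n)) (W n) (Z n) - mehler_exponent t 1 (W n) (Z n))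
           - \<i> * of_real (real n * \<tau> n))
     \<longlonglongrightarrow> \<i> * of_real (s / \<sigma> * (1 - t\<^sup>2)) * (of_real (x / (1 + t)\<^sup>2) * (A + B) + \<i> * of_real (y / (1 - t)\<^sup>2) * (A - B))
       - of_real (s\<^sup>2) / 2"
proof -
  define u where "u = s / \<sigma>"
  define r where "r n = cis (\<tau> n)" for n
  define \<delta> where "\<delta> n = of_real (sqrt (real n)) * (r n - 1)" for n
  define q where "q = complex_of_real t"
  define gp where "gp n = 1 / ((1 + r n * q) * (1 + q))" for n
  define gm where "gm n = 1 / ((1 - r n * q) * (1 - q))" for n
  have \<tau>: "\<tau> n = u / sqrt (real n)" for n by (simp add: \<tau>_def u_def)
  have r: "r \<longlonglongrightarrow> 1"
  proof -
    have "\<tau> \<longlonglongrightarrow> 0" unfolding \<tau> by real_asymp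
    then have "(\<lambda>n. cis (\<tau> n)) \<longlonglongrightarrow> cis 0" by (intro tendsto_intros)
    then show ?thesis by (simp add: r_def[abs_def])
  qed
  have \<delta>: "\<delta> \<longlonglongrightarrow> \<i> * of_real u"
    using cis_expansion_1[of u] by (simp add: \<delta>_def[abs_def] r_def \<tau>)
  have rt: "cmod (r n) * t < 1" for n using t by (simp add: r_def)
  have nz1: "1 + q \<noteq> 0" "1 - q \<noteq> 0"
    using t by (simp_all add: q_def complex_eq_iff)
  have rq: "cmod (r n * q) < 1" for n using rt[of n] t by (simp add: norm_mult q_def)
  have nz: "1 + r n * q \<noteq> 0" "1 - r n * q \<noteq> 0" for n
    using rq[of n] by (metis add_eq_0_iff norm_minus_cancel norm_one less_irrefl, force)
  have gp: "gp \<longlonglongrightarrow> 1 / (1 + q)\<^sup>2"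
  proof -
    have "gp \<longlonglongrightarrow> 1 / ((1 + 1 * q) * (1 + q))"
      unfolding gp_def using nz1 by (intro tendsto_intros r) auto
    then show ?thesis by (simp add: power2_eq_square)
  qed
  have gm: "gm \<longlonglongrightarrow> 1 / (1 - q)\<^sup>2"
  proof -
    have "gm \<longlonglongrightarrow> 1 / ((1 - 1 * q) * (1 - q))"
      unfolding gm_def using nz1 by (intro tendsto_intros r) auto
    then show ?thesis by (simp add: power2_eq_square)
  qed
  \<comment> \<open>Exact first order expansions of \<open>gp\<close> and \<open>gm\<close>.
    Multiplied by \<open>n * (r n - 1)\<close>, their remainders contain the square of
    \<open>\<delta> n\<close>, which has a finite limit.\<close>
  have gp': "gp n = 1 / (1 + q)\<^sup>2 - q * (r n - 1) / (1 + q) * gp n" for n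
    unfolding gp_def using nz[of n] nz1 by (simp add: divide_simps power2_eq_square) (simp add: algebra_simps)
  have gm': "gm n = 1 / (1 - q)\<^sup>2 + q * (r n - 1) / (1 - q) * gm n" for n
    unfolding gm_def using nz[of n] nz1 by (simp add: divide_simps power2_eq_square) (simp add: algebra_simps)
  have d0: "(\<lambda>n. r n - 1) \<longlonglongrightarrow> 0" using tendsto_diff[OF r tendsto_const[of 1]] by simp
  define X Y k where "X = complex_of_real x" and "Y = complex_of_real y" and "k = complex_of_real (1 - t\<^sup>2)"
  have E': "k * (X\<^sup>2 / (1 + q)\<^sup>2 + Y\<^sup>2 / (1 - q)\<^sup>2) = 1"
    using arg_cong[OF E, of complex_of_real] by (simp add: X_def Y_def k_def q_def)
  \<comment> \<open>The centred exponent regrouped so that each line converges separately: the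
    linear term after centring, the curvature, the coupling to \<open>A\<close> and
    \<open>B\<close>, and a remainder tending to 0.\<close>
  define T where "T n = of_nat n * (r n - 1 - \<i> * of_real (\<tau> n))
      + k * (X\<^sup>2 * (- q / (1 + q) * (\<delta> n)\<^sup>2 * gp n) + Y\<^sup>2 * (q / (1 - q) * (\<delta> n)\<^sup>2 * gm n))
      + k * (X * (A + B) * \<delta> n * gp n + \<i> * Y * (A - B) * \<delta> n * gm n)
      + k * (r n - 1) / 4 * ((A + B)\<^sup>2 * gp n - (A - B)\<^sup>2 * gm n)" for n
  have "T \<longlonglongrightarrow> - of_real (u\<^sup>2) / 2
      + k * (X\<^sup>2 * (- q / (1 + q) * (\<i> * of_real u)\<^sup>2 * (1 / (1 + q)\<^sup>2)) + Y\<^sup>2 * (q / (1 - q) * (\<i> * of_real u)\<^sup>2 * (1 / (1 - q)\<^sup>2)))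
      + k * (X * (A + B) * (\<i> * of_real u) * (1 / (1 + q)\<^sup>2) + \<i> * Y * (A - B) * (\<i> * of_real u) * (1 / (1 - q)\<^sup>2))
      + k * 0 / 4 * ((A + B)\<^sup>2 * (1 / (1 + q)\<^sup>2) - (A - B)\<^sup>2 * (1 / (1 - q)\<^sup>2))"
    unfolding T_def by (intro tendsto_intros gp gm \<delta> d0) (use cis_expansion_2[of u] in \<open>simp_all add: r_def \<tau>\<close>)
  also have "- of_real (u\<^sup>2) / 2
      + k * (X\<^sup>2 * (- q / (1 + q) * (\<i> * of_real u)\<^sup>2 * (1 / (1 + q)\<^sup>2)) + Y\<^sup>2 * (q / (1 - q) * (\<i> * of_real u)\<^sup>2 * (1 / (1 - q)\<^sup>2)))
      + k * (X * (A + B) * (\<i> * of_real u) * (1 / (1 + q)\<^sup>2) + \<i> * Y * (A - B) * (\<i> * of_real u) * (1 / (1 - q)\<^sup>2))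
      + k * 0 / 4 * ((A + B)\<^sup>2 * (1 / (1 + q)\<^sup>2) - (A - B)\<^sup>2 * (1 / (1 - q)\<^sup>2))
    = \<i> * of_real u * k * (X / (1 + q)\<^sup>2 * (A + B) + \<i> * (Y / (1 - q)\<^sup>2) * (A - B))
      - of_real u ^ 2 / 2 * (1 + 2 * k * (- q * X\<^sup>2 / (1 + q) ^ 3 + q * Y\<^sup>2 / (1 - q) ^ 3))"
  proof -
    define i j where "i = inverse (1 + q)" and "j = inverse (1 - q)"
    have e: "a / (1 + q) = a * i" "a / (1 - q) = a * j" "a / (1 + q)\<^sup>2 = a * i\<^sup>2" "a / (1 - q)\<^sup>2 = a * j\<^sup>2"
      "a / (1 + q) ^ 3 = a * i ^ 3" "a / (1 - q) ^ 3 = a * j ^ 3" for a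
      by (simp_all add: i_def j_def divide_inverse power_inverse)
    show ?thesis
      unfolding e by (simp add: power2_eq_square power3_eq_cube algebra_simps)
  qed
  also have "1 + 2 * k * (- q * X\<^sup>2 / (1 + q) ^ 3 + q * Y\<^sup>2 / (1 - q) ^ 3) = of_real (\<sigma>\<^sup>2)"
    unfolding S by (simp add: X_def Y_def k_def q_def)
  also have "of_real u ^ 2 / 2 * of_real (\<sigma>\<^sup>2) = complex_of_real (s\<^sup>2) / 2"
    using \<sigma> by (simp add: u_def power_divide)
  also have "\<i> * of_real u * k * (X / (1 + q)\<^sup>2 * (A + B) + \<i> * (Y / (1 - q)\<^sup>2) * (A - B))
     = \<i> * of_real (s / \<sigma> * (1 - t\<^sup>2)) * (of_real (x / (1 + t)\<^sup>2) * (A + B) + \<i> * of_real (y / (1 - t)\<^sup>2) * (A - B))"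
    by (simp add: u_def k_def X_def Y_def q_def)
  finally have lim: "T \<longlonglongrightarrow> \<i> * of_real (s / \<sigma> * (1 - t\<^sup>2)) * (of_real (x / (1 + t)\<^sup>2) * (A + B) + \<i> * of_real (y / (1 - t)\<^sup>2) * (A - B))
       - of_real (s\<^sup>2) / 2" .
  have "\<forall>\<^sub>F n in sequentially. T n = of_real (real n * (1 - t\<^sup>2)) * (mehler_exponent t (cis (\<tau> n)) (W n) (Z n) - mehler_exponent t 1 (W n) (Z n))
           - \<i> * of_real (real n * \<tau> n)"
    using eventually_gt_at_top[of 0]
  proof eventually_elim
    case (elim n)
    define h where "h = complex_of_real (sqrt (real n))"
    have h: "h \<noteq> 0" "h\<^sup>2 = of_nat n" using elim by (simp_all add: h_def flip: of_real_power)
    define d where "d = r n - 1"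
    have \<delta>n: "\<delta> n = h * d" by (simp add: \<delta>_def h_def d_def)
    have p: "h\<^sup>2 * (W n + Z n)\<^sup>2 = 4 * X\<^sup>2 * h\<^sup>2 + 4 * X * (A + B) * h + (A + B)\<^sup>2"
      and m: "h\<^sup>2 * (W n - Z n)\<^sup>2 = - 4 * Y\<^sup>2 * h\<^sup>2 - 4 * \<i> * Y * (A - B) * h + (A - B)\<^sup>2"
    proof -
      have "h * (W n + Z n) = 2 * X * h + (A + B)" "h * (W n - Z n) = - 2 * \<i> * Y * h + (A - B)"
        using h(1) by (simp_all add: W_def Z_def X_def Y_def h_def[symmetric] field_simps)
      then have "(h * (W n + Z n))\<^sup>2 = (2 * X * h + (A + B))\<^sup>2" "(h * (W n - Z n))\<^sup>2 = (- 2 * \<i> * Y * h + (A - B))\<^sup>2"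
        by (simp_all only:)
      then show "h\<^sup>2 * (W n + Z n)\<^sup>2 = 4 * X\<^sup>2 * h\<^sup>2 + 4 * X * (A + B) * h + (A + B)\<^sup>2"
        "h\<^sup>2 * (W n - Z n)\<^sup>2 = - 4 * Y\<^sup>2 * h\<^sup>2 - 4 * \<i> * Y * (A - B) * h + (A - B)\<^sup>2"
        by (simp_all add: power2_eq_square algebra_simps)
    qed
    have "of_real (real n * (1 - t\<^sup>2)) * (mehler_exponent t (cis (\<tau> n)) (W n) (Z n) - mehler_exponent t 1 (W n) (Z n))
      = k * d / 4 * ((h\<^sup>2 * (W n + Z n)\<^sup>2) * gp n - (h\<^sup>2 * (W n - Z n)\<^sup>2) * gm n)"
      unfolding r_def[symmetric] mehler_exponent_diff[OF t rt] h(2)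
      by (simp add: gp_def gm_def k_def d_def q_def algebra_simps)
    also have "\<dots> = h\<^sup>2 * d * (k * (X\<^sup>2 * gp n + Y\<^sup>2 * gm n))
      + k * (X * (A + B) * (h * d) * gp n + \<i> * Y * (A - B) * (h * d) * gm n)
      + k * d / 4 * ((A + B)\<^sup>2 * gp n - (A - B)\<^sup>2 * gm n)"
      unfolding p m by (simp add: field_simps)
    also have "k * (X\<^sup>2 * gp n + Y\<^sup>2 * gm n) = k * (X\<^sup>2 / (1 + q)\<^sup>2 + Y\<^sup>2 / (1 - q)\<^sup>2)
        + k * (X\<^sup>2 * (- q / (1 + q) * d * gp n) + Y\<^sup>2 * (q / (1 - q) * d * gm n))"
      by (subst gp', subst gm') (simp add: d_def[symmetric] algebra_simps)
    \<comment> \<open>On the ellipse the leading term is therefore exactly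
      \<open>n * (r n - 1)\<close>, whose divergent part the centring removes.\<close>
    also have "k * (X\<^sup>2 / (1 + q)\<^sup>2 + Y\<^sup>2 / (1 - q)\<^sup>2) = 1" by (rule E')
    finally show ?case
      unfolding T_def \<delta>n d_def[symmetric] h(2)[symmetric]
      by (simp add: algebra_simps power2_eq_square[of "_ * _"] h(2)) (simp add: power2_eq_square algebra_simps)
  qed
  with lim show ?thesis by (rule Lim_transform_eventually)
qed

section \<open>The generating function of the kernel\<close>

definition scaled_point :: "complex \<Rightarrow> real \<Rightarrow> complex \<Rightarrow> nat \<Rightarrow> complex" where
  "scaled_point z0 \<psi> a n = z0 + a * cis \<psi> / of_real (sqrt (real n))"

definition gauge_phase :: "real \<Rightarrow> complex \<Rightarrow> real \<Rightarrow> complex \<Rightarrow> nat \<Rightarrow> real" where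
  "gauge_phase t z0 \<psi> a n = sqrt (real n) * Im (cnj (a * cis \<psi>) * (z0 - of_real t * cnj z0)) + t / 2 * Im ((a * cis \<psi>)\<^sup>2)"

text \<open>
  The squared moduli sum to 1 over \<open>k\<close>, and the gauge phase removes the part of \<^const>\<open>phase\<close> that
  grows with \<open>n\<close>, so that the products converge.
\<close>

definition level_amplitude :: "real \<Rightarrow> complex \<Rightarrow> real \<Rightarrow> complex \<Rightarrow> nat \<Rightarrow> nat \<Rightarrow> complex" where
  "level_amplitude t z0 \<psi> a n k =
     (let c = real n * (1 - t\<^sup>2); z = scaled_point z0 \<psi> a n in
      of_real (sqrt (sqrt (1 - t\<^sup>2)) * exp (- (real n / 2) * elliptic_potential t z) / sqrt (fact k * c ^ k))
      * poly (herm (of_real c) (of_real t) k) z * cis (gauge_phase t z0 \<psi> a n))"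

text \<open>A phase that is a difference of a function of \<open>a\<close> and the same function of
  \<open>b\<close> can be distributed over the two factors of every summand. Only
  \<open>Im (cnj a * b)\<close> is left, and this is what completes
  \<open>exp (- (cmod (a - b))\<^sup>2 / 2)\<close> to \<open>coherent a b\<close>.\<close>

lemma phase_gauge_phase:
  "phase t z0 \<psi> a b n = gauge_phase t z0 \<psi> a n - gauge_phase t z0 \<psi> b n + Im (cnj a * b)"
proof -
  have e: "cis (- \<psi>) = cnj (cis \<psi>)" "cis (2 * \<psi>) = (cis \<psi>)\<^sup>2"
    by (simp_all add: cis_cnj power2_eq_square cis_mult)
  have "Im (cis (- \<psi>) * (cnj a - cnj b) * (z0 - of_real t * cnj z0))
    = Im (cnj (a * cis \<psi>) * (z0 - of_real t * cnj z0)) - Im (cnj (b * cis \<psi>) * (z0 - of_real t * cnj z0))"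
    unfolding e minus_complex.sel(2)[symmetric] by (rule arg_cong[of _ _ Im]) (simp add: algebra_simps)
  moreover have "Im (cnj a * b + of_real (t / 2) * cis (2 * \<psi>) * (a\<^sup>2 - b\<^sup>2))
    = Im (cnj a * b) + t / 2 * (Im ((a * cis \<psi>)\<^sup>2) - Im ((b * cis \<psi>)\<^sup>2))"
  proof -
    have "of_real (t / 2) * cis (2 * \<psi>) * (a\<^sup>2 - b\<^sup>2) = of_real (t / 2) * ((a * cis \<psi>)\<^sup>2 - (b * cis \<psi>)\<^sup>2)"
      unfolding e power_mult_distrib by (simp only: right_diff_distrib mult_ac)
    moreover have "Im (of_real (t / 2) * X) = t / 2 * Im X" for X by simp
    ultimately show ?thesis by (simp only: plus_complex.sel minus_complex.sel)
  qed
  ultimately show ?thesis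
    unfolding phase_def gauge_phase_def by (simp add: algebra_simps)
qed

lemma cis_Im_coherent: "cis (Im (cnj a * b)) * of_real (exp (- (cmod (a - b))\<^sup>2 / 2)) = coherent a b"
proof -
  have "\<i> * of_real (Im (cnj a * b)) + of_real (- (cmod (a - b))\<^sup>2 / 2)
    = cnj a * b - of_real ((cmod a)\<^sup>2 + (cmod b)\<^sup>2) / 2"
    by (simp add: complex_eq_iff cmod_power2) (simp add: power2_eq_square algebra_simps)
  then show ?thesis
    unfolding coherent_def cis_conv_exp exp_of_real[symmetric] mult_exp_exp by (simp only:)
qed

lemma coherent_diag: "coherent a a = 1"
  unfolding coherent_def complex_norm_square of_real_add by (simp add: mult.commute)

lemma elliptic_potential_complex:
  "of_real (elliptic_potential t z) = z * cnj z - of_real t / 2 * (z\<^sup>2 + (cnj z)\<^sup>2)"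
  
proof -
  have "elliptic_potential t z = Re z * Re z + Im z * Im z - t / 2 * (2 * (Re z * Re z - Im z * Im z))"
    by (simp add: elliptic_potential_eq power2_eq_square algebra_simps)
  then show ?thesis by (simp add: complex_eq_iff power2_eq_square)
qed

context
  fixes t \<psi> :: real and z0 :: complex
  assumes t: "0 < t" "t < 1"
begin

lemma one_minus_t2_pos: "1 - t\<^sup>2 > 0"
  using t by (simp add: abs_square_less_1)

lemma mehler_exponent_1: "of_real (real n * (1 - t\<^sup>2)) * mehler_exponent t 1 x y
   = of_nat n * (x * y - of_real t / 2 * (x\<^sup>2 + y\<^sup>2))"
proof -
  have "complex_of_real (1 - t\<^sup>2) \<noteq> 0" using one_minus_t2_pos by (simp only: of_real_eq_0_iff)
  then show ?thesis
    by (simp add: mehler_exponent_def)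
qed

text \<open>All exponents are quadratic in the points, so the contributions of \<open>z0\<close>
  cancel identically: the equality is exact for every positive \<open>n\<close>, not merely
  asymptotic.\<close>

lemma full_exponent:
  fixes n :: nat and a b :: complex
  assumes "n > 0"
  defines "w \<equiv> scaled_point z0 \<psi> a n" and "z \<equiv> scaled_point z0 \<psi> b n"
  shows "of_real (exp (- (real n / 2) * (elliptic_potential t w + elliptic_potential t z)))
      * exp (of_real (real n * (1 - t\<^sup>2)) * mehler_exponent t 1 (cnj w) z)
      * cis (gauge_phase t z0 \<psi> b n - gauge_phase t z0 \<psi> a n) = coherent a b"
proof -
  define h where "h = complex_of_real (sqrt (real n))"
  have h: "h \<noteq> 0" "h * h = of_nat n" "cnj h = h" using assms(1) by (simp_all add: h_def flip: of_real_mult)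
  define \<alpha> where "\<alpha> = a * cis \<psi>"
  define \<beta> where "\<beta> = b * cis \<psi>"
  have w: "h * w = h * z0 + \<alpha>" "h * cnj w = h * cnj z0 + cnj \<alpha>"
    and z: "h * z = h * z0 + \<beta>" "h * cnj z = h * cnj z0 + cnj \<beta>"
    using h(1) by (simp_all add: w_def z_def scaled_point_def \<alpha>_def \<beta>_def h_def field_simps)
  have ab: "cnj a * b = cnj \<alpha> * \<beta>" "of_real ((cmod a)\<^sup>2) = \<alpha> * cnj \<alpha>" "of_real ((cmod b)\<^sup>2) = \<beta> * cnj \<beta>"
  proof -
    have e: "cis \<psi> * cnj (cis \<psi>) = 1" by (simp add: complex_norm_square[symmetric])
    have "cnj a * b = cnj a * b * (cis \<psi> * cnj (cis \<psi>))" unfolding e by simp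
    then show "cnj a * b = cnj \<alpha> * \<beta>" by (simp add: \<alpha>_def \<beta>_def mult_ac)
    show "of_real ((cmod a)\<^sup>2) = \<alpha> * cnj \<alpha>" "of_real ((cmod b)\<^sup>2) = \<beta> * cnj \<beta>"
      unfolding complex_norm_square[symmetric] by (simp_all add: \<alpha>_def \<beta>_def norm_mult)
  qed
  have Im: "\<i> * of_real (Im x) = (x - cnj x) / 2" for x by (simp add: complex_eq_iff)
  have g: "\<i> * of_real (gauge_phase t z0 \<psi> a n) = h * (cnj \<alpha> * (z0 - of_real t * cnj z0) - \<alpha> * (cnj z0 - of_real t * z0)) / 2
      + of_real t / 4 * (\<alpha>\<^sup>2 - (cnj \<alpha>)\<^sup>2)" if "\<alpha> = a * cis \<psi>" for a \<alpha>
  proof -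
    have "\<i> * of_real (gauge_phase t z0 \<psi> a n)
      = h * (\<i> * of_real (Im (cnj \<alpha> * (z0 - of_real t * cnj z0)))) + of_real t / 2 * (\<i> * of_real (Im (\<alpha>\<^sup>2)))"
      unfolding gauge_phase_def that[symmetric] h_def by (simp add: algebra_simps)
    then show ?thesis unfolding Im by (simp add: field_simps)
  qed
  have "of_real (- (real n / 2) * (elliptic_potential t w + elliptic_potential t z))
      + of_real (real n * (1 - t\<^sup>2)) * mehler_exponent t 1 (cnj w) z
      + \<i> * of_real (gauge_phase t z0 \<psi> b n - gauge_phase t z0 \<psi> a n)
      = cnj a * b - of_real ((cmod a)\<^sup>2 + (cmod b)\<^sup>2) / 2"
  proof -
    have "of_real (- (real n / 2) * (elliptic_potential t w + elliptic_potential t z))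
      + of_real (real n * (1 - t\<^sup>2)) * mehler_exponent t 1 (cnj w) z
      = - (h * h / 2) * (w * cnj w - of_real t / 2 * (w\<^sup>2 + (cnj w)\<^sup>2) + (z * cnj z - of_real t / 2 * (z\<^sup>2 + (cnj z)\<^sup>2)))
       + h * h * (cnj w * z - of_real t / 2 * ((cnj w)\<^sup>2 + z\<^sup>2))"
      unfolding mehler_exponent_1
      unfolding of_real_mult of_real_add elliptic_potential_complex h(2) by simp
    also have "\<dots> = - ((h * w) * (h * cnj w) + (h * z) * (h * cnj z)) / 2 + (h * cnj w) * (h * z)
        + of_real t / 4 * ((h * w)\<^sup>2 - (h * cnj w)\<^sup>2 - (h * z)\<^sup>2 + (h * cnj z)\<^sup>2)"
      by (simp add: power2_eq_square field_simps)
    finally have main: "of_real (- (real n / 2) * (elliptic_potential t w + elliptic_potential t z))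
      + of_real (real n * (1 - t\<^sup>2)) * mehler_exponent t 1 (cnj w) z
      = - ((h * w) * (h * cnj w) + (h * z) * (h * cnj z)) / 2 + (h * cnj w) * (h * z)
        + of_real t / 4 * ((h * w)\<^sup>2 - (h * cnj w)\<^sup>2 - (h * z)\<^sup>2 + (h * cnj z)\<^sup>2)" .
    show ?thesis
      unfolding main
      unfolding w z of_real_diff right_diff_distrib[of \<i>] g[OF \<alpha>_def] g[OF \<beta>_def] of_real_add ab
      by (simp add: power2_eq_square field_simps)
  qed
  then show ?thesis
    unfolding coherent_def cis_conv_exp exp_of_real[symmetric] mult_exp_exp by (simp only:)
qed

lemma amplitude_product:
  fixes n :: nat and a b :: complex
  assumes n: "n > 0"
  defines "c \<equiv> real n * (1 - t\<^sup>2)" and "w \<equiv> scaled_point z0 \<psi> a n" and "z \<equiv> scaled_point z0 \<psi> b n"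
  shows "cnj (level_amplitude t z0 \<psi> a n k) * level_amplitude t z0 \<psi> b n k * r ^ k
    = cis (gauge_phase t z0 \<psi> b n - gauge_phase t z0 \<psi> a n)
      * of_real (sqrt (1 - t\<^sup>2) * exp (- (real n / 2) * (elliptic_potential t w + elliptic_potential t z)))
      * mehler_term c t r (cnj w) z k"
proof -
  have c: "c > 0" using n one_minus_t2_pos by (simp add: c_def)
  define s where "s = sqrt (fact k * c ^ k)"
  have s: "s \<noteq> 0" "fact k * c ^ k = s * s" using c by (simp_all add: s_def)
  define q where "q = sqrt (sqrt (1 - t\<^sup>2))"
  have q: "sqrt (1 - t\<^sup>2) = q * q" using one_minus_t2_pos by (simp add: q_def)
  have e: "exp (- (real n / 2) * (elliptic_potential t w + elliptic_potential t z))
     = exp (- (real n / 2) * elliptic_potential t w) * exp (- (real n / 2) * elliptic_potential t z)"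
    by (simp add: mult_exp_exp algebra_simps)
  have g: "cis (gauge_phase t z0 \<psi> b n - gauge_phase t z0 \<psi> a n)
      = cnj (cis (gauge_phase t z0 \<psi> a n)) * cis (gauge_phase t z0 \<psi> b n)"
    by (simp add: cis_cnj cis_mult)
  show ?thesis
    unfolding level_amplitude_def Let_def c_def[symmetric] w_def[symmetric] z_def[symmetric] s_def[symmetric]
      q_def[symmetric]
    unfolding mehler_term_def s(2) q e g complex_cnj_mult cnj_poly_herm complex_cnj_complex_of_real
    using s(1) by (simp add: field_simps)
qed

lemma kernel_amplitudes:
  fixes n :: nat
  assumes n: "n > 0"
  shows "reproducing_kernel (elliptic_potential t) n (scaled_point z0 \<psi> a n) (scaled_point z0 \<psi> b n) / of_nat n
    = of_real (1 / pi) * cis (gauge_phase t z0 \<psi> a n - gauge_phase t z0 \<psi> b n)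
      * (\<Sum>k<n. cnj (level_amplitude t z0 \<psi> a n k) * level_amplitude t z0 \<psi> b n k)"
proof -
  define c where "c = real n * (1 - t\<^sup>2)"
  define w where "w = scaled_point z0 \<psi> a n"
  define z where "z = scaled_point z0 \<psi> b n"
  define X where "X = exp (- (real n / 2) * (elliptic_potential t w + elliptic_potential t z))"
  define g where "g = gauge_phase t z0 \<psi> a n - gauge_phase t z0 \<psi> b n"
  have "cnj (level_amplitude t z0 \<psi> a n k) * level_amplitude t z0 \<psi> b n k
    = cis (- g) * of_real (sqrt (1 - t\<^sup>2) * X) * mehler_term c t 1 (cnj w) z k" for k
    using amplitude_product[OF n, of a k b 1] by (simp add: X_def g_def c_def w_def z_def)
  then have "(\<Sum>k<n. cnj (level_amplitude t z0 \<psi> a n k) * level_amplitude t z0 \<psi> b n k)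
    = cis (- g) * (of_real (sqrt (1 - t\<^sup>2) * X) * (\<Sum>k<n. mehler_term c t 1 (cnj w) z k))"
    by (simp only: sum_distrib_left[symmetric] mult.assoc)
  moreover have "cis g * (cis (- g) * Q) = Q" for Q
    by (simp add: mult.assoc[symmetric] cis_mult)
  moreover have "reproducing_kernel (elliptic_potential t) n w z / of_nat n
    = of_real (sqrt (1 - t\<^sup>2) / pi * X) * (\<Sum>k<n. mehler_term c t 1 (cnj w) z k)"
    unfolding reproducing_kernel_elliptic[OF t n] X_def c_def mehler_term_def by simp
  ultimately show ?thesis
    unfolding w_def[symmetric] z_def[symmetric] g_def[symmetric] by (simp add: mult.assoc)
qed

text \<open>Mehler's exponential is divided by its value at \<open>r = 1\<close>, which
  \<open>full_exponent\<close> turns into \<open>coherent a b\<close>. The two remaining factors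
  equal 1 at \<open>r = 1\<close> and carry the whole dependence on \<open>r\<close>.\<close>

lemma amplitude_generating_function:
  fixes n :: nat and a b :: complex
  assumes n: "n > 0" and r: "cmod r * t < 1"
  defines "w \<equiv> scaled_point z0 \<psi> a n" and "z \<equiv> scaled_point z0 \<psi> b n"
  shows "(\<lambda>k. cnj (level_amplitude t z0 \<psi> a n k) * level_amplitude t z0 \<psi> b n k * r ^ k) sums
    (coherent a b * (of_real (sqrt (1 - t\<^sup>2)) * (1 - r\<^sup>2 * of_real (t\<^sup>2)) powr (- 1 / 2))
      * exp (of_real (real n * (1 - t\<^sup>2)) * (mehler_exponent t r (cnj w) z - mehler_exponent t 1 (cnj w) z)))"
proof -
  define c where "c = real n * (1 - t\<^sup>2)"
  have c: "c > 0" using n one_minus_t2_pos by (simp add: c_def)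
  define X where "X = complex_of_real (exp (- (real n / 2) * (elliptic_potential t w + elliptic_potential t z)))"
  define g where "g = cis (gauge_phase t z0 \<psi> b n - gauge_phase t z0 \<psi> a n)"
  define q where "q = complex_of_real (sqrt (1 - t\<^sup>2))"
  define p where "p = (1 - r\<^sup>2 * of_real (t\<^sup>2)) powr (- 1 / 2)"
  have "(\<lambda>k. g * of_real (sqrt (1 - t\<^sup>2) * exp (- (real n / 2) * (elliptic_potential t w + elliptic_potential t z)))
      * mehler_term c t r (cnj w) z k) sums (g * (q * X) *
      (p * exp (of_real c * mehler_exponent t r (cnj w) z)))"
    unfolding q_def X_def p_def of_real_mult[symmetric] mehler_exponent_def times_divide_eq_right
    by (intro sums_mult mehler_formula[OF c t(1) r])
  moreover have "g * (q * X) * (p * exp (of_real c * mehler_exponent t r (cnj w) z))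
    = coherent a b * (q * p) * exp (of_real c * (mehler_exponent t r (cnj w) z - mehler_exponent t 1 (cnj w) z))"
  proof -
    have 1: "coherent a b = X * exp (of_real c * mehler_exponent t 1 (cnj w) z) * g"
      using full_exponent[OF n, of a b] by (simp only: X_def c_def w_def z_def g_def)
    have 2: "exp (of_real c * mehler_exponent t r (cnj w) z) = exp (of_real c * mehler_exponent t 1 (cnj w) z)
        * exp (of_real c * (mehler_exponent t r (cnj w) z - mehler_exponent t 1 (cnj w) z))"
      by (simp add: mult_exp_exp algebra_simps)
    show ?thesis unfolding 1 2 by (simp only: mult_ac)
  qed
  ultimately show ?thesis
    unfolding amplitude_product[OF n] w_def[symmetric] z_def[symmetric] c_def[symmetric] g_def[symmetric]
      q_def[symmetric] p_def[symmetric] by (simp only:)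
qed

lemma normalisation: "of_real (sqrt (1 - t\<^sup>2)) * (1 - of_real (t\<^sup>2)) powr (- 1 / 2) = (1 :: complex)"
proof -
  have "(1 - of_real (t\<^sup>2)) powr (- 1 / 2 :: complex) = of_real ((1 - t\<^sup>2) powr (- 1 / 2))"
    using powr_of_real[of "1 - t\<^sup>2" "- 1 / 2"] one_minus_t2_pos by simp
  also have "(1 - t\<^sup>2) powr (- 1 / 2) = inverse (sqrt (1 - t\<^sup>2))"
    using powr_minus[of "1 - t\<^sup>2" "1 / 2"] powr_half_sqrt[OF less_imp_le[OF one_minus_t2_pos]]
    by (simp only: minus_divide_left)
  finally have "of_real (sqrt (1 - t\<^sup>2)) * (1 - of_real (t\<^sup>2)) powr (- 1 / 2)
      = complex_of_real (sqrt (1 - t\<^sup>2) * inverse (sqrt (1 - t\<^sup>2)))"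
    by (simp only: of_real_mult)
  also have "sqrt (1 - t\<^sup>2) * inverse (sqrt (1 - t\<^sup>2)) = 1"
    using one_minus_t2_pos by (intro right_inverse) simp
  finally show ?thesis by simp
qed

lemma amplitude_full_sum:
  assumes n: "n > 0"
  shows "(\<lambda>k. cnj (level_amplitude t z0 \<psi> a n k) * level_amplitude t z0 \<psi> b n k) sums coherent a b"
  using amplitude_generating_function[OF n, of 1 a b] t normalisation by simp

lemma summable_amplitude:
  assumes n: "n > 0"
  shows "summable (\<lambda>k. (cmod (level_amplitude t z0 \<psi> a n k))\<^sup>2)"
proof -
  have "(\<lambda>k. complex_of_real ((cmod (level_amplitude t z0 \<psi> a n k))\<^sup>2)) sums 1"
    using amplitude_full_sum[OF n, of a a] unfolding complex_norm_square coherent_diag by (simp add: mult.commute)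
  then have "(\<lambda>k. (cmod (level_amplitude t z0 \<psi> a n k))\<^sup>2) sums 1"
    unfolding sums_of_real_iff[of _ 1, simplified] .
  then show ?thesis by (rule sums_summable)
qed

end

section \<open>Away from the ellipse\<close>

lemma ellipse_form_eq:
  assumes "0 < t" "t < 1"
  shows "ellipse_form t z = (1 - t\<^sup>2) * ((Re z)\<^sup>2 / (1 + t)\<^sup>2 + (Im z)\<^sup>2 / (1 - t)\<^sup>2)"
proof -
  have "(semi_a t)\<^sup>2 = (1 + t) / (1 - t)" "(semi_b t)\<^sup>2 = (1 - t) / (1 + t)"
    using assms by (simp_all add: semi_a_def semi_b_def)
  moreover have "1 - t\<^sup>2 = (1 + t) * (1 - t)" by (simp add: power2_eq_square algebra_simps)
  moreover have "x / (p / q) + y / (q / p) = p * q * (x / p\<^sup>2 + y / q\<^sup>2)" if "p \<noteq> 0" "q \<noteq> 0" for x y p q :: real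
    using that by (simp add: field_simps power2_eq_square)
  ultimately show ?thesis
    using assms by (simp add: ellipse_form_def)
qed

text \<open>The exponent per unit of \<open>n\<close> in the generating function of the squared
  amplitudes at a real argument \<open>r\<close>, as \<open>chernoff_generating_function\<close>
  shows.\<close>

definition rate :: "real \<Rightarrow> real \<Rightarrow> complex \<Rightarrow> real" where
  "rate t r z = (1 - t\<^sup>2) * (r - 1) *
     ((Re z)\<^sup>2 / ((1 + r * t) * (1 + t)) + (Im z)\<^sup>2 / ((1 - r * t) * (1 - t)))"

text \<open>The function differentiated is the Chernoff exponent for the threshold
  \<open>k = n\<close>, and it vanishes at \<open>r = 1\<close>. The sign of its slope there decides
  on which side of 1 a tilt with negative exponent exists; this is where inside and outside of the
  ellipse part ways.\<close>

lemma rate_derivative: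
  assumes t: "0 < t" "t < 1"
  shows "((\<lambda>r. rate t r z - ln r) has_real_derivative (ellipse_form t z - 1)) (at 1)"
proof -
  define g where "g r = (Re z)\<^sup>2 / ((1 + r * t) * (1 + t)) + (Im z)\<^sup>2 / ((1 - r * t) * (1 - t))" for r
  have "\<exists>D. (g has_real_derivative D) (at 1)"
    unfolding g_def using t by (intro exI) (auto intro!: derivative_eq_intros)
  then obtain D where D: "(g has_real_derivative D) (at 1)" by blast
  have "((\<lambda>r. (1 - t\<^sup>2) * (r - 1) * g r - ln r) has_real_derivative
      ((1 - t\<^sup>2) * (1 - 0) * g 1 + D * ((1 - t\<^sup>2) * (1 - 1)) - 1 / 1)) (at 1)"
    by (auto intro!: derivative_eq_intros D)
  also have "(1 - t\<^sup>2) * (1 - 0) * g 1 + D * ((1 - t\<^sup>2) * (1 - 1)) - 1 / 1 = ellipse_form t z - 1"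
    by (simp add: g_def ellipse_form_eq[OF t] power2_eq_square)
  finally show ?thesis by (simp add: rate_def g_def)
qed

context
  fixes t \<psi> :: real and z0 :: complex
  assumes t: "0 < t" "t < 1"
begin

lemma scaled_point_tendsto: "(\<lambda>n. scaled_point z0 \<psi> a n) \<longlonglongrightarrow> z0"
proof -
  have "(\<lambda>n. 1 / sqrt (real n)) \<longlonglongrightarrow> 0" by real_asymp
  then have "(\<lambda>n. z0 + a * cis \<psi> * of_real (1 / sqrt (real n))) \<longlonglongrightarrow> z0 + a * cis \<psi> * of_real 0"
    by (intro tendsto_intros)
  then show ?thesis by (simp add: scaled_point_def)
qed

lemma chernoff_generating_function:
  fixes r :: real
  assumes n: "n > 0" and r: "0 < r" "r * t < 1"
  shows "(\<lambda>k. (cmod (level_amplitude t z0 \<psi> a n k))\<^sup>2 * r ^ k) sums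
    (cmod (of_real (sqrt (1 - t\<^sup>2)) * (1 - (of_real r)\<^sup>2 * of_real (t\<^sup>2)) powr (- 1 / 2))
      * exp (real n * rate t r (scaled_point z0 \<psi> a n)))"
proof -
  define w where "w = scaled_point z0 \<psi> a n"
  define p where "p = of_real (sqrt (1 - t\<^sup>2)) * (1 - (complex_of_real r)\<^sup>2 * of_real (t\<^sup>2)) powr (- 1 / 2)"
  have rt: "cmod (complex_of_real r) * t < 1" using r by simp
  have "of_real (real n * (1 - t\<^sup>2)) * (mehler_exponent t (of_real r) (cnj w) w - mehler_exponent t 1 (cnj w) w)
     = complex_of_real (real n * rate t r w)"
  proof -
    have "cnj w + w = of_real (2 * Re w)" "cnj w - w = - 2 * \<i> * of_real (Im w)"
      by (simp_all add: complex_eq_iff)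
    then have "(cnj w + w)\<^sup>2 = of_real (4 * (Re w)\<^sup>2)" "(cnj w - w)\<^sup>2 = of_real (- 4 * (Im w)\<^sup>2)"
      by (simp_all add: power_mult_distrib)
    moreover have "a / 4 * (4 * x / b - - 4 * y / d) = a * (x / b + y / d)" for a x y b d :: complex
      by (simp add: algebra_simps)
    ultimately show ?thesis
      unfolding mehler_exponent_diff[OF t rt] rate_def by (simp add: mult.commute)
  qed
  then have g: "(\<lambda>k. cnj (level_amplitude t z0 \<psi> a n k) * level_amplitude t z0 \<psi> a n k * of_real r ^ k) sums
      (p * of_real (exp (real n * rate t r w)))"
    using amplitude_generating_function[OF t n rt, of z0 \<psi> a a]
    unfolding w_def[symmetric] p_def[symmetric] by (simp only: coherent_diag mult_1 exp_of_real)
  have "(\<lambda>k. complex_of_real ((cmod (level_amplitude t z0 \<psi> a n k))\<^sup>2 * r ^ k)) sums (p * of_real (exp (real n * rate t r w)))"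
  proof -
    have "complex_of_real ((cmod X)\<^sup>2 * r ^ k) = cnj X * X * of_real r ^ k" for X k
      unfolding of_real_mult complex_norm_square by (simp add: mult.commute)
    note * = this
    show ?thesis unfolding * by (rule g)
  qed
  \<comment> \<open>The series has real nonnegative terms, so its sum equals its own modulus. This
    determines the sum without evaluating the complex power in \<open>p\<close>.\<close>
  then have s: "(\<lambda>k. (cmod (level_amplitude t z0 \<psi> a n k))\<^sup>2 * r ^ k) sums Re (p * of_real (exp (real n * rate t r w)))"
    and i: "(\<lambda>k. 0::real) sums Im (p * of_real (exp (real n * rate t r w)))"
    using sums_Re sums_Im by fastforce+
  have "Re (p * of_real (exp (real n * rate t r w))) \<ge> 0"
    by (rule sums_le[OF _ sums_zero s]) (use r in simp)
  moreover have "Im (p * of_real (exp (real n * rate t r w))) = 0"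
    using i sums_unique by fastforce
  ultimately have "Re (p * of_real (exp (real n * rate t r w))) = cmod (p * of_real (exp (real n * rate t r w)))"
    by (simp add: cmod_eq_Re)
  with s show ?thesis
    by (simp add: norm_mult p_def w_def)
qed

lemma chernoff_decay:
  fixes r :: real
  assumes r: "0 < r" "r * t < 1" and neg: "rate t r z0 < ln r"
  shows "(\<lambda>n. (\<Sum>k. (cmod (level_amplitude t z0 \<psi> a n k))\<^sup>2 * r ^ k) / r ^ n) \<longlonglongrightarrow> 0"
proof -
  define C where "C = cmod (of_real (sqrt (1 - t\<^sup>2)) * (1 - (of_real r)\<^sup>2 * of_real (t\<^sup>2)) powr (- 1 / 2))"
  \<comment> \<open>Half of the gap at \<open>z0\<close>: the moving point may consume the first
    half, and the second remains as the rate of exponential decay.\<close>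
  define \<epsilon> where "\<epsilon> = (ln r - rate t r z0) / 2"
  have \<epsilon>: "\<epsilon> > 0" using neg by (simp add: \<epsilon>_def)
  have "(\<lambda>n. rate t r (scaled_point z0 \<psi> a n)) \<longlonglongrightarrow> rate t r z0"
  proof -
    have "1 + r * t > 0" "1 - r * t > 0" using t r by (simp_all add: add_pos_pos)
    then show ?thesis
      unfolding rate_def using t by (intro tendsto_intros scaled_point_tendsto) auto
  qed
  then have "\<forall>\<^sub>F n in sequentially. rate t r (scaled_point z0 \<psi> a n) < ln r - \<epsilon>"
    by (rule order_tendstoD) (use \<epsilon> in \<open>simp add: \<epsilon>_def field_simps\<close>)
  then have "\<forall>\<^sub>F n in sequentially. norm ((\<Sum>k. (cmod (level_amplitude t z0 \<psi> a n k))\<^sup>2 * r ^ k) / r ^ n) \<le> C * exp (- \<epsilon> * real n)"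
    using eventually_gt_at_top[of 0]
  proof eventually_elim
    case (elim n)
    have "(\<Sum>k. (cmod (level_amplitude t z0 \<psi> a n k))\<^sup>2 * r ^ k) = C * exp (real n * rate t r (scaled_point z0 \<psi> a n))"
      using chernoff_generating_function[OF elim(2) r, of a] unfolding C_def by (rule sums_unique[symmetric])
    moreover have "r ^ n = exp (real n * ln r)"
      using r(1) by (simp add: exp_of_nat_mult)
    ultimately have "norm ((\<Sum>k. (cmod (level_amplitude t z0 \<psi> a n k))\<^sup>2 * r ^ k) / r ^ n)
      = C * exp (real n * (rate t r (scaled_point z0 \<psi> a n) - ln r))"
      by (simp add: C_def exp_diff right_diff_distrib)
    also have "\<dots> \<le> C * exp (real n * (- \<epsilon>))"
    proof -
      have "real n * (rate t r (scaled_point z0 \<psi> a n) - ln r) \<le> real n * (- \<epsilon>)"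
        using elim by (intro mult_left_mono) auto
      then show ?thesis by (simp add: C_def mult_left_mono)
    qed
    finally show ?case by (simp add: mult.commute)
  qed
  moreover have "(\<lambda>n. C * exp (- \<epsilon> * real n)) \<longlonglongrightarrow> 0"
    using \<epsilon> by real_asymp
  ultimately show ?thesis by (rule Lim_null_comparison)
qed

lemma outside_head:
  assumes "ellipse_form t z0 > 1"
  shows "(\<lambda>n. \<Sum>k<n. (cmod (level_amplitude t z0 \<psi> a n k))\<^sup>2) \<longlonglongrightarrow> 0"
proof -
  have "ellipse_form t z0 - 1 > 0" using assms by simp
  from DERIV_pos_inc_left[OF rate_derivative[OF t] this]
  obtain d where d: "d > 0" "\<And>h. 0 < h \<Longrightarrow> h < d \<Longrightarrow> rate t (1 - h) z0 - ln (1 - h) < rate t 1 z0 - ln 1"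
    by blast
  \<comment> \<open>A tilt below 1 controls the head, since \<open>r ^ n \<le> r ^ k\<close> for
    \<open>k < n\<close>. The bound by \<open>d / 2\<close> keeps the Chernoff exponent negative,
    the bound by \<open>1 / 2\<close> keeps \<open>r\<close> positive.\<close>
  define h where "h = min (d / 2) (1 / 2)"
  define r where "r = 1 - h"
  have h: "0 < h" "h < d" "h < 1" using d(1) by (auto simp: h_def)
  have r: "0 < r" "r < 1" "r * t < 1"
  proof -
    show "0 < r" "r < 1" using h by (auto simp: r_def)
    then have "r * t < 1 * 1" using t by (intro mult_strict_mono) auto
    then show "r * t < 1" by simp
  qed
  have neg: "rate t r z0 < ln r" using d(2)[OF h(1,2)] by (simp add: r_def rate_def)
  show ?thesis
  proof (rule tendsto_sandwich[OF _ _ tendsto_const chernoff_decay[OF r(1,3) neg]])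
    show "\<forall>\<^sub>F n in sequentially. 0 \<le> (\<Sum>k<n. (cmod (level_amplitude t z0 \<psi> a n k))\<^sup>2)"
      by (intro always_eventually allI sum_nonneg) simp
    show "\<forall>\<^sub>F n in sequentially. (\<Sum>k<n. (cmod (level_amplitude t z0 \<psi> a n k))\<^sup>2)
        \<le> (\<Sum>k. (cmod (level_amplitude t z0 \<psi> a n k))\<^sup>2 * r ^ k) / r ^ n"
      using eventually_gt_at_top[of 0]
    proof eventually_elim
      case (elim n)
      have "(\<Sum>k<n. (cmod (level_amplitude t z0 \<psi> a n k))\<^sup>2) * r ^ n
          \<le> (\<Sum>k<n. (cmod (level_amplitude t z0 \<psi> a n k))\<^sup>2 * r ^ k)"
        unfolding sum_distrib_right using r by (intro sum_mono mult_left_mono power_decreasing) auto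
      also have "\<dots> \<le> (\<Sum>k. (cmod (level_amplitude t z0 \<psi> a n k))\<^sup>2 * r ^ k)"
        using r sums_summable[OF chernoff_generating_function[OF elim r(1,3)]] by (intro sum_le_suminf) auto
      finally show ?case using r by (simp add: le_divide_eq)
    qed
  qed
qed

lemma inside_tail:
  assumes "ellipse_form t z0 < 1"
  shows "(\<lambda>n. \<Sum>k. if k < n then 0 else (cmod (level_amplitude t z0 \<psi> a n k))\<^sup>2) \<longlonglongrightarrow> 0"
proof -
  have "ellipse_form t z0 - 1 < 0" using assms by simp
  from DERIV_neg_dec_right[OF rate_derivative[OF t] this]
  obtain d where d: "d > 0" "\<And>h. 0 < h \<Longrightarrow> h < d \<Longrightarrow> rate t (1 + h) z0 - ln (1 + h) < rate t 1 z0 - ln 1"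
    by blast
  \<comment> \<open>For the tail the tilt must exceed 1, so that \<open>r ^ n \<le> r ^ k\<close>
    for \<open>k \<ge> n\<close>. The bound \<open>(1 - t) / 2\<close> ensures
    \<open>r * t < 1\<close>, where the generating function converges.\<close>
  define h where "h = min (d / 2) ((1 - t) / 2)"
  define r where "r = 1 + h"
  have h: "0 < h" "h < d" "h < 1 - t" using d(1) t by (auto simp: h_def min_less_iff_disj)
  have r: "0 < r" "r > 1" "r * t < 1"
  proof -
    show "0 < r" "r > 1" using h by (auto simp: r_def)
    have "r * t < (1 + (1 - t)) * t" using h t by (auto simp: r_def)
    also have "\<dots> = 1 - (1 - t)\<^sup>2" by (simp add: power2_eq_square algebra_simps)
    also have "\<dots> < 1" using t by simp
    finally show "r * t < 1" .
  qed
  have neg: "rate t r z0 < ln r" using d(2)[OF h(1,2)] by (simp add: r_def rate_def)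
  show ?thesis
  proof (rule tendsto_sandwich[OF _ _ tendsto_const chernoff_decay[OF r(1,3) neg]])
    have S: "summable (\<lambda>k. if k < n then 0 else (cmod (level_amplitude t z0 \<psi> a n k))\<^sup>2)" if "n > 0" for n
      by (rule summable_comparison_test'[OF summable_amplitude[OF t that, of z0 \<psi> a]]) simp
    show "\<forall>\<^sub>F n in sequentially. 0 \<le> (\<Sum>k. if k < n then 0 else (cmod (level_amplitude t z0 \<psi> a n k))\<^sup>2)"
      using eventually_gt_at_top[of 0]
    proof eventually_elim
      case (elim n)
      then show ?case by (intro suminf_nonneg S) simp_all
    qed
    show "\<forall>\<^sub>F n in sequentially. (\<Sum>k. if k < n then 0 else (cmod (level_amplitude t z0 \<psi> a n k))\<^sup>2)
        \<le> (\<Sum>k. (cmod (level_amplitude t z0 \<psi> a n k))\<^sup>2 * r ^ k) / r ^ n"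
      using eventually_gt_at_top[of 0]
    proof eventually_elim
      case (elim n)
      have "(\<Sum>k. if k < n then 0 else (cmod (level_amplitude t z0 \<psi> a n k))\<^sup>2)
        \<le> (\<Sum>k. (cmod (level_amplitude t z0 \<psi> a n k))\<^sup>2 * r ^ k / r ^ n)"
      proof (rule suminf_le[OF _ S[OF elim]])
        show "summable (\<lambda>k. (cmod (level_amplitude t z0 \<psi> a n k))\<^sup>2 * r ^ k / r ^ n)"
          by (intro summable_divide sums_summable[OF chernoff_generating_function[OF elim r(1,3)]])
        show "(if k < n then 0 else (cmod (level_amplitude t z0 \<psi> a n k))\<^sup>2)
          \<le> (cmod (level_amplitude t z0 \<psi> a n k))\<^sup>2 * r ^ k / r ^ n" for k
        proof (cases "k < n")
          case False
          then have "r ^ n \<le> r ^ k" using r by (intro power_increasing) auto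
          then show ?thesis using False r by (simp add: le_divide_eq mult_left_mono)
        qed (use r in simp)
      qed
      also have "\<dots> = (\<Sum>k. (cmod (level_amplitude t z0 \<psi> a n k))\<^sup>2 * r ^ k) / r ^ n"
        by (intro suminf_divide sums_summable[OF chernoff_generating_function[OF elim r(1,3)]])
      finally show ?case .
    qed
  qed
qed

lemma outside_limit:
  assumes "ellipse_form t z0 > 1"
  shows "(\<lambda>n. \<Sum>k<n. cnj (level_amplitude t z0 \<psi> a n k) * level_amplitude t z0 \<psi> b n k) \<longlonglongrightarrow> 0"
proof (rule Lim_null_comparison[OF always_eventually])
  show "(\<lambda>n. (\<Sum>k<n. (cmod (level_amplitude t z0 \<psi> a n k))\<^sup>2) + (\<Sum>k<n. (cmod (level_amplitude t z0 \<psi> b n k))\<^sup>2)) \<longlonglongrightarrow> 0"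
    using tendsto_add[OF outside_head[OF assms, of a] outside_head[OF assms, of b]] by simp
  show "\<forall>n. cmod (\<Sum>k<n. cnj (level_amplitude t z0 \<psi> a n k) * level_amplitude t z0 \<psi> b n k)
    \<le> (\<Sum>k<n. (cmod (level_amplitude t z0 \<psi> a n k))\<^sup>2) + (\<Sum>k<n. (cmod (level_amplitude t z0 \<psi> b n k))\<^sup>2)"
    unfolding sum.distrib[symmetric] by (intro allI order.trans[OF norm_sum] sum_mono cnj_mult_norm_le)
qed

text \<open>The full series over \<open>k\<close> equals \<open>coherent a b\<close> for every
  positive \<open>n\<close>, so only the part \<open>k \<ge> n\<close> has to be small, and that is
  dominated by the two diagonal tails.\<close>

lemma inside_limit:
  assumes "ellipse_form t z0 < 1"
  shows "(\<lambda>n. \<Sum>k<n. cnj (level_amplitude t z0 \<psi> a n k) * level_amplitude t z0 \<psi> b n k) \<longlonglongrightarrow> coherent a b"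
proof -
  let ?p = "\<lambda>n k. cnj (level_amplitude t z0 \<psi> a n k) * level_amplitude t z0 \<psi> b n k"
  let ?T = "\<lambda>a n. \<Sum>k. if k < n then 0 else (cmod (level_amplitude t z0 \<psi> a n k))\<^sup>2"
  have "(\<lambda>n. coherent a b - (\<Sum>k<n. ?p n k)) \<longlonglongrightarrow> 0"
  proof (rule Lim_null_comparison)
    show "(\<lambda>n. ?T a n + ?T b n) \<longlonglongrightarrow> 0"
      using tendsto_add[OF inside_tail[OF assms, of a] inside_tail[OF assms, of b]] by simp
    show "\<forall>\<^sub>F n in sequentially. cmod (coherent a b - (\<Sum>k<n. ?p n k)) \<le> ?T a n + ?T b n"
      using eventually_gt_at_top[of 0]
    proof eventually_elim
      case (elim n)
      have S: "summable (\<lambda>k. if k < n then 0 else (cmod (level_amplitude t z0 \<psi> a n k))\<^sup>2)" for a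
        by (rule summable_comparison_test'[OF summable_amplitude[OF t elim, of z0 \<psi> a]]) simp
      have "(\<lambda>k. if k \<in> {..<n} then ?p n k else 0) sums (\<Sum>k<n. ?p n k)"
        by (rule sums_If_finite_set) simp
      from sums_diff[OF amplitude_full_sum[OF t elim] this]
      have "(\<lambda>k. if k < n then 0 else ?p n k) sums (coherent a b - (\<Sum>k<n. ?p n k))"
        by (rule back_subst[of "\<lambda>f. f sums _"]) auto
      then have "coherent a b - (\<Sum>k<n. ?p n k) = (\<Sum>k. if k < n then 0 else ?p n k)"
        by (rule sums_unique)
      also have "cmod \<dots> \<le> (\<Sum>k. (if k < n then 0 else (cmod (level_amplitude t z0 \<psi> a n k))\<^sup>2)
          + (if k < n then 0 else (cmod (level_amplitude t z0 \<psi> b n k))\<^sup>2))"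
        by (rule norm_suminf_le) (use S cnj_mult_norm_le in \<open>auto intro!: summable_add\<close>)
      also have "\<dots> = ?T a n + ?T b n"
        by (rule suminf_add[symmetric]) (rule S)+
      finally show ?case .
    qed
  qed
  from tendsto_diff[OF tendsto_const[of "coherent a b"] this] show ?thesis by simp
qed

end

section \<open>On the ellipse\<close>

text \<open>The hypothesis \<open>normal\<close> says that \<sigma> and \<psi> are the modulus and
  argument of half the gradient of \<open>ellipse_form\<close> at \<open>z0\<close>. A displacement
  by \<open>a * cis \<psi> / sqrt n\<close> shifts the mean of \<open>k\<close> by about
  \<open>2 * \<sigma> * Re a * sqrt n\<close>; in units of the standard deviation
  \<open>\<sigma> * sqrt n\<close> this is \<open>cnj a + a\<close>, and \<open>cnj a + b\<close> is
  its sesquilinear extension.\<close>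

lemma boundary_limit:
  fixes t \<psi> \<sigma> :: real and z0 a b :: complex
  assumes t: "0 < t" "t < 1" and \<sigma>: "\<sigma> > 0"
    and E: "ellipse_form t z0 = 1"
    and normal: "of_real (1 - t\<^sup>2) * Complex (Re z0 / (1 + t)\<^sup>2) (Im z0 / (1 - t)\<^sup>2) = of_real \<sigma> * cis \<psi>"
  shows "(\<lambda>n. \<Sum>k<n. cnj (level_amplitude t z0 \<psi> a n k) * level_amplitude t z0 \<psi> b n k)
    \<longlonglongrightarrow> coherent a b * (erfc ((cnj a + b) / of_real (sqrt 2)) / 2)"
proof -
  define x y where "x = Re z0" and "y = Im z0"
  have E': "(1 - t\<^sup>2) * (x\<^sup>2 / (1 + t)\<^sup>2 + y\<^sup>2 / (1 - t)\<^sup>2) = 1"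
    using E by (simp add: ellipse_form_eq[OF t] x_def y_def)
  have norm_eq: "\<sigma>\<^sup>2 = (1 - t\<^sup>2)\<^sup>2 * (x\<^sup>2 / (1 + t) ^ 4 + y\<^sup>2 / (1 - t) ^ 4)"
  proof -
    have "\<sigma>\<^sup>2 = (cmod (of_real \<sigma> * cis \<psi>))\<^sup>2" by (simp add: norm_mult)
    also have "\<dots> = (1 - t\<^sup>2)\<^sup>2 * ((x / (1 + t)\<^sup>2)\<^sup>2 + (y / (1 - t)\<^sup>2)\<^sup>2)"
      unfolding normal[symmetric] norm_mult power_mult_distrib by (simp add: cmod_power2 x_def y_def)
    also have "\<dots> = (1 - t\<^sup>2)\<^sup>2 * (x\<^sup>2 / (1 + t) ^ 4 + y\<^sup>2 / (1 - t) ^ 4)"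
      by (simp add: power_divide)
    finally show ?thesis .
  qed
  \<comment> \<open>The variance found by the expansion equals the squared half gradient. The
    squared half gradient is the ellipse form plus the correction on the right, so the value 1 of
    the form is essential here.\<close>
  have S: "\<sigma>\<^sup>2 = 1 + 2 * (1 - t\<^sup>2) * (- t * x\<^sup>2 / (1 + t) ^ 3 + t * y\<^sup>2 / (1 - t) ^ 3)"
  proof -
    define i j where "i = inverse (1 + t)" and "j = inverse (1 - t)"
    have ij: "(1 + t) * i = 1" "(1 - t) * j = 1" using t by (simp_all add: i_def j_def)
    have f: "1 - t\<^sup>2 = (1 + t) * (1 - t)" by (simp add: power2_eq_square algebra_simps)
    have k: "(1 - t\<^sup>2) * i = 1 - t" "(1 - t\<^sup>2) * j = 1 + t"
      using ij unfolding f by (metis mult.assoc mult.commute mult_1)+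
    have d: "u / (1 + t) ^ m = u * i ^ m" "u / (1 - t) ^ m = u * j ^ m" for u m
      by (simp_all add: i_def j_def divide_inverse power_inverse)
    have "\<sigma>\<^sup>2 = ((1 - t\<^sup>2) * i)\<^sup>2 * i\<^sup>2 * x\<^sup>2 + ((1 - t\<^sup>2) * j)\<^sup>2 * j\<^sup>2 * y\<^sup>2"
      unfolding norm_eq d by (simp add: power2_eq_square power4_eq_xxxx algebra_simps)
    also have "\<dots> = (1 - t\<^sup>2) * (x\<^sup>2 * i\<^sup>2 + y\<^sup>2 * j\<^sup>2) + 2 * (((1 - t\<^sup>2) * i) * (- t * x\<^sup>2 * i\<^sup>2) + ((1 - t\<^sup>2) * j) * (t * y\<^sup>2 * j\<^sup>2))"
      unfolding k by (simp add: power2_eq_square algebra_simps)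
    also have "(1 - t\<^sup>2) * (x\<^sup>2 * i\<^sup>2 + y\<^sup>2 * j\<^sup>2) = 1"
      using E' unfolding d .
    also have "1 + 2 * (((1 - t\<^sup>2) * i) * (- t * x\<^sup>2 * i\<^sup>2) + ((1 - t\<^sup>2) * j) * (t * y\<^sup>2 * j\<^sup>2))
      = 1 + 2 * (1 - t\<^sup>2) * (- t * x\<^sup>2 / (1 + t) ^ 3 + t * y\<^sup>2 / (1 - t) ^ 3)"
      unfolding d by (simp add: power2_eq_square power3_eq_cube algebra_simps)
    finally show ?thesis .
  qed
  \<comment> \<open>\<open>Y n\<close> belongs to the kernel with \<open>Suc n\<close> summands,
    which keeps the kernel index positive. Centring at \<open>n\<close> instead of
    \<open>Suc n\<close> makes \<open>k < Suc n\<close> equivalent to \<open>Y n k \<le> 0\<close>,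
    so the cutoff lies exactly at 0.\<close>
  define Y where "Y n k = (real k - real n) / (\<sigma> * sqrt (Suc n))" for n k :: nat
  define \<tau> where "\<tau> s n = s / (\<sigma> * sqrt (real n))" for s n
  have char_limit: "(\<lambda>n. \<Sum>k. cnj (level_amplitude t z0 \<psi> a (Suc n) k) * level_amplitude t z0 \<psi> b (Suc n) k * cis (s * Y n k))
    \<longlonglongrightarrow> coherent a b * exp (\<i> * of_real s * (cnj a + b) - of_real (s\<^sup>2) / 2)" for a b s
  proof -
    define A where "A = cnj (a * cis \<psi>)"
    define B where "B = b * cis \<psi>"
    define D where "D n = of_real (real n * (1 - t\<^sup>2)) *
       (mehler_exponent t (cis (\<tau> s n)) (cnj (scaled_point z0 \<psi> a n)) (scaled_point z0 \<psi> b n)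
        - mehler_exponent t 1 (cnj (scaled_point z0 \<psi> a n)) (scaled_point z0 \<psi> b n))" for n
    have pts: "cnj (scaled_point z0 \<psi> a n) = of_real x - \<i> * of_real y + A / of_real (sqrt (real n))"
      "scaled_point z0 \<psi> b n = of_real x + \<i> * of_real y + B / of_real (sqrt (real n))" for n
      by (simp_all add: scaled_point_def A_def B_def x_def y_def complex_eq_iff)
    have "(\<lambda>n. D n - \<i> * of_real (real n * \<tau> s n)) \<longlonglongrightarrow>
      \<i> * of_real (s / \<sigma> * (1 - t\<^sup>2)) * (of_real (x / (1 + t)\<^sup>2) * (A + B) + \<i> * of_real (y / (1 - t)\<^sup>2) * (A - B))
       - of_real (s\<^sup>2) / 2"
      unfolding D_def pts \<tau>_def by (rule boundary_exponent_limit[OF t \<sigma> E' S])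
    also have "\<i> * of_real (s / \<sigma> * (1 - t\<^sup>2)) * (of_real (x / (1 + t)\<^sup>2) * (A + B) + \<i> * of_real (y / (1 - t)\<^sup>2) * (A - B))
       = \<i> * of_real s * (cnj a + b)"
    proof -
      define N where "N = of_real (1 - t\<^sup>2) * Complex (x / (1 + t)\<^sup>2) (y / (1 - t)\<^sup>2)"
      have N: "N = of_real \<sigma> * cis \<psi>" using normal by (simp add: N_def x_def y_def)
      have cc: "cis \<psi> * cnj (cis \<psi>) = 1" by (simp add: complex_norm_square[symmetric])
      have "of_real (1 - t\<^sup>2) * (of_real (x / (1 + t)\<^sup>2) * (A + B) + \<i> * of_real (y / (1 - t)\<^sup>2) * (A - B))
          = N * A + cnj N * B"
      proof -
        have "of_real k * (of_real p * (A + B) + \<i> * of_real q * (A - B))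
          = (of_real k * Complex p q) * A + cnj (of_real k * Complex p q) * B" for k p q :: real
          by (simp add: Complex_eq algebra_simps)
        then show ?thesis unfolding N_def by (simp only:)
      qed
      also have "\<dots> = of_real \<sigma> * (cnj a * (cis \<psi> * cnj (cis \<psi>)) + b * (cis \<psi> * cnj (cis \<psi>)))"
        unfolding N A_def B_def by (simp add: algebra_simps)
      finally have *: "of_real (1 - t\<^sup>2) * (of_real (x / (1 + t)\<^sup>2) * (A + B) + \<i> * of_real (y / (1 - t)\<^sup>2) * (A - B))
          = of_real \<sigma> * (cnj a + b)"
        unfolding cc by simp
      have "\<i> * of_real (s / \<sigma> * (1 - t\<^sup>2)) * (of_real (x / (1 + t)\<^sup>2) * (A + B) + \<i> * of_real (y / (1 - t)\<^sup>2) * (A - B))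
        = \<i> * of_real (s / \<sigma>) * (of_real (1 - t\<^sup>2) * (of_real (x / (1 + t)\<^sup>2) * (A + B) + \<i> * of_real (y / (1 - t)\<^sup>2) * (A - B)))"
        unfolding of_real_mult by (simp only: mult.assoc)
      also have "\<dots> = \<i> * of_real s * (cnj a + b)"
        unfolding * using \<sigma> by simp
      finally show ?thesis .
    qed
    finally have lim1: "(\<lambda>n. D n - \<i> * of_real (real n * \<tau> s n)) \<longlonglongrightarrow> \<i> * of_real s * (cnj a + b) - of_real (s\<^sup>2) / 2" .
    have "(\<lambda>n. 1 / sqrt (real n)) \<longlonglongrightarrow> 0" by real_asymp
    from tendsto_mult_right_zero[OF this, of "s / \<sigma>"] have \<tau>0: "\<tau> s \<longlonglongrightarrow> 0"
      by (simp add: \<tau>_def[abs_def])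
    have lim2: "(\<lambda>n. (1 - (cis (\<tau> s n))\<^sup>2 * of_real (t\<^sup>2)) powr (- 1 / 2)) \<longlonglongrightarrow> (1 - (cis 0)\<^sup>2 * of_real (t\<^sup>2)) powr (- 1 / 2)"
    proof (intro tendsto_powr_complex tendsto_intros \<tau>0)
      have "1 - (cis 0)\<^sup>2 * of_real (t\<^sup>2) = complex_of_real (1 - t\<^sup>2)" by simp
      then show "1 - (cis 0)\<^sup>2 * complex_of_real (t\<^sup>2) \<notin> \<real>\<^sub>\<le>\<^sub>0"
        using one_minus_t2_pos[OF t] by (simp only: nonpos_Reals_of_real_iff not_le)
    qed
    \<comment> \<open>The extra factor \<open>cis (\<tau> s n)\<close> accounts for centring at one
      less than the number of summands; it tends to 1.\<close>
    have "(\<lambda>n. coherent a b * (of_real (sqrt (1 - t\<^sup>2)) * (1 - (cis (\<tau> s n))\<^sup>2 * of_real (t\<^sup>2)) powr (- 1 / 2))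
        * (exp (D n - \<i> * of_real (real n * \<tau> s n)) * cis (\<tau> s n)))
      \<longlonglongrightarrow> coherent a b * (of_real (sqrt (1 - t\<^sup>2)) * (1 - (cis 0)\<^sup>2 * of_real (t\<^sup>2)) powr (- 1 / 2))
        * (exp (\<i> * of_real s * (cnj a + b) - of_real (s\<^sup>2) / 2) * cis 0)"
      by (intro tendsto_intros lim1 lim2 \<tau>0)
    also have "coherent a b * (of_real (sqrt (1 - t\<^sup>2)) * (1 - (cis 0)\<^sup>2 * of_real (t\<^sup>2)) powr (- 1 / 2))
        * (exp (\<i> * of_real s * (cnj a + b) - of_real (s\<^sup>2) / 2) * cis 0)
      = coherent a b * exp (\<i> * of_real s * (cnj a + b) - of_real (s\<^sup>2) / 2)"
      using normalisation[OF t] by simp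
    finally have lim: "(\<lambda>n. coherent a b * (of_real (sqrt (1 - t\<^sup>2)) * (1 - (cis (\<tau> s n))\<^sup>2 * of_real (t\<^sup>2)) powr (- 1 / 2))
        * (exp (D n - \<i> * of_real (real n * \<tau> s n)) * cis (\<tau> s n)))
      \<longlonglongrightarrow> coherent a b * exp (\<i> * of_real s * (cnj a + b) - of_real (s\<^sup>2) / 2)" .
    have "(\<Sum>k. cnj (level_amplitude t z0 \<psi> a (Suc m) k) * level_amplitude t z0 \<psi> b (Suc m) k * cis (s * Y m k))
      = coherent a b * (of_real (sqrt (1 - t\<^sup>2)) * (1 - (cis (\<tau> s (Suc m)))\<^sup>2 * of_real (t\<^sup>2)) powr (- 1 / 2))
        * (exp (D (Suc m) - \<i> * of_real (real (Suc m) * \<tau> s (Suc m))) * cis (\<tau> s (Suc m)))" for m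
    proof -
      define n where "n = Suc m"
      define e where "e = cis (- (real m * \<tau> s n))"
      have n0: "n > 0" by (simp add: n_def)
      have rt: "cmod (cis (\<tau> s n)) * t < 1" using t by simp
      have "cis (s * Y m k) = cis (\<tau> s n) ^ k * e" for k
        unfolding e_def Complex.DeMoivre cis_mult
        by (rule arg_cong[of _ _ cis]) (simp add: Y_def \<tau>_def n_def diff_divide_distrib algebra_simps)
      moreover have "exp (- \<i> * of_real (real n * \<tau> s n)) * cis (\<tau> s n) = e"
        unfolding e_def n_def cis_conv_exp mult_exp_exp
        by (rule arg_cong[of _ _ exp]) (simp add: algebra_simps)
      ultimately have "(\<lambda>k. cnj (level_amplitude t z0 \<psi> a n k) * level_amplitude t z0 \<psi> b n k * cis (s * Y m k)) sums
         (coherent a b * (of_real (sqrt (1 - t\<^sup>2)) * (1 - (cis (\<tau> s n))\<^sup>2 * of_real (t\<^sup>2)) powr (- 1 / 2))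
          * exp (D n) * (exp (- \<i> * of_real (real n * \<tau> s n)) * cis (\<tau> s n)))"
        using sums_mult2[OF amplitude_generating_function[OF t n0 rt, of z0 \<psi> a b], of e]
        by (simp only: mult.assoc D_def)
      note sums = this
      have "exp (D n) * (exp (- \<i> * of_real (real n * \<tau> s n)) * cis (\<tau> s n))
          = exp (D n - \<i> * of_real (real n * \<tau> s n)) * cis (\<tau> s n)"
        by (simp add: mult.assoc[symmetric] mult_exp_exp)
      then show ?thesis
        using sums_unique[OF sums] unfolding n_def[symmetric] by (simp only: mult.assoc)
    qed
    then show ?thesis
      using LIMSEQ_Suc[OF lim] by simp
  qed
  define \<phi> where "\<phi> i n = level_amplitude t z0 \<psi> (if i then b else a) (Suc n)" for i n
  define f where "f i = gauss_wave (if i then b else a)" for i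
  have "(\<lambda>n. \<Sum>k. if Y n k \<le> 0 then cnj (\<phi> False n k) * \<phi> True n k else 0)
     \<longlonglongrightarrow> (LINT y|lborel. indicator {..0} y * (cnj (f False y) * f True y))"
  proof (rule levy_continuity_sesquilinear)
    show "summable (\<lambda>k. (cmod (\<phi> i n k))\<^sup>2)" for i n
      unfolding \<phi>_def by (rule summable_amplitude[OF t]) simp
    show "f i \<in> borel_measurable borel" for i
      unfolding f_def by (rule borel_measurable_continuous_onI[OF continuous_gauss_wave])
    show "integrable lborel (\<lambda>y. (cmod (f i y))\<^sup>2)" for i
      unfolding f_def by (rule integrable_gauss_wave)
    show "(\<lambda>n. \<Sum>k. cnj (\<phi> i n k) * \<phi> j n k * cis (s * Y n k))
        \<longlonglongrightarrow> (LINT y|lborel. cnj (f i y) * f j y * cis (s * y))" for i j s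
      unfolding f_def \<phi>_def integral_gauss_wave by (rule char_limit)
  qed
  also have "(LINT y|lborel. indicator {..0} y * (cnj (f False y) * f True y))
     = coherent a b * (erfc ((cnj a + b) / of_real (sqrt 2)) / 2)"
    unfolding f_def by (simp only: if_True if_False integral_gauss_wave_half)
  also have "(\<lambda>n. \<Sum>k. if Y n k \<le> 0 then cnj (\<phi> False n k) * \<phi> True n k else 0)
     = (\<lambda>n. \<Sum>k<Suc n. cnj (level_amplitude t z0 \<psi> a (Suc n) k) * level_amplitude t z0 \<psi> b (Suc n) k)"
  proof
    fix n
    have "Y n k \<le> 0 \<longleftrightarrow> k \<in> {..<Suc n}" for k
    proof -
      have "\<sigma> * sqrt (Suc n) > 0" using \<sigma> by simp
      then have "Y n k \<le> 0 \<longleftrightarrow> real k - real n \<le> 0" unfolding Y_def by (simp add: divide_le_0_iff)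
      then show ?thesis by auto
    qed
    then have "(\<Sum>k. if Y n k \<le> 0 then cnj (\<phi> False n k) * \<phi> True n k else 0)
      = (\<Sum>k. if k \<in> {..<Suc n} then cnj (\<phi> False n k) * \<phi> True n k else 0)" by (simp only:)
    also have "\<dots> = (\<Sum>k<Suc n. cnj (\<phi> False n k) * \<phi> True n k)"
      by (rule sums_unique[symmetric, OF sums_If_finite_set]) simp
    finally show "(\<Sum>k. if Y n k \<le> 0 then cnj (\<phi> False n k) * \<phi> True n k else 0)
      = (\<Sum>k<Suc n. cnj (level_amplitude t z0 \<psi> a (Suc n) k) * level_amplitude t z0 \<psi> b (Suc n) k)"
      by (simp only: \<phi>_def if_True if_False)
  qed
  finally show ?thesis by (rule LIMSEQ_imp_Suc)
qed

section \<open>The normal direction of the ellipse\<close>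

lemma cis_arctan: "cis (arctan v) = of_real (1 / sqrt (1 + v\<^sup>2)) * Complex 1 v"
  by (simp add: complex_eq_iff cos_arctan sin_arctan)

text \<open>The theorem ties \<psi> to \<open>z0\<close> only through a parameter of the ellipse, so
  a parameter in the prescribed range has to be exhibited. After rescaling the axes the point lies
  on the unit circle, and its \<open>Arg\<close> serves.\<close>

lemma ellipse_parametrization:
  assumes t: "0 < t" "t < 1" and E: "ellipse_form t z0 = 1"
  obtains \<phi> where "- pi < \<phi>" "\<phi> \<le> pi"
    "z0 = of_real (semi_a t * cos \<phi>) + \<i> * of_real (semi_b t * sin \<phi>)"
proof -
  have ab: "semi_a t > 0" "semi_b t > 0" using t by (simp_all add: semi_a_def semi_b_def)
  define w where "w = Complex (Re z0 / semi_a t) (Im z0 / semi_b t)"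
  have "(cmod w)\<^sup>2 = 1" using E by (simp add: w_def cmod_power2 ellipse_form_def power_divide)
  then have w1: "cmod w = 1" by (metis norm_ge_zero power2_eq_1_iff zero_le_one not_one_le_zero neg_0_le_iff_le)
  then have "cis (Arg w) = w" by (subst cis_Arg) (auto simp: sgn_eq)
  then have "cos (Arg w) = Re z0 / semi_a t" "sin (Arg w) = Im z0 / semi_b t"
    by (auto simp: w_def complex_eq_iff)
  then have "z0 = of_real (semi_a t * cos (Arg w)) + \<i> * of_real (semi_b t * sin (Arg w))"
    using ab by (simp add: complex_eq_iff)
  then show thesis using that[of "Arg w"] Arg_bounded[of w] by blast
qed

text \<open>The vector on the left is a positive multiple of the gradient of \<^const>\<open>ellipse_form\<close>.\<close>

lemma normal_angle_gradient:
  assumes t: "0 < t" "t < 1" and \<phi>: "- pi < \<phi>" "\<phi> \<le> pi"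
  obtains \<sigma> where "\<sigma> > 0"
    "of_real (1 - t\<^sup>2) * Complex (semi_a t * cos \<phi> / (1 + t)\<^sup>2) (semi_b t * sin \<phi> / (1 - t)\<^sup>2)
      = of_real \<sigma> * cis (normal_angle t \<phi>)"
proof -
  define q where "q = sqrt (1 - t\<^sup>2)"
  have q: "q > 0" using one_minus_t2_pos[OF t] by (simp add: q_def)
  have qq: "q\<^sup>2 = (1 + t) * (1 - t)" using one_minus_t2_pos[OF t] by (simp add: q_def power2_eq_square algebra_simps)
  have q_split: "q = sqrt (1 + t) * sqrt (1 - t)"
    using t unfolding q_def real_sqrt_mult[symmetric] by (simp add: power2_eq_square algebra_simps)
  have sa: "semi_a t = (1 + t) / q" and sb: "semi_b t = (1 - t) / q"
    using t unfolding semi_a_def semi_b_def q_split real_sqrt_divide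
    by (simp_all add: field_simps)
  have f: "1 - t\<^sup>2 = (1 + t) * (1 - t)" by (simp add: power2_eq_square algebra_simps)
  have cancel: "u * v * (u / q * C / u\<^sup>2) = v * C / q" "v * u * (u / q * C / u\<^sup>2) = v * C / q" if "u \<noteq> 0" for u v C :: real
    using that by (simp_all add: power2_eq_square)
  have G: "of_real (1 - t\<^sup>2) * Complex (semi_a t * cos \<phi> / (1 + t)\<^sup>2) (semi_b t * sin \<phi> / (1 - t)\<^sup>2)
     = Complex ((1 - t) * cos \<phi> / q) ((1 + t) * sin \<phi> / q)"
    using t cancel[of "1 + t" "1 - t" "cos \<phi>"] cancel[of "1 - t" "1 + t" "sin \<phi>"]
    unfolding sa sb f by (simp add: complex_eq_iff)
  define v where "v = (1 + t) / (1 - t) * tan \<phi>"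
  have G2: "Complex ((1 - t) * cos \<phi> / q) ((1 + t) * sin \<phi> / q)
      = of_real ((1 - t) * cos \<phi> / q * sqrt (1 + v\<^sup>2)) * cis (arctan v)" if "cos \<phi> \<noteq> 0"
  proof -
    have s: "sqrt (1 + v\<^sup>2) > 0" by (simp add: add_pos_nonneg)
    have "Complex ((1 - t) * cos \<phi> / q) ((1 + t) * sin \<phi> / q) = of_real ((1 - t) * cos \<phi> / q) * Complex 1 v"
      using that t q by (simp add: complex_eq_iff v_def tan_def)
    also have "\<dots> = of_real ((1 - t) * cos \<phi> / q * sqrt (1 + v\<^sup>2)) * (of_real (1 / sqrt (1 + v\<^sup>2)) * Complex 1 v)"
    proof -
      have "c * r * (1 / r) = c" if "r > 0" for c r :: real using that by simp
      then show ?thesis unfolding mult.assoc[symmetric] of_real_mult[symmetric] using s by (simp only:)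
    qed
    finally show ?thesis by (simp only: cis_arctan)
  qed
  have s: "sqrt (1 + v\<^sup>2) > 0" by (simp add: add_pos_nonneg)
  consider "\<phi> \<in> {- pi / 2<..<pi / 2}" | "\<phi> \<notin> {- pi / 2..pi / 2}" | "\<phi> = pi / 2" | "\<phi> = - pi / 2"
    by force
  then show thesis
  proof cases
    case 1
    then have c: "cos \<phi> > 0" by (intro cos_gt_zero_pi) auto
    have "normal_angle t \<phi> = arctan v" using 1 by (simp add: normal_angle_def v_def)
    then show ?thesis
      using that[of "(1 - t) * cos \<phi> / q * sqrt (1 + v\<^sup>2)"] G G2 c t q s by simp
  next
    case 2
    have c: "cos \<phi> < 0"
    proof (cases "\<phi> > 0")
      case True
      then have "cos (pi - \<phi>) > 0" using 2 \<phi> by (intro cos_gt_zero_pi) auto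
      then show ?thesis by simp
    next
      case False
      then have "cos (\<phi> + pi) > 0" using 2 \<phi> by (intro cos_gt_zero_pi) auto
      then show ?thesis by simp
    qed
    \<comment> \<open>Hence \<open>sgn \<phi>\<close> is 1 or -1, and adding that multiple of
      \<open>pi\<close> just flips the sign of \<open>cis\<close>. The flip compensates the negative
      cosine.\<close>
    have "\<phi> \<noteq> 0" using 2 by auto
    then have "cis (normal_angle t \<phi>) = - cis (arctan v)"
      using 2 by (auto simp: normal_angle_def v_def complex_eq_iff sgn_if)
    then show ?thesis
      using that[of "- ((1 - t) * cos \<phi> / q * sqrt (1 + v\<^sup>2))"] G G2 c t q s
      by (simp add: mult_neg_pos divide_neg_pos mult_pos_neg)
  next
    case 3
    have "cis (normal_angle t \<phi>) = \<i>" "cos \<phi> = 0" "sin \<phi> = 1"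
      unfolding 3 by (simp_all add: normal_angle_def complex_eq_iff)
    then show ?thesis using that[of "(1 + t) / q"] G t q by (simp add: complex_eq_iff)
  next
    case 4
    have "cis (normal_angle t \<phi>) = - \<i>" "cos \<phi> = 0" "sin \<phi> = - 1"
      unfolding 4 by (simp_all add: normal_angle_def complex_eq_iff)
    then show ?thesis using that[of "(1 + t) / q"] G t q by (simp add: complex_eq_iff)
  qed
qed

theorem theorem8p13:
  fixes t \<psi> :: real and a b z0 :: complex
  assumes "0 < t" and "t < 1"
    and "- pi < \<psi>" and "\<psi> \<le> pi"
    and "\<And>\<phi>. \<lbrakk>z0 \<in> ellipse t; - pi < \<phi>; \<phi> \<le> pi;
               z0 = of_real (semi_a t * cos \<phi>) + \<i> * of_real (semi_b t * sin \<phi>)\<rbrakk>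
             \<Longrightarrow> \<psi> = normal_angle t \<phi>"
  shows "(\<lambda>n. reproducing_kernel (elliptic_potential t) n
                (z0 + a * cis \<psi> / of_real (sqrt (real n)))
                (z0 + b * cis \<psi> / of_real (sqrt (real n))) / of_nat n
             - cis (phase t z0 \<psi> a b n) * of_real (exp (- (cmod (a - b))\<^sup>2 / 2)) * kappa t z0 a b)
         \<longlonglongrightarrow> 0"
proof -
  note t = \<open>0 < t\<close> \<open>t < 1\<close>
  \<comment> \<open>Removing the factor \<open>1 / pi\<close> of the kernel leaves 1,
    \<open>erfc (...) / 2\<close> or 0, the share of \<open>coherent a b\<close> that the first
    \<open>n\<close> summands retain in the limit.\<close>
  define \<kappa> where "\<kappa> = of_real pi * kappa t z0 a b"
  define S where "S n = (\<Sum>k<n. cnj (level_amplitude t z0 \<psi> a n k) * level_amplitude t z0 \<psi> b n k)" for n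
  have "S \<longlonglongrightarrow> coherent a b * \<kappa>"
  proof (cases "ellipse_form t z0" "1 :: real" rule: linorder_cases)
    case less
    then have "\<kappa> = 1" by (simp add: \<kappa>_def kappa_def ellipse_inside_def)
    then show ?thesis using inside_limit[OF t less] by (simp add: S_def[abs_def])
  next
    case equal
    then have \<kappa>: "\<kappa> = erfc ((cnj a + b) / of_real (sqrt 2)) / 2"
      by (simp add: \<kappa>_def kappa_def ellipse_inside_def ellipse_def)
    obtain \<phi> where \<phi>: "- pi < \<phi>" "\<phi> \<le> pi"
      and z0: "z0 = of_real (semi_a t * cos \<phi>) + \<i> * of_real (semi_b t * sin \<phi>)"
      using ellipse_parametrization[OF t equal] by blast
    have \<psi>: "\<psi> = normal_angle t \<phi>"
      using assms(5)[OF _ \<phi> z0] equal by (simp add: ellipse_def)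
    obtain \<sigma> where \<sigma>: "\<sigma> > 0"
      "of_real (1 - t\<^sup>2) * Complex (semi_a t * cos \<phi> / (1 + t)\<^sup>2) (semi_b t * sin \<phi> / (1 - t)\<^sup>2)
        = of_real \<sigma> * cis \<psi>"
      using normal_angle_gradient[OF t \<phi>] unfolding \<psi> by blast
    have "Re z0 = semi_a t * cos \<phi>" "Im z0 = semi_b t * sin \<phi>"
      using z0 by simp_all
    then show ?thesis
      using boundary_limit[OF t \<sigma>(1) equal, of \<psi> a b] \<sigma>(2) by (simp add: S_def[abs_def] \<kappa>)
  next
    case greater
    then have "\<kappa> = 0" by (simp add: \<kappa>_def kappa_def ellipse_inside_def ellipse_def)
    then show ?thesis using outside_limit[OF t greater] by (simp add: S_def[abs_def])
  qed
  then have "(\<lambda>n. S n - coherent a b * \<kappa>) \<longlonglongrightarrow> 0"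
    by (rule LIM_zero)
  then have lim: "(\<lambda>n. norm (S n - coherent a b * \<kappa>) * (1 / pi)) \<longlonglongrightarrow> 0"
    by (intro tendsto_mult_left_zero tendsto_norm_zero)
  \<comment> \<open>Kernel and claimed asymptotics share a unimodular factor \<open>g\<close> that
    may oscillate with \<open>n\<close>, so their difference is compared in norm, where
    \<open>g\<close> drops out. The kernel index must be positive, hence an eventual bound.\<close>
  have "\<forall>\<^sub>F n in sequentially. norm (reproducing_kernel (elliptic_potential t) n
                (z0 + a * cis \<psi> / of_real (sqrt (real n)))
                (z0 + b * cis \<psi> / of_real (sqrt (real n))) / of_nat n
             - cis (phase t z0 \<psi> a b n) * of_real (exp (- (cmod (a - b))\<^sup>2 / 2)) * kappa t z0 a b)
      \<le> norm (S n - coherent a b * \<kappa>) * (1 / pi)"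
    using eventually_gt_at_top[of 0]
  proof eventually_elim
    case (elim n)
    define g where "g = cis (gauge_phase t z0 \<psi> a n - gauge_phase t z0 \<psi> b n)"
    have 1: "reproducing_kernel (elliptic_potential t) n
                (z0 + a * cis \<psi> / of_real (sqrt (real n)))
                (z0 + b * cis \<psi> / of_real (sqrt (real n))) / of_nat n = of_real (1 / pi) * g * S n"
      using kernel_amplitudes[OF t elim, of z0 \<psi> a b] by (simp only: scaled_point_def g_def S_def)
    have 2: "cis (phase t z0 \<psi> a b n) * of_real (exp (- (cmod (a - b))\<^sup>2 / 2)) * kappa t z0 a b
       = of_real (1 / pi) * g * (coherent a b * \<kappa>)"
    proof -
      have "cis (phase t z0 \<psi> a b n) * of_real (exp (- (cmod (a - b))\<^sup>2 / 2)) = g * coherent a b"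
        unfolding phase_gauge_phase g_def cis_Im_coherent[symmetric] cis_mult[symmetric] by (simp only: mult.assoc)
      then show ?thesis by (simp add: \<kappa>_def)
    qed
    show ?case
      unfolding 1 2 right_diff_distrib[symmetric] by (simp add: norm_mult norm_divide g_def)
  qed
  then show ?thesis by (rule Lim_null_comparison[OF _ lim])
qed

end
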